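(* Let $0\le\rho<s$, $a\in L^\infty(\mathbb{R};\mathbb{R})$ (and fix $0<\Lambda<\frac12$ if $0<s<1$). For $u_0\in H^s(\mathbb{T})$ let $u$ and $u_h$ denote the solutions of the magnetic NLS with data $u_0$ and of the lattice equation with data $u_h(0)=P_\chi\Pi_hu_0$, respectively, both with $\mu=-1$ (focusing). There exists $R>0$ such that, for any $\theta>0$ and $p\ge0$, there do not exist $C>0$ and $h_0>0$ for which $$\|\mathcal{S}_hu_h(t)-u(t)\|_{H^\rho(\mathbb{T})}\le C\,h^\theta\langle t\rangle^p$$ holds for all admissible $0<h\le h_0$, all $u_0$ with $\|u_0\|_{H^s}\le R$, and all $t\in\mathbb{R}$.
   Context: Notation: $\langle x\rangle=(1+x^2)^{1/2}$; $\mathbb{T}=\mathbb{R}/(2\pi\mathbb{Z})$ is identified with $[-\pi,\pi)$. A mesh size $h$ is admissible if $h=\pi/M$ with $M\in\mathbb{N}$; then $\mathbb{T}_h=\{hj:-M\le j\le M-1\}$ (periodic lattice) and $\mathbb{T}_h^*=\{-M,\dots,M-1\}$. Fourier coefficients: $\widehat f(k)=\frac1{2\pi}\int_{\mathbb{T}}f(x)e^{-ikx}dx$, $k\in\mathbb{Z}$, for $f$ on $\mathbb{T}$; $\widehat g(k)=\frac{h}{2\pi}\sum_{x\in\mathbb{T}_h}g(x)e^{-ikx}$, $k\in\mathbb{T}_h^*$, for $g$ on $\mathbb{T}_h$. $\|f\|_{H^s}^2=\sum_{k\in\mathbb{Z}}\langle k\rangle^{2s}|\widehat f(k)|^2$.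 Cell average: $\Pi_hf(x)=\frac1h\int_{x-h/2}^{x+h/2}f(y)dy$, $x\in\mathbb{T}_h$. Shannon interpolation: $\mathcal{S}_hg(x)=\sum_{k\in\mathbb{T}_h^*}\widehat g(k)e^{ikx}$, $x\in\mathbb{T}$. The projector $P_\chi$ is $\widehat{P_\chi f}(k)=\chi(k)\widehat f(k)$, where $\chi=\mathbf{1}_{E_h}$, $E_h=\{k\in\mathbb{T}_h^*:|hk|\le\Lambda\pi\}$, if $0<s<1$, and $\chi\equiv1$ if $s\ge1$. Magnetic NLS: $i\partial_tu=-(\partial_x-ia(t))^2u+\mu|u|^2u$ on $\mathbb{T}\times\mathbb{R}$, $u(\cdot,0)=u_0$. Its solution is the global solution $u(t)=\mathcal{G}_a(t)^{-1}\Phi_tu_0$, where $\Phi_t$ is the (globally defined on $L^2(\mathbb{T})$) flow of the cubic NLS $i\partial_tv=-\partial_x^2v+\mu|v|^2v$ and $(\mathcal{G}_a(t)f)(x)=\exp(i\int_0^ta(\tau)^2d\tau)f(x-2\int_0^ta(\tau)d\tau)$. Lattice equation: $i\partial_tu_h=-\Delta_{h,a(t)}u_h+\mu P_\chi(|P_\chi u_h|^2P_\chi u_h)$ on $\mathbb{T}_h$, $u_h(0)=P_\chi\Pi_hu_0$, where $\Delta_{h,a(t)}f(x)=h^{-2}\left(e^{-iha(t)}f(x+h)-2f(x)+e^{iha(t)}f(x-h)\right)$. It is a finite-dimensional ODE whose global solution is absolutely continuous in time and satisfies the equation for a.e. $t$. *)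

theory Defs
  imports "HOL-Analysis.Analysis"
begin

(* Functions on the torus, and on the periodic lattice, are 2 pi-periodic functions on the reals;
   of a lattice function only the values at the points of lattice M are ever used. *)

definition japanese :: "real \<Rightarrow> real" where
  "japanese x = sqrt (1 + x\<^sup>2)"

definition fourier_coeff :: "(real \<Rightarrow> complex) \<Rightarrow> int \<Rightarrow> complex" where
  "fourier_coeff f k =
     complex_of_real (1 / (2 * pi)) * (LINT x=-pi..pi|lebesgue. (f x * cis (- (of_int k * x))))"

definition in_L2 :: "(real \<Rightarrow> complex) \<Rightarrow> bool" where
  "in_L2 f \<longleftrightarrow> periodic_fun_simple f (2 * pi) \<and> f \<in> borel_measurable lebesgue \<and>
     interval_lebesgue_integrable lebesgue (-pi) pi (\<lambda>x. (cmod (f x))\<^sup>2)"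

definition L2_norm :: "(real \<Rightarrow> complex) \<Rightarrow> real" where
  "L2_norm f = sqrt (LINT x=-pi..pi|lebesgue. ((cmod (f x))\<^sup>2))"

(* Sobolev space of order s \<ge> 0; Hs_norm is meaningful for members of in_Hs only. *)
definition in_Hs :: "real \<Rightarrow> (real \<Rightarrow> complex) \<Rightarrow> bool" where
  "in_Hs s f \<longleftrightarrow> in_L2 f \<and>
     (\<lambda>k::int. japanese (of_int k) powr (2 * s) * (cmod (fourier_coeff f k))\<^sup>2) summable_on UNIV"

definition Hs_norm :: "real \<Rightarrow> (real \<Rightarrow> complex) \<Rightarrow> real" where
  "Hs_norm s f =
     sqrt (\<Sum>\<^sub>\<infinity>k::int. japanese (of_int k) powr (2 * s) * (cmod (fourier_coeff f k))\<^sup>2)"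

definition in_Linfinity :: "(real \<Rightarrow> real) \<Rightarrow> bool" where
  "in_Linfinity a \<longleftrightarrow> a \<in> borel_measurable lebesgue \<and> (\<exists>B. AE t in lebesgue. \<bar>a t\<bar> \<le> B)"


(* Global L^2 solutions of  i v_t = - v_xx + mu |v|^2 v,  v(0) = v0,  i.e. the trajectories of the
   flow on L^2 of the torus: Duhamel's formula, mode by mode, in the class
   C(R; L^2) \<inter> L^4_loc(R; L^4), in which Bourgain's L^4 Strichartz estimate gives existence and
   uniqueness for every v0 in L^2 (up to null sets in x for each t). The L^4 bound makes |v|^2 v
   integrable on bounded time intervals, so that its Fourier coefficients exist for a.e. time. *)
definition cubic_nls_solution ::
  "real \<Rightarrow> (real \<Rightarrow> complex) \<Rightarrow> (real \<Rightarrow> real \<Rightarrow> complex) \<Rightarrow> bool" where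
  "cubic_nls_solution \<mu> v0 v \<longleftrightarrow>
     (\<lambda>(t, x). v t x) \<in> borel_measurable lebesgue \<and>
     (\<forall>t. in_L2 (v t)) \<and>
     (\<forall>t. ((\<lambda>\<tau>. L2_norm (\<lambda>x. v \<tau> x - v t x)) \<longlongrightarrow> 0) (at t)) \<and>
     (\<forall>T>0. set_integrable lebesgue ({-T..T} \<times> {-pi..pi}) (\<lambda>(t, x). cmod (v t x) ^ 4)) \<and>
     (\<forall>t k. fourier_coeff (v t) k =
        cis (- ((of_int k)\<^sup>2 * t)) * fourier_coeff v0 k
        - \<i> * complex_of_real \<mu> *
          (LINT \<tau>=0..t|lebesgue. (cis (- ((of_int k)\<^sup>2 * (t - \<tau>))) *
             fourier_coeff (\<lambda>x. complex_of_real ((cmod (v \<tau> x))\<^sup>2) * v \<tau> x) k)))"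

definition gauge_transform ::
  "(real \<Rightarrow> real) \<Rightarrow> real \<Rightarrow> (real \<Rightarrow> complex) \<Rightarrow> real \<Rightarrow> complex" where
  "gauge_transform a t f = (\<lambda>x. cis (LINT \<tau>=0..t|lebesgue. ((a \<tau>)\<^sup>2)) *
     f (x - 2 * (LINT \<tau>=0..t|lebesgue. (a \<tau>))))"

definition magnetic_nls_solution ::
  "(real \<Rightarrow> real) \<Rightarrow> real \<Rightarrow> (real \<Rightarrow> complex) \<Rightarrow> (real \<Rightarrow> real \<Rightarrow> complex) \<Rightarrow> bool" where
  "magnetic_nls_solution a \<mu> u0 u \<longleftrightarrow>
     (\<exists>v. cubic_nls_solution \<mu> u0 v \<and> (\<forall>t. u t = inv (gauge_transform a t) (v t)))"


(* The admissible mesh sizes are h = mesh M with M > 0. *)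
definition mesh :: "nat \<Rightarrow> real" where
  "mesh M = pi / real M"

definition dual_lattice :: "nat \<Rightarrow> int set" where
  "dual_lattice M = {- int M..int M - 1}"

definition lattice :: "nat \<Rightarrow> real set" where
  "lattice M = (\<lambda>j. mesh M * of_int j) ` {- int M..int M - 1}"

definition lattice_fourier_coeff :: "nat \<Rightarrow> (real \<Rightarrow> complex) \<Rightarrow> int \<Rightarrow> complex" where
  "lattice_fourier_coeff M g k =
     complex_of_real (mesh M / (2 * pi)) * (\<Sum>x\<in>lattice M. g x * cis (- (of_int k * x)))"

definition cell_average :: "nat \<Rightarrow> (real \<Rightarrow> complex) \<Rightarrow> real \<Rightarrow> complex" where
  "cell_average M f x =
     complex_of_real (1 / mesh M) * (LINT y=x - mesh M / 2..x + mesh M / 2|lebesgue. (f y))"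

definition shannon :: "nat \<Rightarrow> (real \<Rightarrow> complex) \<Rightarrow> real \<Rightarrow> complex" where
  "shannon M g x = (\<Sum>k\<in>dual_lattice M. lattice_fourier_coeff M g k * cis (of_int k * x))"

definition cutoff :: "real \<Rightarrow> real \<Rightarrow> nat \<Rightarrow> int \<Rightarrow> complex" where
  "cutoff s \<Lambda> M k =
     (if s < 1 then indicator {k \<in> dual_lattice M. \<bar>mesh M * of_int k\<bar> \<le> \<Lambda> * pi} k else 1)"

(* The lattice function whose lattice Fourier coefficients are those of g times the cutoff. *)
definition projector ::
  "real \<Rightarrow> real \<Rightarrow> nat \<Rightarrow> (real \<Rightarrow> complex) \<Rightarrow> real \<Rightarrow> complex" where
  "projector s \<Lambda> M g x =
     (\<Sum>k\<in>dual_lattice M. cutoff s \<Lambda> M k * lattice_fourier_coeff M g k * cis (of_int k * x))"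

definition magnetic_laplacian :: "nat \<Rightarrow> real \<Rightarrow> (real \<Rightarrow> complex) \<Rightarrow> real \<Rightarrow> complex" where
  "magnetic_laplacian M \<alpha> f x =
     (cis (- (mesh M * \<alpha>)) * f (x + mesh M) - 2 * f x + cis (mesh M * \<alpha>) * f (x - mesh M))
       / complex_of_real ((mesh M)\<^sup>2)"

definition absolutely_continuous_on :: "real set \<Rightarrow> (real \<Rightarrow> complex) \<Rightarrow> bool" where
  "absolutely_continuous_on I f \<longleftrightarrow>
     (\<forall>\<epsilon>>0. \<exists>\<delta>>0. \<forall>(n::nat) l r.
        (\<forall>i<n. l i \<in> I \<and> r i \<in> I \<and> l i \<le> r i) \<and>
        disjoint_family_on (\<lambda>i. {l i<..<r i}) {..<n} \<and>
        (\<Sum>i<n. r i - l i) < \<delta> \<longrightarrow>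
        (\<Sum>i<n. cmod (f (r i) - f (l i))) < \<epsilon>)"

definition lattice_solution ::
  "real \<Rightarrow> real \<Rightarrow> (real \<Rightarrow> real) \<Rightarrow> real \<Rightarrow> nat \<Rightarrow> (real \<Rightarrow> complex) \<Rightarrow>
   (real \<Rightarrow> real \<Rightarrow> complex) \<Rightarrow> bool" where
  "lattice_solution s \<Lambda> a \<mu> M u0 w \<longleftrightarrow>
     (\<forall>t. periodic_fun_simple (w t) (2 * pi)) \<and>
     (\<forall>x\<in>lattice M. \<forall>T>0. absolutely_continuous_on {-T..T} (\<lambda>t. w t x)) \<and>
     (\<forall>x\<in>lattice M. w 0 x = projector s \<Lambda> M (cell_average M u0) x) \<and>
     (AE t in lebesgue. \<forall>x\<in>lattice M. \<exists>D.
        ((\<lambda>\<tau>. w \<tau> x) has_vector_derivative D) (at t) \<and>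
        \<i> * D = - magnetic_laplacian M (a t) (w t) x
          + complex_of_real \<mu> * projector s \<Lambda> M
              (\<lambda>y. complex_of_real ((cmod (projector s \<Lambda> M (w t) y))\<^sup>2) *
                   projector s \<Lambda> M (w t) y) x)"

end

(* The datum 1 + d (1 + i) (cos x + (2M + 1) cos ((2M + 1) x)) has all its cell averages equal to 1:
   its high frequency is aliased onto frequency one and cancels it. So the lattice solution stays
   constant in space, and the error bounds every nonzero Fourier coefficient of the NLS solution.
   The plane wave of amplitude 1 is modulationally unstable exactly at the frequencies 1 and -1, with
   growth rate 1. With d = M^(-q), the NLS solution therefore has a nonzero mode of size 1/10000 at
   some time of order log M, whereas the error bound at such times is M^(-theta) up to logarithms.

   For the growth, write c_k for the Fourier coefficients and z for the part of the solution of mean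
   zero. Conservation of energy controls the stable modes: |z|^2 <= D(0) + 2 (|c_1|^2 + |c_(-1)|^2) in
   L^2 while z is small, where D(0) is the initial Dirichlet energy. Then Z = Im (cnj c_0 ^2 c_1 c_(-1))
   satisfies Z' >= Z - 26 D(0)^2 without any bootstrap. The estimate is proved for Galerkin
   approximations, with constants independent of the truncation. The same approximations yield the NLS
   solution by Arzela-Ascoli, which needs the H^1 bound from mass and energy but no uniqueness. *)
theory Submission
  imports Defs "HOL-Complex_Analysis.Great_Picard" "HOL-Real_Asymp.Real_Asymp"
begin

section \<open>Primitives and global solutions of Lipschitz equations\<close>

text \<open>The refuted estimate speaks about every pair of solutions, so a single pair that
  violates it is enough: existence has to be proved on both sides, uniqueness on neither. The
  potential \<open>a\<close> is harmless. On the torus the gauge is a translation and a constant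
  phase, which keep the moduli of Fourier coefficients; on the lattice it only turns the phase of a
  constant. The obstacle is the high mode that aliasing requires. Its Dirichlet energy is about M^4
  d^2, far above the size d^2 of Z(0), so an error linear in D(0) would swamp the instability. The
  error in the inequality for Z is quadratic in D(0), of size M^8 d^4, and a high power of 1/M as d
  makes this negligible against d^2. A second difficulty is that the time and the frequency at which
  a Galerkin solution leaves the plane wave depend on the truncation. The frequency ranges over a
  fixed finite set because the Dirichlet energy is bounded uniformly. The times lie in a compact
  interval, and the limit is therefore taken along convergent sequences of times, not at a fixed
  time.\<close>

definition prim :: "(real \<Rightarrow> 'a::banach) \<Rightarrow> real \<Rightarrow> 'a" where
  "prim g t = (if 0 \<le> t then integral {0..t} g else - integral {t..0} g)"

text \<open>With a base point to the left of all times considered, the distinction by the sign of t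
  disappears, and results on integrals over intervals starting at -T apply on both sides of
  0.\<close>

lemma prim_shift:
  fixes g :: "real \<Rightarrow> 'a::banach"
  assumes "\<And>a b. g integrable_on {a..b}" and "\<bar>t\<bar> \<le> T"
  shows "prim g t = integral {-T..t} g - integral {-T..0} g"
proof (cases "0 \<le> t")
  case True
  have "integral {-T..0} g + integral {0..t} g = integral {-T..t} g"
    by (rule Henstock_Kurzweil_Integration.integral_combine) (use assms True in auto)
  then show ?thesis using True by (simp add: prim_def algebra_simps)
next
  case False
  have "integral {-T..t} g + integral {t..0} g = integral {-T..0} g"
    by (rule Henstock_Kurzweil_Integration.integral_combine) (use assms False in auto)
  then show ?thesis using False by (simp add: prim_def algebra_simps)
qed

lemma prim_0 [simp]: "prim g 0 = 0"
  by (simp add: prim_def)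

lemma prim_has_vector_derivative:
  fixes g :: "real \<Rightarrow> 'a::banach"
  assumes "continuous_on UNIV g"
  shows "(prim g has_vector_derivative g t) (at t)"
proof -
  define T where "T = \<bar>t\<bar> + 1"
  have int: "g integrable_on {a..b}" for a b
    by (rule integrable_continuous_real) (rule continuous_on_subset[OF assms], simp)
  have "((\<lambda>u. integral {-T..u} g) has_vector_derivative g t) (at t within {-T..T})"
    by (rule integral_has_vector_derivative) (use assms in \<open>auto simp: T_def intro: continuous_on_subset\<close>)
  then have "((\<lambda>u. integral {-T..u} g) has_vector_derivative g t) (at t within {-T<..<T})"
    by (rule has_vector_derivative_within_subset) auto
  then have "((\<lambda>u. integral {-T..u} g) has_vector_derivative g t) (at t)"
    by (subst (asm) has_vector_derivative_within_open) (auto simp: T_def)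
  then have "((\<lambda>u. integral {-T..u} g - integral {-T..0} g) has_vector_derivative g t) (at t)"
    by (auto intro!: derivative_eq_intros)
  then show ?thesis
  proof (rule has_vector_derivative_transform_within_open[of _ _ _ "{-T<..<T}"])
    show "integral {-T..u} g - integral {-T..0} g = prim g u" if "u \<in> {-T<..<T}" for u
      using prim_shift[of g u T] int that by auto
  qed (auto simp: T_def)
qed

lemma prim_eq_diff:
  fixes f :: "real \<Rightarrow> 'a::banach"
  assumes "\<And>t. (f has_vector_derivative g t) (at t)"
  shows "prim g t = f t - f 0"
proof (cases "0 \<le> t")
  case True
  have "(g has_integral (f t - f 0)) {0..t}"
    by (rule fundamental_theorem_of_calculus[OF True])
      (use assms in \<open>auto intro: has_vector_derivative_at_within\<close>)
  then show ?thesis using True by (simp add: prim_def integral_unique)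
next
  case False
  have "(g has_integral (f 0 - f t)) {t..0}"
    by (rule fundamental_theorem_of_calculus)
      (use assms False in \<open>auto intro: has_vector_derivative_at_within\<close>)
  then show ?thesis using False by (simp add: prim_def integral_unique)
qed

lemma set_integrable_lebesgue_continuous:
  fixes g :: "real \<Rightarrow> 'a::euclidean_space"
  assumes "continuous_on {a..b} g"
  shows "set_integrable lebesgue {a..b} g"
  using absolutely_integrable_continuous[of a b g] assms by simp

text \<open>The definitions use interval Lebesgue integrals, which are taken over open intervals,
  whereas the calculus below uses Henstock-Kurzweil integrals over closed ones. This lemma and the
  next translate.\<close>

lemma LINT_lebesgue_eq_integral:
  fixes g :: "real \<Rightarrow> 'a::euclidean_space"
  assumes "set_integrable lebesgue {a..b} g" "a \<le> b"
  shows "(LINT x=a..b|lebesgue. g x) = integral {a..b} g"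
proof -
  have eq: "einterval (ereal a) (ereal b) = {a<..<b}" by auto
  have s: "set_integrable lebesgue {a<..<b} g"
    by (rule set_integrable_subset[OF assms(1)]) auto
  have "(LINT x:{a<..<b}|lebesgue. g x) = integral {a<..<b} g"
    using s by (rule set_lebesgue_integral_eq_integral)
  also have "\<dots> = integral {a..b} g"
    by (metis integral_open_interval interval_cbox(1) box_real(1) cbox_interval)
  finally show ?thesis
    using assms(2) by (simp add: interval_lebesgue_integral_def eq)
qed

lemma LINT_lebesgue_eq_prim:
  fixes g :: "real \<Rightarrow> 'a::euclidean_space"
  assumes "\<And>a b. set_integrable lebesgue {a..b} g"
  shows "(LINT \<tau>=0..t|lebesgue. g \<tau>) = prim g t"
proof (cases "0 \<le> t")
  case True
  then show ?thesis
    using LINT_lebesgue_eq_integral[of 0 t g] assms by (simp add: prim_def zero_ereal_def)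
next
  case False
  have "(LINT \<tau>=0..t|lebesgue. g \<tau>) = - (LINT \<tau>=t..0|lebesgue. g \<tau>)"
    using False by (simp add: interval_lebesgue_integral_def)
  then show ?thesis
    using LINT_lebesgue_eq_integral[of t 0 g] assms False by (simp add: prim_def zero_ereal_def)
qed

text \<open>Integration gains the factor 1 / (2 L) on functions that grow like exp (2 L |t|).
  Against a Lipschitz constant L this leaves 1/2, which makes the Picard map a contraction on the
  whole line.\<close>

lemma norm_prim_le_exp:
  fixes g :: "real \<Rightarrow> 'a::banach"
  assumes "continuous_on UNIV g" and L: "L > 0"
    and b: "\<And>\<tau>. norm (g \<tau>) \<le> K * exp (2 * L * \<bar>\<tau>\<bar>)"
  shows "norm (prim g t) \<le> K / (2 * L) * (exp (2 * L * \<bar>t\<bar>) - 1)"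
proof -
  have int: "g integrable_on {a..b}" for a b
    by (rule integrable_continuous_real) (rule continuous_on_subset[OF assms(1)], simp)
  show ?thesis
  proof (cases "0 \<le> t")
    case True
    have I: "((\<lambda>\<tau>. K * exp (2 * L * \<tau>)) has_integral
        (K / (2 * L) * exp (2 * L * t) - K / (2 * L) * exp (2 * L * 0))) {0..t}"
      by (rule fundamental_theorem_of_calculus[OF True])
        (use L in \<open>auto intro!: derivative_eq_intros simp: has_real_derivative_iff_has_vector_derivative[symmetric]\<close>)
    have "norm (integral {0..t} g) \<le> integral {0..t} (\<lambda>\<tau>. K * exp (2 * L * \<tau>))"
      by (rule integral_norm_bound_integral)
        (use int b I in \<open>auto simp: has_integral_integrable dest: order_trans[OF b] intro!: order_trans[OF b]\<close>)
    then show ?thesis using True integral_unique[OF I] by (simp add: prim_def algebra_simps)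
  next
    case False
    have I: "((\<lambda>\<tau>. K * exp (- 2 * L * \<tau>)) has_integral
        (- K / (2 * L) * exp (- 2 * L * 0) - (- K / (2 * L) * exp (- 2 * L * t)))) {t..0}"
      by (rule fundamental_theorem_of_calculus)
        (use L False in \<open>auto intro!: derivative_eq_intros simp: has_real_derivative_iff_has_vector_derivative[symmetric]\<close>)
    have "norm (integral {t..0} g) \<le> integral {t..0} (\<lambda>\<tau>. K * exp (- 2 * L * \<tau>))"
      by (rule integral_norm_bound_integral)
        (use int b I in \<open>auto simp: has_integral_integrable intro!: order_trans[OF b]\<close>)
    then show ?thesis using False integral_unique[OF I] by (simp add: prim_def algebra_simps)
  qed
qed

text \<open>Picard iteration in the supremum norm weighted by exp (-2 L |t|): one application of the
  fixed point theorem gives the solution for all times, with no continuation of local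
  solutions.\<close>

theorem lipschitz_ode_global_solution:
  fixes F :: "'a::banach \<Rightarrow> 'a" and u0 :: 'a
  assumes L0: "\<And>x y. dist (F x) (F y) \<le> L0 * dist x y"
  obtains u where "u 0 = u0" "\<And>t. (u has_vector_derivative F (u t)) (at t)"
proof -
  define L where "L = \<bar>L0\<bar> + 1"
  have Lpos: "L > 0" by (simp add: L_def)
  have lip: "dist (F x) (F y) \<le> L * dist x y" for x y
    by (rule order_trans[OF L0]) (auto simp: L_def intro!: mult_right_mono)
  have contF: "continuous_on UNIV F"
    by (rule lipschitz_on_continuous_on[of L]) (use lip Lpos in \<open>auto simp: lipschitz_on_def\<close>)
  \<comment> \<open>The unknown w is the weighted solution, u(t) = exp (2 L |t|) w(t); it is bounded
    even though u may grow exponentially, and so lives in the space of bounded continuous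
    functions.\<close>
  define G where "G w = (\<lambda>\<tau>. F (exp (2 * L * \<bar>\<tau>\<bar>) *\<^sub>R apply_bcontfun w \<tau>))" for w :: "real \<Rightarrow>\<^sub>C 'a"
  define U where "U w t = u0 + prim (G w) t" for w t
  define \<Phi> where "\<Phi> w = Bcontfun (\<lambda>t. exp (- (2 * L * \<bar>t\<bar>)) *\<^sub>R U w t)" for w
  have contG: "continuous_on UNIV (G w)" for w
    unfolding G_def by (rule continuous_on_compose2[OF contF]) (auto intro!: continuous_intros)
  have derU: "(U w has_vector_derivative G w t) (at t)" for w t
    unfolding U_def by (auto intro!: derivative_eq_intros prim_has_vector_derivative contG)
  have contU: "continuous_on UNIV (U w)" for w
    by (meson continuous_at_imp_continuous_on derU has_vector_derivative_continuous)
  have bG: "norm (G w \<tau>) \<le> (norm (F 0) + L * norm w) * exp (2 * L * \<bar>\<tau>\<bar>)" for w \<tau>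
  proof -
    let ?e = "exp (2 * L * \<bar>\<tau>\<bar>)"
    have e: "?e \<ge> 1" using Lpos by simp
    have "norm (G w \<tau>) \<le> norm (F 0) + dist (G w \<tau>) (F 0)"
      by (metis add.commute dist_norm norm_triangle_sub)
    also have "dist (G w \<tau>) (F 0) \<le> L * (?e * norm (apply_bcontfun w \<tau>))"
      unfolding G_def using lip[of "?e *\<^sub>R apply_bcontfun w \<tau>" 0] by simp
    also have "\<dots> \<le> L * (?e * norm w)"
      using Lpos by (intro mult_left_mono norm_bounded) auto
    also have "norm (F 0) \<le> norm (F 0) * ?e"
      using e by (simp add: mult_le_cancel_left1)
    finally show ?thesis by (simp add: algebra_simps)
  qed
  have bc: "(\<lambda>t. exp (- (2 * L * \<bar>t\<bar>)) *\<^sub>R U w t) \<in> bcontfun" for w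
    unfolding bcontfun_def
  proof (intro CollectI conjI)
    show "continuous_on UNIV (\<lambda>t. exp (- (2 * L * \<bar>t\<bar>)) *\<^sub>R U w t)"
      by (intro continuous_intros contU)
    show "bounded (range (\<lambda>t. exp (- (2 * L * \<bar>t\<bar>)) *\<^sub>R U w t))"
    proof (rule boundedI, clarsimp)
      fix t
      define K where "K = norm (F 0) + L * norm w"
      have K: "K \<ge> 0" using Lpos by (simp add: K_def)
      have "norm (prim (G w) t) \<le> K / (2 * L) * (exp (2 * L * \<bar>t\<bar>) - 1)"
        using norm_prim_le_exp[OF contG Lpos, of w K] bG by (simp add: K_def)
      also have "\<dots> \<le> K / (2 * L) * exp (2 * L * \<bar>t\<bar>)"
        using K Lpos by (intro mult_left_mono) auto
      finally have "norm (U w t) \<le> norm u0 + K / (2 * L) * exp (2 * L * \<bar>t\<bar>)"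
        unfolding U_def by (meson add_left_mono norm_triangle_ineq order_trans)
      also have "\<dots> \<le> norm u0 * exp (2 * L * \<bar>t\<bar>) + K / (2 * L) * exp (2 * L * \<bar>t\<bar>)"
        using Lpos by (simp add: mult_le_cancel_left1)
      finally show "exp (- (2 * L * \<bar>t\<bar>)) * norm (U w t) \<le> norm u0 + K / (2 * L)"
        by (simp add: exp_minus field_simps)
    qed
  qed
  have app: "apply_bcontfun (\<Phi> w) t = exp (- (2 * L * \<bar>t\<bar>)) *\<^sub>R U w t" for w t
    unfolding \<Phi>_def by (subst Bcontfun_inverse[OF bc]) simp
  have contr: "dist (\<Phi> w) (\<Phi> w') \<le> (1/2) * dist w w'" for w w'
  proof (rule dist_bound)
    fix t
    have "norm (prim (\<lambda>\<tau>. G w \<tau> - G w' \<tau>) t) \<le> (L * dist w w') / (2 * L) * (exp (2 * L * \<bar>t\<bar>) - 1)"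
    proof (rule norm_prim_le_exp[OF _ Lpos])
      fix \<tau>
      let ?e = "exp (2 * L * \<bar>\<tau>\<bar>)"
      have "norm (G w \<tau> - G w' \<tau>) \<le> L * dist (?e *\<^sub>R apply_bcontfun w \<tau>) (?e *\<^sub>R apply_bcontfun w' \<tau>)"
        unfolding G_def dist_norm[symmetric] by (rule lip)
      also have "\<dots> = L * ?e * dist (apply_bcontfun w \<tau>) (apply_bcontfun w' \<tau>)"
        by (simp add: dist_norm scaleR_diff_right[symmetric])
      also have "\<dots> \<le> L * ?e * dist w w'"
        using Lpos by (intro mult_left_mono dist_bounded) auto
      finally show "norm (G w \<tau> - G w' \<tau>) \<le> L * dist w w' * ?e" by (simp add: algebra_simps)
    qed (intro continuous_intros contG)
    also have "\<dots> \<le> dist w w' / 2 * exp (2 * L * \<bar>t\<bar>)"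
      using Lpos by (simp add: field_simps)
    also have "prim (\<lambda>\<tau>. G w \<tau> - G w' \<tau>) t = U w t - U w' t"
      using prim_eq_diff[of "\<lambda>t. U w t - U w' t" "\<lambda>t. G w t - G w' t" t]
        has_vector_derivative_diff[OF derU derU] by (simp add: U_def)
    finally have "norm (U w t - U w' t) \<le> dist w w' / 2 * exp (2 * L * \<bar>t\<bar>)" .
    then have "exp (- (2 * L * \<bar>t\<bar>)) * norm (U w t - U w' t) \<le> dist w w' / 2"
      by (simp add: exp_minus field_simps)
    then show "dist (apply_bcontfun (\<Phi> w) t) (apply_bcontfun (\<Phi> w') t) \<le> (1/2) * dist w w'"
      by (simp add: app dist_norm scaleR_diff_right[symmetric])
  qed
  have "\<exists>!w. \<Phi> w = w"
    by (rule banach_fix_type[of "1/2"]) (use contr in auto)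
  then obtain w where w: "\<Phi> w = w" by auto
  have U: "U w t = exp (2 * L * \<bar>t\<bar>) *\<^sub>R apply_bcontfun w t" for t
    using app[of w t] w by (simp add: exp_minus)
  have G: "G w t = F (U w t)" for t
    by (simp add: G_def U)
  show ?thesis
  proof (rule that)
    show "U w 0 = u0" by (simp add: U_def)
    show "(U w has_vector_derivative F (U w t)) (at t)" for t
      using derU[of w t] by (simp only: G)
  qed
qed

section \<open>Means and Fourier coefficients of continuous functions\<close>

definition mean :: "(real \<Rightarrow> 'a::banach) \<Rightarrow> 'a" where
  "mean f = integral {-pi..pi} f /\<^sub>R (2 * pi)"

text \<open>Equal to \<open>fourier_coeff\<close> on continuous functions. Writing it as a
  \<open>mean\<close> lets all rules for coefficients follow from rules for means, and the
  normalisation removes every factor 2 pi from Parseval's identity.\<close>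

definition fc :: "(real \<Rightarrow> complex) \<Rightarrow> int \<Rightarrow> complex" where
  "fc f k = mean (\<lambda>x. f x * cis (- (of_int k * x)))"

definition trig :: "nat \<Rightarrow> (int \<Rightarrow> complex) \<Rightarrow> real \<Rightarrow> complex" where
  "trig N c x = (\<Sum>k\<in>{-int N..int N}. c k * cis (of_int k * x))"

lemma continuous_on_cis_comp [continuous_intros]:
  "continuous_on A f \<Longrightarrow> continuous_on A (\<lambda>x. cis (f x))"
  unfolding cis_conv_exp by (intro continuous_intros)

lemma mean_integrable:
  fixes f :: "real \<Rightarrow> 'a::banach"
  assumes "continuous_on UNIV f"
  shows "f integrable_on {-pi..pi}"
  by (rule integrable_continuous_real) (rule continuous_on_subset[OF assms], simp)

lemma mean_add:
  fixes f g :: "real \<Rightarrow> 'a::banach"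
  assumes "continuous_on UNIV f" "continuous_on UNIV g"
  shows "mean (\<lambda>x. f x + g x) = mean f + mean g"
  unfolding mean_def
  by (simp add: Henstock_Kurzweil_Integration.integral_add mean_integrable assms scaleR_add_right)

lemma mean_diff:
  fixes f g :: "real \<Rightarrow> 'a::banach"
  assumes "continuous_on UNIV f" "continuous_on UNIV g"
  shows "mean (\<lambda>x. f x - g x) = mean f - mean g"
  unfolding mean_def
  by (simp add: Henstock_Kurzweil_Integration.integral_diff mean_integrable assms scaleR_diff_right)

lemma mean_linear:
  fixes f :: "real \<Rightarrow> 'a::banach" and L :: "'a \<Rightarrow> 'b::banach"
  assumes "bounded_linear L" "continuous_on UNIV f"
  shows "mean (\<lambda>x. L (f x)) = L (mean f)"
proof -
  interpret bounded_linear L by (rule assms)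
  show ?thesis
    using integral_linear[OF mean_integrable[OF assms(2)] assms(1)]
    by (simp add: mean_def o_def scaleR)
qed

lemma mean_mult_left:
  fixes f :: "real \<Rightarrow> 'a::{banach, real_normed_algebra}"
  shows "continuous_on UNIV f \<Longrightarrow> mean (\<lambda>x. c * f x) = c * mean f"
  by (rule mean_linear[OF bounded_linear_mult_right])

lemma mean_cnj: "continuous_on UNIV f \<Longrightarrow> mean (\<lambda>x. cnj (f x)) = cnj (mean f)"
  by (rule mean_linear[OF bounded_linear_cnj])

lemma mean_of_real: "continuous_on UNIV f \<Longrightarrow> mean (\<lambda>x. complex_of_real (f x)) = complex_of_real (mean f)"
  by (rule mean_linear[OF bounded_linear_of_real])

lemma mean_sum:
  fixes f :: "'b \<Rightarrow> real \<Rightarrow> 'a::banach"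
  assumes "finite S" "\<And>k. k \<in> S \<Longrightarrow> continuous_on UNIV (f k)"
  shows "mean (\<lambda>x. \<Sum>k\<in>S. f k x) = (\<Sum>k\<in>S. mean (f k))"
  unfolding mean_def
  by (simp add: Henstock_Kurzweil_Integration.integral_sum mean_integrable assms scaleR_sum_right)

lemma mean_const [simp]: "mean (\<lambda>x. c) = (c::'a::banach)"
  by (simp add: mean_def)

lemma mean_mono:
  fixes f g :: "real \<Rightarrow> real"
  assumes "continuous_on UNIV f" "continuous_on UNIV g" "\<And>x. f x \<le> g x"
  shows "mean f \<le> mean g"
  unfolding mean_def
  by (auto intro!: mult_left_mono integral_le mean_integrable assms)

lemma norm_mean_le:
  fixes f :: "real \<Rightarrow> 'a::banach" and g :: "real \<Rightarrow> real"
  assumes "continuous_on UNIV f" "continuous_on UNIV g" "\<And>x. norm (f x) \<le> g x"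
  shows "norm (mean f) \<le> mean g"
  unfolding mean_def norm_scaleR
  using integral_norm_bound_integral[of f "{-pi..pi}" g] assms
  by (auto intro!: mult_left_mono mean_integrable)

lemma mean_cis: "mean (\<lambda>x. cis (of_int k * x)) = (if k = 0 then 1 else 0)"
proof (cases "k = 0")
  case False
  have "((\<lambda>x. cis (of_int k * x)) has_integral
      (cis (of_int k * pi) / (\<i> * of_int k) - cis (of_int k * (-pi)) / (\<i> * of_int k))) {-pi..pi}"
  proof (rule fundamental_theorem_of_calculus)
    fix x assume "x \<in> {-pi..pi}"
    show "((\<lambda>x. cis (of_int k * x) / (\<i> * of_int k)) has_vector_derivative cis (of_int k * x))
        (at x within {-pi..pi})"
      unfolding cis_conv_exp using False
      by (auto intro!: derivative_eq_intros has_vector_derivative_real_field simp: field_simps)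
  qed auto
  moreover have "cis (of_int k * pi) = cis (of_int k * (-pi))"
    by (simp add: complex_eq_iff)
      (metis mult.commute minus_zero neg_0_equal_iff_equal sin_int_times_real sin_npi_int)
  ultimately have "integral {-pi..pi} (\<lambda>x. cis (of_int k * x)) = 0"
    by (simp add: integral_unique)
  then show ?thesis using False by (simp add: mean_def)
qed simp

lemma continuous_trig [continuous_intros]:
  "continuous_on A (trig N c)"
  unfolding trig_def[abs_def] by (intro continuous_intros)

lemma fc_trig: "fc (trig N c) k = (if \<bar>k\<bar> \<le> int N then c k else 0)"
proof -
  have "trig N c x * cis (- (of_int k * x)) = (\<Sum>j\<in>{-int N..int N}. c j * cis (of_int (j - k) * x))" for x
    by (simp add: trig_def sum_distrib_right mult.assoc cis_mult left_diff_distrib)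
  then have "fc (trig N c) k = (\<Sum>j\<in>{-int N..int N}. c j * (if j - k = 0 then 1 else 0))"
    unfolding fc_def
    by (simp only: mean_sum mean_mult_left mean_cis continuous_intros finite_atLeastAtMost_int)
  also have "\<dots> = (\<Sum>j\<in>{-int N..int N}. if k = j then c j else 0)"
    by (rule sum.cong) auto
  also have "\<dots> = (if \<bar>k\<bar> \<le> int N then c k else 0)"
    by (subst sum.delta') auto
  finally show ?thesis .
qed

text \<open>Testing against a trigonometric polynomial of degree N does not see the truncation to
  frequencies up to N. This is why the Galerkin system inherits the conservation laws of the
  equation.\<close>

lemma sum_cnj_fc:
  assumes "continuous_on UNIV f"
  shows "(\<Sum>k\<in>{-int N..int N}. cnj (c k) * fc f k) = mean (\<lambda>x. f x * cnj (trig N c x))"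
proof -
  have "f x * cnj (trig N c x) = (\<Sum>k\<in>{-int N..int N}. cnj (c k) * (f x * cis (- (of_int k * x))))" for x
    by (simp add: trig_def sum_distrib_left cis_cnj mult_ac)
  moreover have "mean (\<lambda>x. \<Sum>k\<in>{-int N..int N}. cnj (c k) * (f x * cis (- (of_int k * x)))) =
      (\<Sum>k\<in>{-int N..int N}. mean (\<lambda>x. cnj (c k) * (f x * cis (- (of_int k * x)))))"
    by (rule mean_sum) (auto intro!: continuous_intros assms)
  ultimately show ?thesis
    by (simp add: fc_def mean_mult_left continuous_intros assms)
qed

lemma parseval_trig:
  "mean (\<lambda>x. (cmod (trig N c x))\<^sup>2) = (\<Sum>k\<in>{-int N..int N}. (cmod (c k))\<^sup>2)"
proof -
  have "complex_of_real (mean (\<lambda>x. (cmod (trig N c x))\<^sup>2)) = mean (\<lambda>x. complex_of_real ((cmod (trig N c x))\<^sup>2))"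
    by (rule mean_of_real[symmetric]) (intro continuous_intros)
  also have "\<dots> = mean (\<lambda>x. trig N c x * cnj (trig N c x))"
    by (simp add: complex_norm_square[symmetric])
  also have "\<dots> = (\<Sum>k\<in>{-int N..int N}. cnj (c k) * fc (trig N c) k)"
    by (rule sum_cnj_fc[symmetric]) (intro continuous_intros)
  also have "\<dots> = (\<Sum>k\<in>{-int N..int N}. complex_of_real ((cmod (c k))\<^sup>2))"
    by (rule sum.cong) (auto simp: fc_trig complex_norm_square mult.commute simp del: of_real_power)
  finally show ?thesis by (simp only: of_real_sum[symmetric] of_real_eq_iff)
qed

lemma cmod_trig_le: "cmod (trig N c x) \<le> (\<Sum>k\<in>{-int N..int N}. cmod (c k))"
  unfolding trig_def by (rule order_trans[OF norm_sum]) (simp add: norm_mult)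

lemma norm_fc_le:
  assumes "continuous_on UNIV f" "continuous_on UNIV g" "\<And>x. cmod (f x) \<le> g x"
  shows "cmod (fc f k) \<le> mean g"
  unfolding fc_def
  by (rule norm_mean_le) (use assms in \<open>auto intro!: continuous_intros simp: norm_mult\<close>)

lemma fc_diff:
  assumes "continuous_on UNIV f" "continuous_on UNIV g"
  shows "fc (\<lambda>x. f x - g x) k = fc f k - fc g k"
  unfolding fc_def left_diff_distrib
  by (rule mean_diff) (intro continuous_intros assms)+

lemma fc_add:
  assumes "continuous_on UNIV f" "continuous_on UNIV g"
  shows "fc (\<lambda>x. f x + g x) k = fc f k + fc g k"
  unfolding fc_def distrib_right
  by (rule mean_add) (intro continuous_intros assms)+

lemma fc_mult_left:
  assumes "continuous_on UNIV f"
  shows "fc (\<lambda>x. c * f x) k = c * fc f k"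
  unfolding fc_def mult.assoc
  by (rule mean_mult_left) (intro continuous_intros assms)+

lemma fc_cnj:
  assumes "continuous_on UNIV f"
  shows "fc (\<lambda>x. cnj (f x)) k = cnj (fc f (- k))"
  unfolding fc_def
  by (subst mean_cnj[symmetric]) (auto intro!: continuous_intros assms simp: cis_cnj)

lemma fc_const: "fc (\<lambda>x. c) k = (if k = 0 then c else 0)"
proof -
  have "fc (\<lambda>x. c) k = c * mean (\<lambda>x. cis (of_int (- k) * x))"
    unfolding fc_def by (subst mean_mult_left[symmetric]) (auto intro!: continuous_intros)
  then show ?thesis by (simp only: mean_cis) simp
qed

lemma fourier_coeff_eq_fc:
  assumes "continuous_on UNIV f"
  shows "fourier_coeff f k = fc f k"
proof -
  have "continuous_on {-pi..pi} (\<lambda>x. f x * cis (- (of_int k * x)))"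
    by (intro continuous_intros continuous_on_subset[OF assms] subset_UNIV)
  from LINT_lebesgue_eq_integral[OF set_integrable_lebesgue_continuous[OF this]]
  have "(LINT x=-pi..pi|lebesgue. (f x * cis (- (of_int k * x)))) =
      integral {-pi..pi} (\<lambda>x. f x * cis (- (of_int k * x)))"
    by simp
  then show ?thesis
    unfolding fourier_coeff_def fc_def mean_def scaleR_conv_of_real by (simp only: inverse_eq_divide)
qed

lemma tendsto_mean:
  fixes f :: "nat \<Rightarrow> real \<Rightarrow> 'a::euclidean_space"
  assumes "\<And>n. continuous_on UNIV (f n)" "\<And>n x. norm (f n x) \<le> B" "\<And>x. (\<lambda>n. f n x) \<longlonglongrightarrow> g x"
  shows "(\<lambda>n. mean (f n)) \<longlonglongrightarrow> mean g"
  unfolding mean_def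
  by (intro tendsto_intros dominated_convergence(2)[where h="\<lambda>x. B"])
    (use assms in \<open>auto intro: mean_integrable\<close>)

lemma tendsto_fc:
  assumes "\<And>n. continuous_on UNIV (f n)" "\<And>n x. norm (f n x) \<le> B" "\<And>x. (\<lambda>n. f n x) \<longlonglongrightarrow> g x"
  shows "(\<lambda>n. fc (f n) k) \<longlonglongrightarrow> fc g k"
  unfolding fc_def
  by (rule tendsto_mean[where B=B]) (use assms in \<open>auto intro!: continuous_intros tendsto_intros simp: norm_mult\<close>)

lemma continuous_on_mean:
  fixes f :: "real \<Rightarrow> real \<Rightarrow> 'a::banach"
  assumes "continuous_on UNIV (\<lambda>(t, x). f t x)"
  shows "continuous_on UNIV (\<lambda>t. mean (f t))"
  unfolding mean_def
  using integral_continuous_on_param[of UNIV "-pi" pi f] continuous_on_subset[OF assms]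
  by (intro continuous_intros) auto

lemma continuous_on_slice:
  assumes "continuous_on UNIV (\<lambda>(t, x). f t x)"
  shows "continuous_on UNIV (f t)"
proof -
  have "continuous_on UNIV ((\<lambda>(t, x). f t x) \<circ> (\<lambda>x. (t, x)))"
    by (rule continuous_on_compose) (auto intro!: continuous_intros continuous_on_subset[OF assms])
  then show ?thesis by (simp add: o_def)
qed

lemma mean_has_vector_derivative:
  fixes f :: "real \<Rightarrow> real \<Rightarrow> 'a::banach"
  assumes f: "continuous_on UNIV (\<lambda>(t, x). f t x)" and f': "continuous_on UNIV (\<lambda>(t, x). f' t x)"
    and der: "\<And>t x. ((\<lambda>t. f t x) has_vector_derivative f' t x) (at t)"
  shows "((\<lambda>t. mean (f t)) has_vector_derivative mean (f' t)) (at t)"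
proof -
  have "((\<lambda>t. integral (cbox (-pi) pi) (f t)) has_vector_derivative integral (cbox (-pi) pi) (f' t))
      (at t within UNIV)"
    by (rule leibniz_rule_vector_derivative)
      (use der f f' in \<open>auto intro!: mean_integrable[simplified] continuous_on_slice
        intro: continuous_on_subset\<close>)
  then show ?thesis
    unfolding mean_def by (auto intro!: derivative_eq_intros)
qed

section \<open>The Galerkin system\<close>

text \<open>The cubic nonlinearity with its factor |z|^2 cut off at L, which makes it globally
  Lipschitz. The factor stays real, so mass is still conserved, and conservation later shows that
  the cut-off is never reached.\<close>

definition cap :: "real \<Rightarrow> complex \<Rightarrow> complex" where
  "cap L z = complex_of_real (min ((cmod z)\<^sup>2) L) * z"

lemma continuous_on_cap [continuous_intros]:
  "continuous_on A f \<Longrightarrow> continuous_on A (\<lambda>x. cap L (f x))"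
  unfolding cap_def by (intro continuous_intros)

lemma min_square_diff_le:
  fixes a b L :: real
  assumes "0 \<le> b" "b \<le> a" "0 \<le> L"
  shows "(min (a\<^sup>2) L - min (b\<^sup>2) L) * b \<le> 2 * L * (a - b)"
proof -
  have *: "(r\<^sup>2 - b\<^sup>2) * b \<le> 2 * r\<^sup>2 * (r - b)" if "b \<le> r" for r
  proof -
    have "(r + b) * b \<le> (2 * r) * r" using that assms by (intro mult_mono) auto
    then have "(r - b) * ((r + b) * b) \<le> (r - b) * (2 * r * r)"
      using that by (intro mult_left_mono) auto
    then show ?thesis by (simp add: power2_eq_square algebra_simps)
  qed
  consider "L \<le> b\<^sup>2" | "a\<^sup>2 \<le> L" | "b\<^sup>2 < L" "L < a\<^sup>2" by linarith
  then show ?thesis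
  proof cases
    case 1
    have "b\<^sup>2 \<le> a\<^sup>2" using assms by (intro power_mono) auto
    with 1 have "L \<le> a\<^sup>2" by linarith
    then show ?thesis using 1 assms by (simp add: min_absorb2)
  next
    case 2
    have "b\<^sup>2 \<le> a\<^sup>2" using assms by (intro power_mono) auto
    with 2 have "b\<^sup>2 \<le> L" by simp
    have "2 * a\<^sup>2 * (a - b) \<le> 2 * L * (a - b)" using 2 assms by (intro mult_right_mono) auto
    then show ?thesis using *[of a] 2 \<open>b\<^sup>2 \<le> L\<close> assms by simp
  next
    \<comment> \<open>Only the part of the interval from b to a below the cap counts, so a is
      replaced by sqrt L, where the cap is just reached.\<close>
    case 3
    have b: "b \<le> sqrt L" using 3 by (simp add: real_le_rsqrt)
    have "sqrt L \<le> a" using 3 assms by (intro real_le_lsqrt) auto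
    then have "2 * L * (sqrt L - b) \<le> 2 * L * (a - b)" using assms by (intro mult_left_mono) auto
    then show ?thesis using *[OF b] 3 assms by simp
  qed
qed

text \<open>By symmetry w may be taken as the smaller vector. The difference of the real factors is
  then multiplied by |w|, which costs 2 L; the difference of the vectors costs another L.\<close>

lemma cap_lipschitz:
  assumes "0 \<le> L"
  shows "cmod (cap L z - cap L w) \<le> 3 * L * cmod (z - w)"
proof -
  have *: "cmod (cap L z - cap L w) \<le> 3 * L * cmod (z - w)" if "cmod w \<le> cmod z" for z w
  proof -
    let ?A = "min ((cmod z)\<^sup>2) L" and ?B = "min ((cmod w)\<^sup>2) L"
    have "?B \<le> ?A" using that by (intro min.mono power_mono order_refl) auto
    have "cap L z - cap L w = of_real ?A * (z - w) + of_real (?A - ?B) * w"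
      by (simp add: cap_def algebra_simps)
    then have "cmod (cap L z - cap L w) \<le> cmod (of_real ?A * (z - w)) + cmod (of_real (?A - ?B) * w)"
      by (simp only: norm_triangle_ineq)
    also have "\<dots> = \<bar>?A\<bar> * cmod (z - w) + \<bar>?A - ?B\<bar> * cmod w"
      by (simp only: norm_mult norm_of_real)
    also have "\<dots> = ?A * cmod (z - w) + (?A - ?B) * cmod w"
      using \<open>?B \<le> ?A\<close> assms by simp
    also have "\<dots> \<le> L * cmod (z - w) + 2 * L * (cmod z - cmod w)"
      using min_square_diff_le[of "cmod w" "cmod z" L] that assms
      by (intro add_mono mult_right_mono) auto
    also have "cmod z - cmod w \<le> cmod (z - w)" by (rule norm_triangle_ineq2)
    finally show ?thesis using assms by (simp add: mult_left_mono)
  qed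
  show ?thesis
    using *[of w z] *[of z w] by (cases "cmod w \<le> cmod z") (auto simp: norm_minus_commute)
qed

lemma trig_diff: "trig N c x - trig N d x = trig N (\<lambda>k. c k - d k) x"
  by (simp add: trig_def sum_subtractf left_diff_distrib)

text \<open>The time derivative of mode k prescribed by the focusing equation with capped
  nonlinearity. It is defined for any function f, since the equation is first solved among all
  bounded continuous functions.\<close>

definition galerkin_coeff :: "real \<Rightarrow> (real \<Rightarrow> complex) \<Rightarrow> int \<Rightarrow> complex" where
  "galerkin_coeff L f k = - \<i> * (of_int (k\<^sup>2) * fc f k - fc (\<lambda>x. cap L (f x)) k)"

lemma galerkin_coeff_lipschitz:
  assumes "0 \<le> L" "\<bar>k\<bar> \<le> int N" and f: "continuous_on UNIV f" and g: "continuous_on UNIV g"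
    and d: "\<And>x. cmod (f x - g x) \<le> \<delta>"
  shows "cmod (galerkin_coeff L f k - galerkin_coeff L g k) \<le> ((real N)\<^sup>2 + 3 * L) * \<delta>"
proof -
  have \<delta>: "0 \<le> \<delta>" using d[of 0] norm_ge_zero order_trans by blast
  have fg: "cmod (fc f k - fc g k) \<le> \<delta>"
    using norm_fc_le[of "\<lambda>x. f x - g x" "\<lambda>x. \<delta>" k] d by (simp add: fc_diff f g continuous_intros)
  have "cmod (cap L (f x) - cap L (g x)) \<le> 3 * L * \<delta>" for x
    using assms(1) d by (intro order_trans[OF cap_lipschitz[OF assms(1)]] mult_left_mono) auto
  then have "cmod (fc (\<lambda>x. cap L (f x) - cap L (g x)) k) \<le> mean (\<lambda>x. 3 * L * \<delta>)"
    by (intro norm_fc_le) (auto intro!: continuous_intros f g)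
  then have fc: "cmod (fc (\<lambda>x. cap L (f x)) k - fc (\<lambda>x. cap L (g x)) k) \<le> 3 * L * \<delta>"
    by (simp add: fc_diff continuous_intros f g)
  have "\<bar>k\<bar>^2 \<le> (int N)^2" using assms(2) by (intro power_mono) auto
  then have "real_of_int (k\<^sup>2) \<le> real_of_int ((int N)^2)"
    by (subst of_int_le_iff) simp
  then have k: "real_of_int (k\<^sup>2) \<le> (real N)^2" by simp
  have "galerkin_coeff L f k - galerkin_coeff L g k =
      - \<i> * (of_int (k\<^sup>2) * (fc f k - fc g k) - (fc (\<lambda>x. cap L (f x)) k - fc (\<lambda>x. cap L (g x)) k))"
    by (simp add: galerkin_coeff_def algebra_simps)
  then have "cmod (galerkin_coeff L f k - galerkin_coeff L g k) =
      cmod (of_int (k\<^sup>2) * (fc f k - fc g k) - (fc (\<lambda>x. cap L (f x)) k - fc (\<lambda>x. cap L (g x)) k))"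
    by (simp only: norm_mult norm_minus_cancel norm_ii mult_1)
  also have "\<dots> \<le> cmod (of_int (k\<^sup>2) * (fc f k - fc g k)) + cmod (fc (\<lambda>x. cap L (f x)) k - fc (\<lambda>x. cap L (g x)) k)"
    by (rule norm_triangle_ineq4)
  also have "cmod (of_int (k\<^sup>2) * (fc f k - fc g k)) = real_of_int (k\<^sup>2) * cmod (fc f k - fc g k)"
    by (simp add: norm_mult norm_power)
  also have "\<dots> \<le> (real N)\<^sup>2 * \<delta>" using k fg \<delta> by (intro mult_mono) auto
  finally show ?thesis using fc by (simp add: algebra_simps)
qed

instance bcontfun :: (metric_space, banach) banach ..

lemma trig_bcontfun: "trig N c \<in> bcontfun"
proof -
  have "bounded (range (trig N c))"
    by (rule boundedI[where B="\<Sum>k\<in>{-int N..int N}. cmod (c k)"]) (auto intro: cmod_trig_le)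
  then show ?thesis by (simp add: bcontfun_def continuous_intros)
qed

lemma trig_has_vector_derivative:
  assumes "\<And>k. \<bar>k\<bar> \<le> int N \<Longrightarrow> ((\<lambda>t. c t k) has_vector_derivative c' t k) (at t)"
  shows "((\<lambda>t. trig N (c t) x) has_vector_derivative trig N (c' t) x) (at t)"
  unfolding trig_def
  by (intro has_vector_derivative_sum has_vector_derivative_mult_left assms) auto

text \<open>The Galerkin system is solved in the Banach space of bounded continuous functions of \<open>x\<close>;
  trigonometric polynomials form an invariant subspace.\<close>

lemma capped_galerkin_solution:
  assumes "0 \<le> L"
  obtains c where "\<And>k. \<bar>k\<bar> \<le> int N \<Longrightarrow> c 0 k = c0 k"
    "\<And>t k. \<bar>k\<bar> \<le> int N \<Longrightarrow>
      ((\<lambda>t. c t k) has_vector_derivative galerkin_coeff L (trig N (c t)) k) (at t)"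
proof -
  let ?J = "{-int N..int N}"
  define F where "F u = Bcontfun (trig N (galerkin_coeff L (apply_bcontfun u)))" for u :: "real \<Rightarrow>\<^sub>C complex"
  have app: "apply_bcontfun (F u) = trig N (galerkin_coeff L (apply_bcontfun u))" for u
    unfolding F_def by (rule Bcontfun_inverse) (rule trig_bcontfun)
  \<comment> \<open>There are 2 N + 1 modes, each with Lipschitz constant N^2 + 3 L by
    \<open>galerkin_coeff_lipschitz\<close>.\<close>
  define K where "K = (2 * real N + 1) * ((real N)\<^sup>2 + 3 * L)"
  have lip: "dist (F u) (F w) \<le> K * dist u w" for u w
  proof (rule dist_bound, unfold app dist_norm trig_diff)
    fix x
    let ?d = "\<lambda>k. galerkin_coeff L (apply_bcontfun u) k - galerkin_coeff L (apply_bcontfun w) k"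
    have "cmod (trig N ?d x) \<le> (\<Sum>k\<in>?J. cmod (?d k))" by (rule cmod_trig_le)
    also have "\<dots> \<le> (\<Sum>k\<in>?J. ((real N)\<^sup>2 + 3 * L) * norm (u - w))"
    proof (intro sum_mono galerkin_coeff_lipschitz assms)
      show "cmod (apply_bcontfun u x - apply_bcontfun w x) \<le> norm (u - w)" for x
        using dist_bounded[of u x w] by (simp add: dist_norm)
    qed auto
    also have "\<dots> = K * norm (u - w)" by (simp add: K_def)
    finally show "cmod (trig N ?d x) \<le> K * norm (u - w)" .
  qed
  obtain u where u: "u 0 = Bcontfun (trig N c0)" "\<And>t. (u has_vector_derivative F (u t)) (at t)"
    by (rule lipschitz_ode_global_solution[of F K "Bcontfun (trig N c0)", OF lip]) (rule that)
  define c where "c t = fc (apply_bcontfun (u t))" for t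
  have bl: "bounded_linear (\<lambda>w :: real \<Rightarrow>\<^sub>C complex. apply_bcontfun w x)" for x
  proof (rule bounded_linear_intro[where K=1])
    show "cmod (apply_bcontfun w x) \<le> norm w * 1" for w :: "real \<Rightarrow>\<^sub>C complex"
      using norm_bounded[of w x] by simp
  qed (auto simp: plus_bcontfun.rep_eq scaleR_bcontfun.rep_eq)
  have bl2: "bounded_linear (\<lambda>w. fc (apply_bcontfun w) k)" for k
  proof (rule bounded_linear_intro[where K=1])
    show "cmod (fc (apply_bcontfun w) k) \<le> norm w * 1" for w :: "real \<Rightarrow>\<^sub>C complex"
      using norm_fc_le[of "apply_bcontfun w" "\<lambda>x. norm w" k] norm_bounded[of w] by simp
  qed (auto simp: plus_bcontfun.rep_eq[abs_def] scaleR_bcontfun.rep_eq[abs_def] fc_add fc_mult_left scaleR_conv_of_real)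
  have dc: "((\<lambda>t. c t k) has_vector_derivative galerkin_coeff L (apply_bcontfun (u t)) k) (at t)"
    if "\<bar>k\<bar> \<le> int N" for t k
    using bounded_linear.has_vector_derivative[OF bl2 u(2), of k t] that by (simp add: app fc_trig c_def)
  have dV: "((\<lambda>t. trig N (c t) x) has_vector_derivative trig N (galerkin_coeff L (apply_bcontfun (u t))) x) (at t)"
    for x t
    by (rule trig_has_vector_derivative[of _ c "\<lambda>t. galerkin_coeff L (apply_bcontfun (u t))"]) (rule dc)
  \<comment> \<open>The solution and the trigonometric polynomial built from its coefficients have
    the same time derivative and the same initial value. So the solution never leaves the space of
    trigonometric polynomials.\<close>
  have "((\<lambda>t. apply_bcontfun (u t) x - trig N (c t) x) has_vector_derivative 0) (at t)" for x t
    using has_vector_derivative_diff[OF bounded_linear.has_vector_derivative[OF bl u(2), of x t] dV[of x t]]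
    by (simp add: app)
  then have C: "apply_bcontfun (u t) x - trig N (c t) x = apply_bcontfun (u 0) x - trig N (c 0) x" for t x
    using prim_eq_diff[of "\<lambda>t. apply_bcontfun (u t) x - trig N (c t) x" "\<lambda>t. 0" t]
    by (simp add: prim_def split: if_splits)
  have u0: "apply_bcontfun (u 0) = trig N c0"
    unfolding u(1) by (rule Bcontfun_inverse) (rule trig_bcontfun)
  have c0: "c 0 k = c0 k" if "\<bar>k\<bar> \<le> int N" for k
    using that by (simp add: c_def u0 fc_trig)
  have "trig N (c 0) = trig N c0"
    unfolding trig_def[abs_def] by (intro ext sum.cong) (auto simp: c0)
  then have "apply_bcontfun (u t) = trig N (c t)" for t
    using C[of t] u0 by (simp add: fun_eq_iff)
  then show ?thesis using that[of c] c0 dc by simp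
qed

lemma cmod_square_has_real_derivative:
  assumes "(f has_vector_derivative f') (at t)"
  shows "((\<lambda>t. (cmod (f t))\<^sup>2) has_real_derivative 2 * Re (cnj (f t) * f')) (at t)"
proof -
  have R: "((\<lambda>t. Re (f t)) has_real_derivative Re f') (at t)"
    and I: "((\<lambda>t. Im (f t)) has_real_derivative Im f') (at t)"
    using bounded_linear.has_vector_derivative[OF bounded_linear_Re assms]
      bounded_linear.has_vector_derivative[OF bounded_linear_Im assms]
    by (simp_all add: has_real_derivative_iff_has_vector_derivative)
  have "((\<lambda>t. (Re (f t))\<^sup>2 + (Im (f t))\<^sup>2) has_real_derivative 2 * Re (cnj (f t) * f')) (at t)"
    by (rule DERIV_cong[OF DERIV_add[OF DERIV_power[OF R] DERIV_power[OF I]]]) (simp add: algebra_simps)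
  then show ?thesis by (simp add: cmod_power2)
qed

text \<open>The capped nonlinearity is a real multiple of the solution, so its pairing with the
  solution is real, and the mass changes only through the imaginary part of that pairing.\<close>

lemma capped_mass_conserved:
  assumes "\<And>t k. \<bar>k\<bar> \<le> int N \<Longrightarrow>
    ((\<lambda>t. c t k) has_vector_derivative galerkin_coeff L (trig N (c t)) k) (at t)"
  shows "(\<Sum>k\<in>{-int N..int N}. (cmod (c t k))\<^sup>2) = (\<Sum>k\<in>{-int N..int N}. (cmod (c 0 k))\<^sup>2)"
proof -
  have "((\<lambda>t. \<Sum>k\<in>{-int N..int N}. (cmod (c t k))\<^sup>2) has_real_derivative 0) (at t)" for t
  proof -
    let ?J = "{-int N..int N}" and ?V = "trig N (c t)"
    let ?n = "fc (\<lambda>x. cap L (?V x))"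
    have "((\<lambda>t. \<Sum>k\<in>?J. (cmod (c t k))\<^sup>2) has_real_derivative
        (\<Sum>k\<in>?J. 2 * Re (cnj (c t k) * galerkin_coeff L ?V k))) (at t)"
      by (intro DERIV_sum cmod_square_has_real_derivative assms) auto
    also have "(\<Sum>k\<in>?J. 2 * Re (cnj (c t k) * galerkin_coeff L ?V k)) =
        (\<Sum>k\<in>?J. - 2 * Im (cnj (c t k) * ?n k))"
      by (rule sum.cong) (auto simp: galerkin_coeff_def fc_trig algebra_simps)
    also have "\<dots> = - 2 * Im (\<Sum>k\<in>?J. cnj (c t k) * ?n k)"
      by (simp only: sum_distrib_left Im_sum)
    also have "(\<Sum>k\<in>?J. cnj (c t k) * ?n k) = mean (\<lambda>x. cap L (?V x) * cnj (?V x))"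
      by (rule sum_cnj_fc) (intro continuous_intros)
    also have "(\<lambda>x. cap L (?V x) * cnj (?V x)) =
        (\<lambda>x. complex_of_real (min ((cmod (?V x))\<^sup>2) L * (cmod (?V x))\<^sup>2))"
      by (simp add: cap_def complex_norm_square mult.assoc fun_eq_iff del: of_real_power)
    also have "mean \<dots> = of_real (mean (\<lambda>x. min ((cmod (?V x))\<^sup>2) L * (cmod (?V x))\<^sup>2))"
      by (rule mean_of_real) (intro continuous_intros)
    finally show ?thesis by simp
  qed
  then show ?thesis using DERIV_isconst_all by blast
qed

text \<open>The focusing equation projected to the frequencies up to N. Only these modes of c are
  constrained, as \<open>trig N\<close> reads no others.\<close>

locale galerkin =
  fixes N :: nat and c :: "real \<Rightarrow> int \<Rightarrow> complex"
  assumes ode: "\<And>t k. \<bar>k\<bar> \<le> int N \<Longrightarrow> ((\<lambda>t. c t k) has_vector_derivative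
    - \<i> * (of_int (k\<^sup>2) * c t k - fc (\<lambda>x. (cmod (trig N (c t) x))\<^sup>2 * trig N (c t) x) k)) (at t)"

theorem galerkin_exists:
  obtains c where "galerkin N c" "\<And>k. \<bar>k\<bar> \<le> int N \<Longrightarrow> c 0 k = c0 k"
proof -
  let ?J = "{-int N..int N}"
  define L where "L = real (card ?J) * (\<Sum>k\<in>?J. (cmod (c0 k))\<^sup>2)"
  have L: "0 \<le> L" by (simp add: L_def sum_nonneg)
  obtain c where c: "\<And>k. \<bar>k\<bar> \<le> int N \<Longrightarrow> c 0 k = c0 k"
    "\<And>t k. \<bar>k\<bar> \<le> int N \<Longrightarrow>
      ((\<lambda>t. c t k) has_vector_derivative galerkin_coeff L (trig N (c t)) k) (at t)"
    using capped_galerkin_solution[OF L, of N c0] by metis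
  have "(cmod (trig N (c t) x))\<^sup>2 \<le> L" for t x
  proof -
    have "(cmod (trig N (c t) x))\<^sup>2 \<le> (\<Sum>k\<in>?J. cmod (c t k))\<^sup>2"
      by (intro power_mono cmod_trig_le) auto
    also have "\<dots> \<le> (\<Sum>k\<in>?J. (cmod (c t k))\<^sup>2) * real (card ?J)"
      by (rule sum_squared_le_sum_of_squares)
    also have "(\<Sum>k\<in>?J. (cmod (c t k))\<^sup>2) = (\<Sum>k\<in>?J. (cmod (c0 k))\<^sup>2)"
      using capped_mass_conserved[OF c(2)] c(1) by (simp add: abs_le_iff)
    finally show ?thesis by (simp add: L_def mult.commute)
  qed
  then have cap: "cap L (trig N (c t) x) = (cmod (trig N (c t) x))\<^sup>2 * trig N (c t) x" for t x
    by (simp add: cap_def min_absorb1)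
  have "galerkin N c"
  proof
    fix t k assume k: "\<bar>k\<bar> \<le> int N"
    show "((\<lambda>t. c t k) has_vector_derivative
        - \<i> * (of_int (k\<^sup>2) * c t k - fc (\<lambda>x. (cmod (trig N (c t) x))\<^sup>2 * trig N (c t) x) k)) (at t)"
      using c(2)[OF k, of t] k unfolding galerkin_coeff_def cap by (simp only: fc_trig if_True)
  qed
  then show ?thesis using c(1) that by blast
qed

section \<open>Conservation of mass and energy\<close>

context galerkin
begin

definition V :: "real \<Rightarrow> real \<Rightarrow> complex" where
  "V t x = trig N (c t) x"

definition nonlin :: "real \<Rightarrow> int \<Rightarrow> complex" where
  "nonlin t k = fc (\<lambda>x. (cmod (V t x))\<^sup>2 * V t x) k"

definition c' :: "real \<Rightarrow> int \<Rightarrow> complex" where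
  "c' t k = - \<i> * (of_int (k\<^sup>2) * c t k - nonlin t k)"

definition mass :: "real \<Rightarrow> real" where
  "mass t = (\<Sum>k\<in>{-int N..int N}. (cmod (c t k))\<^sup>2)"

definition Dir :: "real \<Rightarrow> real" where
  "Dir t = (\<Sum>k\<in>{-int N..int N}. of_int (k\<^sup>2) * (cmod (c t k))\<^sup>2)"

definition Quart :: "real \<Rightarrow> real" where
  "Quart t = mean (\<lambda>x. (cmod (V t x)) ^ 4)"

lemma c_deriv: "\<bar>k\<bar> \<le> int N \<Longrightarrow> ((\<lambda>t. c t k) has_vector_derivative c' t k) (at t)"
  using ode[of k t] by (simp only: c'_def nonlin_def V_def)

lemma continuous_c: "\<bar>k\<bar> \<le> int N \<Longrightarrow> continuous_on A (\<lambda>t. c t k)"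
  by (auto intro!: continuous_at_imp_continuous_on has_vector_derivative_continuous[OF c_deriv])

lemma continuous_V: "continuous_on A (V t)"
  unfolding V_def[abs_def] by (intro continuous_intros)

lemma continuous_V_joint: "continuous_on A (\<lambda>(t, x). V t x)"
proof -
  have "continuous_on A (\<lambda>p. c (fst p) k)" if "k \<in> {-int N..int N}" for k
    by (rule continuous_on_compose2[OF continuous_c[of k UNIV]]) (use that in \<open>auto intro!: continuous_intros\<close>)
  then show ?thesis
    unfolding V_def trig_def case_prod_unfold
    by (intro continuous_on_sum continuous_on_mult) (auto intro!: continuous_intros)
qed

lemma continuous_nonlin: "continuous_on UNIV (\<lambda>t. nonlin t k)"
  unfolding nonlin_def fc_def
proof (rule continuous_on_mean)
  have "continuous_on UNIV (\<lambda>p. V (fst p) (snd p))"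
    using continuous_V_joint by (simp add: case_prod_unfold)
  then show "continuous_on UNIV (\<lambda>(t, x). complex_of_real ((cmod (V t x))\<^sup>2) * V t x * cis (- (of_int k * x)))"
    unfolding case_prod_unfold by (intro continuous_intros)
qed

lemma continuous_c': "\<bar>k\<bar> \<le> int N \<Longrightarrow> continuous_on UNIV (\<lambda>t. c' t k)"
  unfolding c'_def by (intro continuous_intros continuous_c continuous_nonlin)

lemma sum_nonlin_V: "(\<Sum>k\<in>{-int N..int N}. cnj (d k) * nonlin t k) =
    mean (\<lambda>x. (cmod (V t x))\<^sup>2 * V t x * cnj (trig N d x))"
  unfolding nonlin_def by (rule sum_cnj_fc) (intro continuous_intros continuous_V)

lemma mass_deriv: "(mass has_real_derivative 0) (at t)"
proof -
  let ?J = "{-int N..int N}"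
  have "(mass has_real_derivative (\<Sum>k\<in>?J. 2 * Re (cnj (c t k) * c' t k))) (at t)"
    unfolding mass_def[abs_def] by (intro DERIV_sum cmod_square_has_real_derivative c_deriv) auto
  also have "(\<Sum>k\<in>?J. 2 * Re (cnj (c t k) * c' t k)) = (\<Sum>k\<in>?J. - 2 * Im (cnj (c t k) * nonlin t k))"
    by (rule sum.cong) (auto simp: c'_def algebra_simps)
  also have "\<dots> = - 2 * Im (\<Sum>k\<in>?J. cnj (c t k) * nonlin t k)"
    by (simp only: sum_distrib_left Im_sum)
  also have "(\<Sum>k\<in>?J. cnj (c t k) * nonlin t k) = mean (\<lambda>x. (cmod (V t x))\<^sup>2 * V t x * cnj (V t x))"
    unfolding sum_nonlin_V V_def ..
  also have "(\<lambda>x. complex_of_real ((cmod (V t x))\<^sup>2) * V t x * cnj (V t x)) =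
      (\<lambda>x. complex_of_real ((cmod (V t x))\<^sup>2 * (cmod (V t x))\<^sup>2))"
    by (simp only: mult.assoc complex_norm_square[symmetric] of_real_mult)
  also have "mean \<dots> = of_real (mean (\<lambda>x. (cmod (V t x))\<^sup>2 * (cmod (V t x))\<^sup>2))"
    by (rule mean_of_real) (intro continuous_intros continuous_V)
  finally show ?thesis by simp
qed

lemma mass_eq: "mass t = mass 0"
  using mass_deriv DERIV_isconst_all by blast

text \<open>The time derivative of V is again a trigonometric polynomial of degree N, so the
  integral of |V|^2 V against its conjugate becomes a finite sum over modes, ready to be combined
  with the derivative of \<open>Dir\<close>.\<close>

lemma Quart_deriv:
  "(Quart has_real_derivative 4 * Re (\<Sum>k\<in>{-int N..int N}. cnj (c' t k) * nonlin t k)) (at t)"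
proof -
  let ?J = "{-int N..int N}"
  define V' where "V' t x = trig N (c' t) x" for t x
  have V': "((\<lambda>t. V t x) has_vector_derivative V' t x) (at t)" for t x
    unfolding V_def V'_def trig_def
    by (intro has_vector_derivative_sum has_vector_derivative_mult_left c_deriv) auto
  have cV': "continuous_on UNIV (\<lambda>p. V' (fst p) (snd p))"
  proof -
    have "continuous_on UNIV (\<lambda>p. c' (fst p) k)" if "k \<in> ?J" for k
      by (rule continuous_on_compose2[OF continuous_c'[of k]]) (use that in \<open>auto intro!: continuous_intros\<close>)
    then show ?thesis
      unfolding V'_def trig_def
      by (intro continuous_on_sum continuous_on_mult) (auto intro!: continuous_intros)
  qed
  have cV: "continuous_on UNIV (\<lambda>p. V (fst p) (snd p))"
    using continuous_V_joint by (simp add: case_prod_unfold)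
  define f' where "f' t x = 4 * Re ((cmod (V t x))\<^sup>2 * V t x * cnj (V' t x))" for t x
  have der: "((\<lambda>t. (cmod (V t x)) ^ 4) has_vector_derivative f' t x) (at t)" for t x
  proof -
    have "((\<lambda>t. ((cmod (V t x))\<^sup>2)\<^sup>2) has_real_derivative f' t x) (at t)"
      by (rule DERIV_cong[OF DERIV_power[OF cmod_square_has_real_derivative[OF V']]])
        (simp add: f'_def algebra_simps power2_eq_square)
    then show ?thesis
      by (simp add: has_real_derivative_iff_has_vector_derivative flip: power_mult)
  qed
  have "((\<lambda>t. mean (\<lambda>x. (cmod (V t x)) ^ 4)) has_vector_derivative mean (f' t)) (at t)"
    by (rule mean_has_vector_derivative)
      (use der in \<open>auto simp: case_prod_unfold f'_def intro!: continuous_intros cV cV'\<close>)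
  also have "mean (f' t) = 4 * Re (mean (\<lambda>x. (cmod (V t x))\<^sup>2 * V t x * cnj (V' t x)))"
  proof -
    have "bounded_linear (\<lambda>z. 4 * Re z)"
      using bounded_linear_compose[OF bounded_linear_mult_right[of 4] bounded_linear_Re] by simp
    moreover have "continuous_on UNIV (\<lambda>x. complex_of_real ((cmod (V t x))\<^sup>2) * V t x * cnj (V' t x))"
      unfolding V'_def by (intro continuous_intros continuous_V)
    ultimately show ?thesis
      unfolding f'_def by (rule mean_linear)
  qed
  also have "mean (\<lambda>x. (cmod (V t x))\<^sup>2 * V t x * cnj (V' t x)) = (\<Sum>k\<in>?J. cnj (c' t k) * nonlin t k)"
    unfolding sum_nonlin_V V'_def ..
  finally show ?thesis
    by (simp only: has_real_derivative_iff_has_vector_derivative Quart_def[abs_def])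
qed

text \<open>Hamiltonian structure mode by mode: the derivative is the sum of 2 Re (cnj c_k' (k^2 c_k
  - n_k)), where n_k is the nonlinear term. By the equation the last factor equals i c_k', so every
  summand vanishes.\<close>

lemma energy_eq: "Dir t - Quart t / 2 = Dir 0 - Quart 0 / 2"
proof -
  let ?J = "{-int N..int N}"
  have "((\<lambda>t. Dir t - Quart t / 2) has_real_derivative 0) (at t)" for t
  proof -
    have "(Dir has_real_derivative (\<Sum>k\<in>?J. of_int (k\<^sup>2) * (2 * Re (cnj (c t k) * c' t k)))) (at t)"
      unfolding Dir_def[abs_def]
      by (intro DERIV_sum DERIV_cmult cmod_square_has_real_derivative c_deriv) auto
    then have "((\<lambda>t. Dir t - Quart t / 2) has_real_derivative
        (\<Sum>k\<in>?J. of_int (k\<^sup>2) * (2 * Re (cnj (c t k) * c' t k)))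
        - 4 * Re (\<Sum>k\<in>?J. cnj (c' t k) * nonlin t k) / 2) (at t)"
      by (intro DERIV_diff DERIV_cdivide Quart_deriv)
    also have "4 * Re (\<Sum>k\<in>?J. cnj (c' t k) * nonlin t k) / 2 = 2 * Re (\<Sum>k\<in>?J. cnj (c' t k) * nonlin t k)"
      by linarith
    also have "\<dots> = (\<Sum>k\<in>?J. 2 * Re (cnj (c' t k) * nonlin t k))"
      by (simp only: Re_sum sum_distrib_left)
    also have "(\<Sum>k\<in>?J. of_int (k\<^sup>2) * (2 * Re (cnj (c t k) * c' t k))) - \<dots> =
        (\<Sum>k\<in>?J. 2 * Re (cnj (c' t k) * (of_int (k\<^sup>2) * c t k - nonlin t k)))"
      unfolding sum_subtractf[symmetric] by (rule sum.cong) (auto simp: algebra_simps)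
    also have "\<dots> = (\<Sum>k\<in>?J. 0)"
      by (rule sum.cong) (auto simp: c'_def algebra_simps)
    finally show ?thesis by simp
  qed
  then show ?thesis using DERIV_isconst_all by blast
qed

end

section \<open>A priori bounds\<close>

lemma sum_inverse_squares_nat:
  assumes "1 \<le> K" "K \<le> n"
  shows "(\<Sum>k\<in>{K<..n}. 1 / (real k)\<^sup>2) \<le> 1 / real K - 1 / real n"
  using assms(2)
proof (induction n rule: dec_induct)
  case base
  then show ?case by simp
next
  case (step n)
  have n: "0 < real n" using assms step by simp
  have "{K<..Suc n} = insert (Suc n) {K<..n}" using step by auto
  then have "(\<Sum>k\<in>{K<..Suc n}. 1 / (real k)\<^sup>2) \<le> 1 / (real (Suc n))\<^sup>2 + (1 / real K - 1 / real n)"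
    using step by simp
  also have "1 / (real (Suc n))\<^sup>2 \<le> 1 / real n - 1 / real (Suc n)"
  proof -
    have "1 / (real (Suc n))\<^sup>2 \<le> 1 / (real n * real (Suc n))"
      using n by (intro divide_left_mono) (auto simp: power2_eq_square)
    also have "\<dots> = 1 / real n - 1 / real (Suc n)" using n by (simp add: field_simps)
    finally show ?thesis .
  qed
  finally show ?case by simp
qed

lemma finite_bounded_int [simp]: "finite {k. - int N \<le> k \<and> k \<le> int N \<and> P k}"
  by (rule finite_subset[of _ "{-int N..int N}"]) auto

lemma sum_Un_le:
  fixes f :: "'a \<Rightarrow> real"
  assumes "finite A" "finite B" "\<And>x. 0 \<le> f x"
  shows "sum f (A \<union> B) \<le> sum f A + sum f B"
  using assms by (simp add: sum_Un sum_nonneg)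

lemma sum_inverse_squares_tail:
  assumes "1 \<le> K"
  shows "(\<Sum>k | k \<in> {-int N..int N} \<and> int K < \<bar>k\<bar>. 1 / (real_of_int k)\<^sup>2) \<le> 2 / real K"
proof -
  let ?A = "{K<..N}"
  have "{k. k \<in> {-int N..int N} \<and> int K < \<bar>k\<bar>} = int ` ?A \<union> (\<lambda>k. - int k) ` ?A" (is "?L = ?R")
  proof (intro equalityI subsetI)
    fix k assume "k \<in> ?L"
    then show "k \<in> ?R"
      by (cases "k \<ge> 0") (auto intro!: image_eqI[of _ _ "nat \<bar>k\<bar>"])
  qed auto
  then have "(\<Sum>k | k \<in> {-int N..int N} \<and> int K < \<bar>k\<bar>. 1 / (real_of_int k)\<^sup>2)
      \<le> (\<Sum>k\<in>int ` ?A. 1 / (real_of_int k)\<^sup>2) + (\<Sum>k\<in>(\<lambda>k. - int k) ` ?A. 1 / (real_of_int k)\<^sup>2)"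
    by (simp only:) (intro sum_Un_le, auto)
  also have "\<dots> = 2 * (\<Sum>k\<in>?A. 1 / (real k)\<^sup>2)"
    by (subst (1 2) sum.reindex) (auto simp: inj_on_def)
  also have "(\<Sum>k\<in>?A. 1 / (real k)\<^sup>2) \<le> 1 / real K"
  proof (cases "K \<le> N")
    case True
    have "0 \<le> 1 / real N" by simp
    then show ?thesis using sum_inverse_squares_nat[OF assms True] by linarith
  qed simp
  finally show ?thesis by simp
qed

definition dirichlet :: "nat \<Rightarrow> (int \<Rightarrow> complex) \<Rightarrow> real" where
  "dirichlet N c = (\<Sum>k\<in>{-int N..int N}. of_int (k\<^sup>2) * (cmod (c k))\<^sup>2)"

text \<open>Cauchy-Schwarz with the weights 1 / k and k: one factor is the sum of inverse squares,
  the other at most the Dirichlet energy.\<close>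

lemma weighted_l1_bound:
  assumes "A \<subseteq> {-int N..int N}" "0 \<notin> A" and B: "(\<Sum>k\<in>A. 1 / (real_of_int k)\<^sup>2) \<le> B"
  shows "(\<Sum>k\<in>A. cmod (c k))\<^sup>2 \<le> B * dirichlet N c"
proof -
  have "(\<Sum>k\<in>A. cmod (c k)) = (\<Sum>k\<in>A. 1 / real_of_int k * (real_of_int k * cmod (c k)))"
    by (rule sum.cong) (use assms(2) in auto)
  then have "(\<Sum>k\<in>A. cmod (c k))\<^sup>2 \<le> (\<Sum>k\<in>A. (1 / real_of_int k)\<^sup>2) * (\<Sum>k\<in>A. (real_of_int k * cmod (c k))\<^sup>2)"
    by (simp only: Cauchy_Schwarz_ineq_sum)
  also have "\<dots> \<le> B * dirichlet N c"
  proof (intro mult_mono)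
    show "(\<Sum>k\<in>A. (1 / real_of_int k)\<^sup>2) \<le> B" using B by (simp add: power_divide)
    then show "0 \<le> B" by (rule order_trans[rotated]) (auto intro: sum_nonneg)
    show "(\<Sum>k\<in>A. (real_of_int k * cmod (c k))\<^sup>2) \<le> dirichlet N c"
      unfolding dirichlet_def power_mult_distrib of_int_power
      by (rule sum_mono2) (use assms(1) in auto)
  qed (auto intro: sum_nonneg)
  finally show ?thesis .
qed

lemma tail_l1_bound:
  assumes "1 \<le> K"
  shows "(\<Sum>k | k \<in> {-int N..int N} \<and> int K < \<bar>k\<bar>. cmod (c k))\<^sup>2 \<le> 2 / real K * dirichlet N c"
  by (rule weighted_l1_bound[OF _ _ sum_inverse_squares_tail[OF assms]]) auto

lemma nonzero_l1_bound: "(\<Sum>k\<in>{-int N..int N} - {0}. cmod (c k))\<^sup>2 \<le> 4 * dirichlet N c"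
proof (rule weighted_l1_bound)
  let ?g = "\<lambda>k. 1 / (real_of_int k)\<^sup>2"
  have "{-int N..int N} - {0} \<subseteq> {1, -1} \<union> {k. k \<in> {-int N..int N} \<and> int 1 < \<bar>k\<bar>}" by auto
  then have "sum ?g ({-int N..int N} - {0}) \<le> sum ?g ({1, -1} \<union> {k. k \<in> {-int N..int N} \<and> int 1 < \<bar>k\<bar>})"
    by (intro sum_mono2) auto
  also have "\<dots> \<le> sum ?g {1, -1} + sum ?g {k. k \<in> {-int N..int N} \<and> int 1 < \<bar>k\<bar>}"
    by (intro sum_Un_le) auto
  also have "\<dots> \<le> 2 + 2 / real 1"
    by (intro add_mono sum_inverse_squares_tail) auto
  finally show "sum ?g ({-int N..int N} - {0}) \<le> 4" by simp
qed auto

lemma norm_diff_le_of_vector_derivative: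
  fixes f :: "real \<Rightarrow> 'a::real_normed_vector"
  assumes der: "\<And>t. (f has_vector_derivative f' t) (at t)" and b: "\<And>t. norm (f' t) \<le> B"
  shows "norm (f t - f s) \<le> B * \<bar>t - s\<bar>"
proof -
  have "norm (f t - f s) \<le> B * norm (t - s)"
  proof (rule differentiable_bound[OF convex_UNIV])
    show "(f has_derivative (\<lambda>h. h *\<^sub>R f' t)) (at t within UNIV)" for t
      using der[of t] by (simp add: has_vector_derivative_def)
    show "onorm (\<lambda>h. h *\<^sub>R f' t) \<le> B" for t
    proof (rule onorm_le)
      show "norm (h *\<^sub>R f' t) \<le> B * norm h" for h
        using mult_right_mono[OF b[of t], of "\<bar>h\<bar>"] by (simp add: mult.commute)
    qed
  qed auto
  then show ?thesis by simp
qed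

lemma cmod_cis_diff_le: "cmod (cis a - cis b) \<le> \<bar>a - b\<bar>"
proof (rule norm_diff_le_of_vector_derivative[of cis "\<lambda>t. \<i> * cis t" 1, simplified])
  show "(cis has_vector_derivative \<i> * cis t) (at t)" for t
    unfolding cis_conv_exp[abs_def]
    by (auto intro!: derivative_eq_intros has_vector_derivative_real_field)
qed (simp add: norm_mult)

context galerkin
begin

lemma Dir_dirichlet: "Dir t = dirichlet N (c t)"
  by (simp add: Dir_def dirichlet_def)

lemma Dir_nonneg: "0 \<le> Dir t"
  unfolding Dir_def by (intro sum_nonneg mult_nonneg_nonneg) auto

lemma mass_nonneg: "0 \<le> mass t"
  unfolding mass_def by (intro sum_nonneg) auto

lemma cmod_c_le: "\<bar>k\<bar> \<le> int N \<Longrightarrow> (cmod (c t k))\<^sup>2 \<le> mass t"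
  unfolding mass_def by (rule member_le_sum[of _ _ "\<lambda>k. (cmod (c t k))\<^sup>2"]) auto

lemma mass_eq_mean: "mass t = mean (\<lambda>x. (cmod (V t x))\<^sup>2)"
  unfolding mass_def V_def parseval_trig ..

text \<open>A one-dimensional Sobolev inequality with a free parameter: the at most 2 K + 1 low
  modes are paid for by the mass, the high modes by the Dirichlet energy with a factor that can be
  made as small as needed.\<close>

lemma l1_bound:
  assumes "1 \<le> K"
  shows "(\<Sum>k\<in>{-int N..int N}. cmod (c t k))\<^sup>2 \<le> 2 * ((2 * real K + 1) * mass t + 2 / real K * Dir t)"
proof -
  let ?J = "{-int N..int N}"
  let ?l = "\<Sum>k | k \<in> ?J \<and> \<bar>k\<bar> \<le> int K. cmod (c t k)" and ?h = "\<Sum>k | k \<in> ?J \<and> int K < \<bar>k\<bar>. cmod (c t k)"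
  have "(\<Sum>k\<in>?J. cmod (c t k)) = ?l + ?h"
    by (subst sum.union_disjoint[symmetric]) (auto intro: sum.cong)
  then have "(\<Sum>k\<in>?J. cmod (c t k))\<^sup>2 \<le> 2 * (?l\<^sup>2 + ?h\<^sup>2)"
    using sum_squares_bound[of ?l ?h] by (simp add: power2_sum)
  also have "?l\<^sup>2 \<le> (\<Sum>k | k \<in> ?J \<and> \<bar>k\<bar> \<le> int K. (cmod (c t k))\<^sup>2) * real (card {k. k \<in> ?J \<and> \<bar>k\<bar> \<le> int K})"
    by (rule sum_squared_le_sum_of_squares)
  also have "\<dots> \<le> mass t * (2 * real K + 1)"
  proof (intro mult_mono)
    show "(\<Sum>k | k \<in> ?J \<and> \<bar>k\<bar> \<le> int K. (cmod (c t k))\<^sup>2) \<le> mass t"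
      unfolding mass_def by (rule sum_mono2) auto
    have "card {k. k \<in> ?J \<and> \<bar>k\<bar> \<le> int K} \<le> card {-int K..int K}"
      by (rule card_mono) auto
    then show "real (card {k. k \<in> ?J \<and> \<bar>k\<bar> \<le> int K}) \<le> 2 * real K + 1" by simp
  qed (auto intro: mass_nonneg)
  also have "?h\<^sup>2 \<le> 2 / real K * Dir t"
    unfolding Dir_dirichlet by (rule tail_l1_bound[OF assms])
  finally show ?thesis by (simp add: mult.commute)
qed

lemma V_le_l1: "cmod (V t x) \<le> (\<Sum>k\<in>{-int N..int N}. cmod (c t k))"
  unfolding V_def by (rule cmod_trig_le)

lemma V_square_le:
  assumes "mass 0 \<le> 2"
  shows "(cmod (V t x))\<^sup>2 \<le> 68 + Dir t / 2"
proof -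
  have "(cmod (V t x))\<^sup>2 \<le> (\<Sum>k\<in>{-int N..int N}. cmod (c t k))\<^sup>2"
    by (intro power_mono V_le_l1) auto
  \<comment> \<open>K = 8 makes the coefficient of \<open>Dir t\<close> equal to 1/2; the mass term
    is then at most 2 * 17 * 2 = 68.\<close>
  also have "\<dots> \<le> 2 * ((2 * real 8 + 1) * mass t + 2 / real 8 * Dir t)"
    by (rule l1_bound) simp
  also have "\<dots> \<le> 68 + Dir t / 2" using assms mass_eq[of t] by simp
  finally show ?thesis .
qed

text \<open>The focusing energy has a negative quartic part. With mass at most 2 and the factor 1/2
  in \<open>V_square_le\<close>, the quartic term is at most 136 + \<open>Dir t\<close>, and the
  energy contains half of it, so half of the Dirichlet energy survives absorption.\<close>

lemma Dir_bound:
  assumes "mass 0 \<le> 2"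
  shows "Dir t \<le> 2 * Dir 0 + 136"
proof -
  have "Quart t \<le> mean (\<lambda>x. (68 + Dir t / 2) * (cmod (V t x))\<^sup>2)"
    unfolding Quart_def
  proof (rule mean_mono)
    fix x
    have "(cmod (V t x)) ^ 4 = (cmod (V t x))\<^sup>2 * (cmod (V t x))\<^sup>2"
      by (simp flip: power_add)
    also have "\<dots> \<le> (68 + Dir t / 2) * (cmod (V t x))\<^sup>2"
      by (intro mult_right_mono V_square_le assms) auto
    finally show "(cmod (V t x)) ^ 4 \<le> (68 + Dir t / 2) * (cmod (V t x))\<^sup>2" .
  qed (intro continuous_intros continuous_V)+
  also have "\<dots> = (68 + Dir t / 2) * mass t"
    unfolding mass_eq_mean by (rule mean_mult_left) (intro continuous_intros continuous_V)
  also have "\<dots> \<le> (68 + Dir t / 2) * 2"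
    using assms mass_eq[of t] Dir_nonneg[of t] by (intro mult_left_mono) auto
  finally have "Quart t \<le> 136 + Dir t" by simp
  moreover have "0 \<le> Quart 0"
    unfolding Quart_def using mean_mono[of "\<lambda>x. 0" "\<lambda>x. (cmod (V 0 x)) ^ 4"]
    by (simp add: continuous_intros continuous_V)
  ultimately show ?thesis using energy_eq[of t] by simp
qed

lemma V_bound:
  assumes "mass 0 \<le> 2" "Dir t \<le> B"
  shows "cmod (V t x) \<le> 68 + B"
proof (rule power2_le_imp_le)
  have B: "0 \<le> B" using assms(2) Dir_nonneg[of t] by simp
  have "(cmod (V t x))\<^sup>2 \<le> 68 + B" using V_square_le[OF assms(1), of t x] assms(2) B by simp
  also have "\<dots> \<le> (68 + B)\<^sup>2" using B by (simp add: power2_eq_square algebra_simps)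
  finally show "(cmod (V t x))\<^sup>2 \<le> (68 + B)\<^sup>2" .
  show "0 \<le> 68 + B" using B by simp
qed

lemma nonlin_bound:
  assumes "mass 0 \<le> 2" "Dir t \<le> B"
  shows "cmod (nonlin t k) \<le> (68 + B) ^ 3"
proof -
  have "cmod (nonlin t k) \<le> mean (\<lambda>x. (68 + B) ^ 3)"
    unfolding nonlin_def
  proof (rule norm_fc_le)
    fix x
    have "cmod ((cmod (V t x))\<^sup>2 * V t x) = (cmod (V t x)) ^ 3"
      by (simp add: norm_mult norm_power power_def numeral_eq_Suc)
    also have "\<dots> \<le> (68 + B) ^ 3" by (intro power_mono V_bound assms) auto
    finally show "cmod ((cmod (V t x))\<^sup>2 * V t x) \<le> (68 + B) ^ 3" .
  qed (intro continuous_intros continuous_V)+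
  then show ?thesis by simp
qed

text \<open>Joint equicontinuity in time and space with constants free of N: modes up to K are
  Lipschitz in t by the equation and in x by differentiation, and the remaining modes are small in
  l^1 by the Dirichlet bound. K is chosen only when a precision is prescribed.\<close>

lemma V_modulus:
  assumes m: "mass 0 \<le> 2" and B: "\<And>t. Dir t \<le> B" and K: "1 \<le> K"
  shows "cmod (V t x - V s y) \<le>
    (2 * real K + 1) * ((2 * (real K)\<^sup>2 + (68 + B) ^ 3) * \<bar>t - s\<bar> + 2 * real K * \<bar>x - y\<bar>)
      + 2 * sqrt (2 * B / real K)"
proof -
  let ?J = "{-int N..int N}"
  let ?L = "{k. k \<in> ?J \<and> \<bar>k\<bar> \<le> int K}" and ?H = "{k. k \<in> ?J \<and> int K < \<bar>k\<bar>}"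
  let ?g = "\<lambda>k. c t k * cis (of_int k * x) - c s k * cis (of_int k * y)"
  let ?b = "(2 * (real K)\<^sup>2 + (68 + B) ^ 3) * \<bar>t - s\<bar> + 2 * real K * \<bar>x - y\<bar>"
  have B0: "0 \<le> B" using B[of 0] Dir_nonneg[of 0] by simp
  have c2: "cmod (c t k) \<le> 2" if "k \<in> ?J" for t k
  proof (rule power2_le_imp_le)
    have "\<bar>k\<bar> \<le> int N" using that by auto
    then show "(cmod (c t k))\<^sup>2 \<le> 2\<^sup>2" using cmod_c_le[of k t] mass_eq[of t] m by simp
  qed simp
  have tail: "(\<Sum>k\<in>?H. cmod (c t k)) \<le> sqrt (2 * B / real K)" for t
  proof (rule real_le_rsqrt)
    have "(\<Sum>k\<in>?H. cmod (c t k))\<^sup>2 \<le> 2 / real K * Dir t"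
      unfolding Dir_dirichlet by (rule tail_l1_bound[OF K])
    also have "\<dots> \<le> 2 / real K * B" by (intro mult_left_mono B) auto
    finally show "(\<Sum>k\<in>?H. cmod (c t k))\<^sup>2 \<le> 2 * B / real K" by simp
  qed
  have low: "cmod (?g k) \<le> ?b" if k: "k \<in> ?L" for k
  proof -
    have kN: "\<bar>k\<bar> \<le> int N" and kJ: "k \<in> ?J" and kK: "\<bar>k\<bar> \<le> int K" using k by auto
    have kK': "\<bar>real_of_int k\<bar> \<le> real K" using kK by linarith
    then have k2: "real_of_int (k\<^sup>2) \<le> (real K)\<^sup>2"
      using power_mono[of "\<bar>real_of_int k\<bar>" "real K" 2] by simp
    have "cmod (c t k - c s k) \<le> (2 * (real K)\<^sup>2 + (68 + B) ^ 3) * \<bar>t - s\<bar>"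
    proof (rule norm_diff_le_of_vector_derivative[OF c_deriv[OF kN]])
      fix t
      have "cmod (c' t k) = cmod (of_int (k\<^sup>2) * c t k - nonlin t k)"
        unfolding c'_def by (simp only: norm_mult norm_minus_cancel norm_ii mult_1)
      also have "\<dots> \<le> cmod (of_int (k\<^sup>2) * c t k) + cmod (nonlin t k)" by (rule norm_triangle_ineq4)
      also have "cmod (of_int (k\<^sup>2) * c t k) = real_of_int (k\<^sup>2) * cmod (c t k)"
        by (simp add: norm_mult norm_power)
      also have "\<dots> \<le> (real K)\<^sup>2 * 2" using k2 c2[OF kJ] by (intro mult_mono) auto
      finally show "cmod (c' t k) \<le> 2 * (real K)\<^sup>2 + (68 + B) ^ 3"
        using nonlin_bound[OF m B, of t k] by simp
    qed
    moreover have "cmod (c s k * (cis (of_int k * x) - cis (of_int k * y))) \<le> 2 * (real K * \<bar>x - y\<bar>)"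
      unfolding norm_mult
    proof (intro mult_mono c2 kJ)
      have "cmod (cis (of_int k * x) - cis (of_int k * y)) \<le> \<bar>of_int k * x - of_int k * y\<bar>"
        by (rule cmod_cis_diff_le)
      also have "\<dots> = \<bar>real_of_int k\<bar> * \<bar>x - y\<bar>" by (simp add: abs_mult flip: right_diff_distrib)
      also have "\<dots> \<le> real K * \<bar>x - y\<bar>" using kK' by (intro mult_right_mono) auto
      finally show "cmod (cis (of_int k * x) - cis (of_int k * y)) \<le> real K * \<bar>x - y\<bar>" .
    qed auto
    moreover have "?g k = (c t k - c s k) * cis (of_int k * x) + c s k * (cis (of_int k * x) - cis (of_int k * y))"
      by (simp add: algebra_simps)
    then have "cmod (?g k) \<le> cmod ((c t k - c s k) * cis (of_int k * x)) +
        cmod (c s k * (cis (of_int k * x) - cis (of_int k * y)))"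
      by (simp only: norm_triangle_ineq)
    ultimately show ?thesis by (simp add: norm_mult)
  qed
  have b0: "0 \<le> ?b" using B0 by simp
  have "V t x - V s y = (\<Sum>k\<in>?J. ?g k)"
    by (simp add: V_def trig_def sum_subtractf)
  also have "\<dots> = (\<Sum>k\<in>?L. ?g k) + (\<Sum>k\<in>?H. ?g k)"
    by (subst sum.union_disjoint[symmetric]) (auto intro: sum.cong)
  finally have "cmod (V t x - V s y) \<le> cmod (\<Sum>k\<in>?L. ?g k) + cmod (\<Sum>k\<in>?H. ?g k)"
    by (simp only: norm_triangle_ineq)
  also have "cmod (\<Sum>k\<in>?L. ?g k) \<le> (\<Sum>k\<in>?L. ?b)" by (rule sum_norm_le) (rule low)
  also have "\<dots> = real (card ?L) * ?b" by simp
  also have "\<dots> \<le> (2 * real K + 1) * ?b"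
  proof (rule mult_right_mono[OF _ b0])
    have "card ?L \<le> card {-int K..int K}" by (rule card_mono) auto
    then show "real (card ?L) \<le> 2 * real K + 1" by simp
  qed
  also have "cmod (\<Sum>k\<in>?H. ?g k) \<le> (\<Sum>k\<in>?H. cmod (c t k) + cmod (c s k))"
    by (rule sum_norm_le) (rule order_trans[OF norm_triangle_ineq4], simp add: norm_mult)
  also have "\<dots> \<le> 2 * sqrt (2 * B / real K)"
    using tail[of t] tail[of s] by (simp add: sum.distrib)
  finally show ?thesis by simp
qed

end

section \<open>Modulational instability of the plane wave\<close>

text \<open>Here a, b, d stand for c_0, c_1, c_(-1), z for the fluctuation mass, \<delta> for
  \<open>Dir 0\<close>, and the r are remainders of the nonlinearity. Multiplication by cnj a strips
  off the phase of the mean: with A = |a|^2 the linear part is Q' = i (A - 1) Q + i A cnj P, and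
  likewise with P and Q exchanged. Hence (Im (Q P))' is A (|P|^2 + |Q|^2) up to small terms. As
  |P|^2 + |Q|^2 is at least 2 Im (Q P), the undisturbed rate is about 2, and the surplus over the
  claimed rate 1 pays for all errors.\<close>

lemma instability_algebra:
  fixes a b d r\<^sub>0 r\<^sub>1 r\<^sub>2 :: complex and \<delta> z :: real
  defines "Q \<equiv> cnj a * b" and "P \<equiv> cnj a * d"
  assumes a: "0.999 \<le> (cmod a)\<^sup>2" "(cmod a)\<^sup>2 \<le> 1.01"
    and bd: "(cmod b)\<^sup>2 + (cmod d)\<^sup>2 \<le> z" and z: "z \<le> 0.0001"
    and r: "cmod r\<^sub>0 \<le> 3.1 * z" "cmod r\<^sub>1 \<le> 3.1 * z" "cmod r\<^sub>2 \<le> 3.1 * z"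
    and z2: "z \<le> \<delta> + 2 * ((cmod b)\<^sup>2 + (cmod d)\<^sup>2)" and \<delta>: "0 \<le> \<delta>"
  shows "Im (Q * P) - 26 * \<delta>\<^sup>2 \<le> Im (
      (cnj (\<i> * ((cmod a)\<^sup>2 * a + r\<^sub>0)) * b
        + cnj a * (- \<i> * (b - (2 * (cmod a)\<^sup>2 * b + a\<^sup>2 * cnj d + r\<^sub>1)))) * P
      + Q * (cnj (\<i> * ((cmod a)\<^sup>2 * a + r\<^sub>0)) * d
        + cnj a * (- \<i> * (d - (2 * (cmod a)\<^sup>2 * d + a\<^sup>2 * cnj b + r\<^sub>2)))))"
proof -
  define A where "A = (cmod a)\<^sup>2"
  define e1 where "e1 = \<i> * (cnj a * r\<^sub>1 - cnj r\<^sub>0 * b)"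
  define e2 where "e2 = \<i> * (cnj a * r\<^sub>2 - cnj r\<^sub>0 * d)"
  define W where "W = (cmod P)\<^sup>2 + (cmod Q)\<^sup>2"
  define s where "s = cmod P + cmod Q"
  have A: "complex_of_real A = a * cnj a" by (simp only: A_def complex_norm_square)
  have q': "cnj (\<i> * ((cmod a)\<^sup>2 * a + r\<^sub>0)) * b
        + cnj a * (- \<i> * (b - (2 * (cmod a)\<^sup>2 * b + a\<^sup>2 * cnj d + r\<^sub>1)))
      = \<i> * (A - 1) * Q + \<i> * A * cnj P + e1"
    unfolding A_def[symmetric] e1_def P_def Q_def
    by (simp add: A algebra_simps power2_eq_square)
  have p': "cnj (\<i> * ((cmod a)\<^sup>2 * a + r\<^sub>0)) * d
        + cnj a * (- \<i> * (d - (2 * (cmod a)\<^sup>2 * d + a\<^sup>2 * cnj b + r\<^sub>2)))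
      = \<i> * (A - 1) * P + \<i> * A * cnj Q + e2"
    unfolding A_def[symmetric] e2_def P_def Q_def
    by (simp add: A algebra_simps power2_eq_square)
  have "Im ((\<i> * (A - 1) * Q + \<i> * A * cnj P + e1) * P + Q * (\<i> * (A - 1) * P + \<i> * A * cnj Q + e2))
      = 2 * (A - 1) * Re (Q * P) + A * W + Im (e1 * P + Q * e2)"
    unfolding W_def cmod_power2 by (simp add: algebra_simps power2_eq_square)
  moreover have "\<bar>2 * (A - 1) * Re (Q * P)\<bar> \<le> W / 100"
  proof -
    have "\<bar>2 * (A - 1) * Re (Q * P)\<bar> = \<bar>A - 1\<bar> * (2 * \<bar>Re (Q * P)\<bar>)"
      by (simp only: abs_mult abs_numeral mult_ac)
    also have "\<dots> \<le> 0.01 * W"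
    proof (intro mult_mono)
      show "\<bar>A - 1\<bar> \<le> 0.01" using a by (auto simp: A_def abs_if)
      have "2 * \<bar>Re (Q * P)\<bar> \<le> 2 * (cmod Q * cmod P)"
        using abs_Re_le_cmod[of "Q * P"] by (simp add: norm_mult)
      also have "\<dots> \<le> W" using sum_squares_bound[of "cmod P" "cmod Q"] by (simp add: W_def mult_ac)
      finally show "2 * \<bar>Re (Q * P)\<bar> \<le> W" .
    qed auto
    finally show ?thesis by simp
  qed
  moreover have "999 / 1000 * W \<le> A * W"
    using a by (intro mult_right_mono) (auto simp: A_def W_def)
  moreover have "\<bar>Im (e1 * P + Q * e2)\<bar> \<le> 35 / 100 * W + 26 * \<delta>\<^sup>2"
  proof -
    have z0: "0 \<le> z" using bd by (meson add_nonneg_nonneg order_trans zero_le_power2)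
    have ca: "cmod a \<le> 1.005" by (rule power2_le_imp_le) (use a in \<open>auto simp: power2_eq_square\<close>)
    have b2: "(cmod b)\<^sup>2 \<le> 0.0001" by (rule order_trans[OF order_trans[OF _ bd] z]) simp
    have cb: "cmod b \<le> 0.01" by (rule power2_le_imp_le) (use b2 in \<open>auto simp: power2_eq_square\<close>)
    have d2: "(cmod d)\<^sup>2 \<le> 0.0001" by (rule order_trans[OF order_trans[OF _ bd] z]) simp
    have cd: "cmod d \<le> 0.01" by (rule power2_le_imp_le) (use d2 in \<open>auto simp: power2_eq_square\<close>)
    have e: "cmod (\<i> * (cnj a * r - cnj r\<^sub>0 * x)) \<le> 3.2 * z" if "cmod r \<le> 3.1 * z" "cmod x \<le> 0.01" for r x
    proof -
      have "cmod (\<i> * (cnj a * r - cnj r\<^sub>0 * x)) \<le> cmod (cnj a * r) + cmod (cnj r\<^sub>0 * x)"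
        by (simp only: norm_mult norm_ii mult_1) (metis norm_mult norm_triangle_ineq4)
      also have "\<dots> \<le> 1.005 * (3.1 * z) + (3.1 * z) * 0.01"
        unfolding norm_mult complex_mod_cnj using that ca r(1) z0 by (intro add_mono mult_mono) auto
      also have "\<dots> \<le> 3.2 * z" using z0 by simp
      finally show ?thesis .
    qed
    have "\<bar>Im (e1 * P + Q * e2)\<bar> \<le> cmod (e1 * P + Q * e2)" by (rule abs_Im_le_cmod)
    also have "\<dots> \<le> cmod (e1 * P) + cmod (Q * e2)" by (rule norm_triangle_ineq)
    also have "\<dots> \<le> 3.2 * z * cmod P + cmod Q * (3.2 * z)"
      unfolding norm_mult using e[OF r(2) cb] e[OF r(3) cd]
      by (intro add_mono mult_right_mono mult_left_mono) (auto simp: e1_def e2_def)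
    also have "\<dots> = 3.2 * z * s" by (simp add: s_def algebra_simps)
    finally have *: "\<bar>Im (e1 * P + Q * e2)\<bar> \<le> 3.2 * z * s" .
    have s0: "0 \<le> s" by (simp add: s_def)
    have sW: "s\<^sup>2 \<le> 2 * W"
      using sum_squares_bound[of "cmod P" "cmod Q"] by (simp add: s_def W_def power2_sum)
    have s1: "s \<le> 0.0201"
    proof -
      have "s = cmod a * (cmod b + cmod d)" by (simp add: s_def P_def Q_def norm_mult algebra_simps)
      also have "\<dots> \<le> 1.005 * 0.02" using ca cb cd by (intro mult_mono) auto
      finally show ?thesis by simp
    qed
    have WA: "W = A * ((cmod b)\<^sup>2 + (cmod d)\<^sup>2)"
      by (simp add: W_def P_def Q_def A_def norm_mult power_mult_distrib algebra_simps)
    have "0.999 * ((cmod b)\<^sup>2 + (cmod d)\<^sup>2) \<le> W"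
      unfolding WA using a by (intro mult_right_mono) (auto simp: A_def)
    moreover have "0 \<le> W" by (simp add: W_def)
    \<comment> \<open>The fluctuation mass is traded for the unstable modes, since 2 / 0.999 is
      below 2.003. The error z s then splits into a cubic part, absorbed because s is small, and a
      part \<delta> s.\<close>
    ultimately have "z \<le> \<delta> + 2.003 * W" using z2 by simp
    then have "3.2 * z * s \<le> 3.2 * (\<delta> + 2.003 * W) * s"
      using s0 by (intro mult_right_mono) auto
    also have "\<dots> = 3.2 * \<delta> * s + (3.2 * 2.003 * s) * W" by (simp add: algebra_simps)
    also have "(3.2 * 2.003 * s) * W \<le> 0.15 * W"
      using s1 by (intro mult_right_mono) (auto simp: W_def)
    \<comment> \<open>Young's inequality; 1.6^2 / 0.1 = 25.6 is the origin of the constant 26. The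
      share 0.1 s^2 costs at most 0.2 W, which together with 0.15 W stays within 0.35 W.\<close>
    also have "3.2 * \<delta> * s \<le> 0.1 * s\<^sup>2 + 26 * \<delta>\<^sup>2"
    proof -
      have "0 \<le> (0.1 * s - 1.6 * \<delta>)\<^sup>2" by simp
      also have "\<dots> = 0.1 * (0.1 * s\<^sup>2 + 25.6 * \<delta>\<^sup>2 - 3.2 * \<delta> * s)"
        by (simp add: power2_eq_square algebra_simps)
      finally have "0 \<le> 0.1 * s\<^sup>2 + 25.6 * \<delta>\<^sup>2 - 3.2 * \<delta> * s" by simp
      moreover have "25.6 * \<delta>\<^sup>2 \<le> 26 * \<delta>\<^sup>2" by simp
      ultimately show ?thesis by linarith
    qed
    finally have "3.2 * z * s \<le> 0.1 * s\<^sup>2 + 26 * \<delta>\<^sup>2 + 0.15 * W" by simp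
    with * sW show ?thesis by simp
  qed
  moreover have "Im (Q * P) \<le> W / 2"
  proof -
    have "Im (Q * P) \<le> cmod Q * cmod P"
      using abs_Im_le_cmod[of "Q * P"] by (simp only: norm_mult abs_le_iff)
    also have "\<dots> \<le> W / 2" using sum_squares_bound[of "cmod P" "cmod Q"] by (simp add: W_def mult_ac)
    finally show ?thesis .
  qed
  moreover have "0 \<le> W" by (simp add: W_def)
  ultimately show ?thesis
    unfolding q' p' by linarith
qed

lemma exp_growth:
  fixes f f' :: "real \<Rightarrow> real"
  assumes "0 \<le> T" and der: "\<And>t. (f has_real_derivative f' t) (at t)"
    and ge: "\<And>t. 0 \<le> t \<Longrightarrow> t \<le> T \<Longrightarrow> f t - \<kappa> \<le> f' t"
  shows "exp T * (f 0 - \<kappa>) \<le> f T - \<kappa>"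
proof -
  have "(f 0 - \<kappa>) * exp (- 0) \<le> (f T - \<kappa>) * exp (- T)"
  proof (rule DERIV_nonneg_imp_nondecreasing[OF assms(1)])
    fix t assume t: "0 \<le> t" "t \<le> T"
    have "((\<lambda>t. (f t - \<kappa>) * exp (- t)) has_real_derivative (f' t - (f t - \<kappa>)) * exp (- t)) (at t)"
      by (rule derivative_eq_intros der | simp add: algebra_simps)+
    moreover have "0 \<le> (f' t - (f t - \<kappa>)) * exp (- t)" using ge[OF t] by simp
    ultimately show "\<exists>y. ((\<lambda>t. (f t - \<kappa>) * exp (- t)) has_real_derivative y) (at t) \<and> 0 \<le> y" by blast
  qed
  then show ?thesis by (simp add: exp_minus field_simps)
qed

section \<open>Energy control of the fluctuation and growth of the unstable product\<close>

context galerkin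
begin

definition fluct :: "real \<Rightarrow> real \<Rightarrow> complex" where
  "fluct t x = V t x - c t 0"

definition fluct_mass :: "real \<Rightarrow> real" where
  "fluct_mass t = (\<Sum>k\<in>{-int N..int N} - {0}. (cmod (c t k))\<^sup>2)"

lemma fluct_eq_trig: "fluct t x = trig N ((c t)(0 := 0)) x"
  by (simp add: fluct_def V_def trig_def sum.remove[of _ 0] cong: sum.cong_simp)

lemma fluct_le: "cmod (fluct t x) \<le> (\<Sum>k\<in>{-int N..int N} - {0}. cmod (c t k))"
proof -
  have "cmod (fluct t x) \<le> (\<Sum>k\<in>{-int N..int N}. cmod (((c t)(0 := 0)) k))"
    unfolding fluct_eq_trig by (rule cmod_trig_le)
  also have "\<dots> = (\<Sum>k\<in>{-int N..int N} - {0}. cmod (c t k))"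
    by (rule sum.mono_neutral_cong_right) auto
  finally show ?thesis .
qed

lemma continuous_fluct: "continuous_on A (fluct t)"
  unfolding fluct_def[abs_def] by (intro continuous_intros continuous_V)

lemma mean_fluct: "mean (\<lambda>x. (cmod (fluct t x))\<^sup>2) = fluct_mass t"
  unfolding fluct_eq_trig parseval_trig fluct_mass_def
  by (rule sum.mono_neutral_cong_right) auto

lemma mass_split: "mass t = (cmod (c t 0))\<^sup>2 + fluct_mass t"
  unfolding mass_def fluct_mass_def by (simp add: sum.remove[of _ 0])

lemma fluct_mass_nonneg: "0 \<le> fluct_mass t"
  unfolding fluct_mass_def by (intro sum_nonneg) auto

text \<open>Needed for two values of \<alpha>: the mass, for which the left side is a variance, and
  |c_0|^2, for which the left side is bounded by a multiple of the fluctuation mass.\<close>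

lemma mean_square_deviation:
  "mean (\<lambda>x. ((cmod (V t x))\<^sup>2 - \<alpha>)\<^sup>2) = Quart t - 2 * \<alpha> * mass t + \<alpha>\<^sup>2"
proof -
  have "mean (\<lambda>x. ((cmod (V t x))\<^sup>2 - \<alpha>)\<^sup>2) = mean (\<lambda>x. ((cmod (V t x)) ^ 4 - 2 * \<alpha> * (cmod (V t x))\<^sup>2) + \<alpha>\<^sup>2)"
    by (rule arg_cong[of _ _ mean], rule ext) (simp add: power2_diff algebra_simps flip: power_mult)
  also have "\<dots> = mean (\<lambda>x. (cmod (V t x)) ^ 4) - mean (\<lambda>x. 2 * \<alpha> * (cmod (V t x))\<^sup>2) + mean (\<lambda>x. \<alpha>\<^sup>2)"
    by (subst mean_add mean_diff, (intro continuous_intros continuous_V)+)+ simp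
  also have "mean (\<lambda>x. 2 * \<alpha> * (cmod (V t x))\<^sup>2) = 2 * \<alpha> * mean (\<lambda>x. (cmod (V t x))\<^sup>2)"
    by (rule mean_mult_left) (intro continuous_intros continuous_V)
  finally show ?thesis by (simp add: Quart_def mass_eq_mean)
qed

lemma Quart_ge: "(mass t)\<^sup>2 \<le> Quart t"
proof -
  have "mean (\<lambda>x. 0) \<le> mean (\<lambda>x. ((cmod (V t x))\<^sup>2 - mass t)\<^sup>2)"
    by (rule mean_mono) (auto intro!: continuous_intros continuous_V)
  then show ?thesis
    unfolding mean_square_deviation mean_const by (simp add: power2_eq_square)
qed

text \<open>Pointwise, |V|^2 differs from |c_0|^2 by at most (2 |c_0| + S) |z|, where z is the
  fluctuation. Taking \<alpha> = |c_0|^2 in \<open>mean_square_deviation\<close> and using 2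
  \<alpha> m - \<alpha>^2 \<le> m^2 for the mass m gives the claim.\<close>

lemma Quart_le:
  assumes S: "\<And>x. cmod (fluct t x) \<le> S"
  shows "Quart t \<le> (mass t)\<^sup>2 + (2 * cmod (c t 0) + S)\<^sup>2 * fluct_mass t"
proof -
  let ?\<alpha> = "(cmod (c t 0))\<^sup>2" and ?K = "(2 * cmod (c t 0) + S)\<^sup>2"
  have "mean (\<lambda>x. ((cmod (V t x))\<^sup>2 - ?\<alpha>)\<^sup>2) \<le> mean (\<lambda>x. ?K * (cmod (fluct t x))\<^sup>2)"
  proof (rule mean_mono)
    fix x
    have d: "\<bar>cmod (V t x) - cmod (c t 0)\<bar> \<le> cmod (fluct t x)"
      unfolding fluct_def by (rule norm_triangle_ineq3)
    have "\<bar>(cmod (V t x))\<^sup>2 - ?\<alpha>\<bar> = (cmod (V t x) + cmod (c t 0)) * \<bar>cmod (V t x) - cmod (c t 0)\<bar>"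
      by (simp add: power2_eq_square square_diff_square_factored abs_mult)
    also have "\<dots> \<le> (2 * cmod (c t 0) + S) * cmod (fluct t x)"
      using d S[of x] by (intro mult_mono) auto
    finally have "\<bar>(cmod (V t x))\<^sup>2 - ?\<alpha>\<bar>\<^sup>2 \<le> ((2 * cmod (c t 0) + S) * cmod (fluct t x))\<^sup>2"
      by (intro power_mono) auto
    then show "((cmod (V t x))\<^sup>2 - ?\<alpha>)\<^sup>2 \<le> ?K * (cmod (fluct t x))\<^sup>2"
      by (simp add: power_mult_distrib)
  qed (intro continuous_intros continuous_V continuous_fluct)+
  also have "\<dots> = ?K * fluct_mass t"
    unfolding mean_fluct[symmetric] by (rule mean_mult_left) (intro continuous_intros continuous_fluct)
  finally have "Quart t - 2 * ?\<alpha> * mass t + ?\<alpha>\<^sup>2 \<le> ?K * fluct_mass t"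
    unfolding mean_square_deviation .
  moreover have "0 \<le> (mass t - ?\<alpha>)\<^sup>2" by simp
  ultimately show ?thesis by (simp add: power2_diff algebra_simps)
qed

text \<open>The squared mass bounds the quartic term from below at time 0 and gives its leading part
  at time t. Since mass is conserved the two cancel in the energy identity, and what remains is
  proportional to the fluctuation mass.\<close>

lemma Dir_le_fluct:
  assumes "\<And>x. cmod (fluct t x) \<le> S"
  shows "Dir t \<le> Dir 0 + (2 * cmod (c t 0) + S)\<^sup>2 / 2 * fluct_mass t"
  using energy_eq[of t] Quart_ge[of 0] Quart_le[OF assms] mass_eq[of t] by simp

text \<open>Frequencies of modulus at least 2 have k^2 \<ge> 4; the two modes with k^2 = 1 fall
  short of the factor 4 by 3. Against the factor close to 2 in the upper bound, this gap is what
  makes all modes other than 1 and -1 controllable.\<close>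

lemma Dir_ge_fluct:
  assumes "1 \<le> N"
  shows "4 * fluct_mass t - 3 * ((cmod (c t 1))\<^sup>2 + (cmod (c t (-1)))\<^sup>2) \<le> Dir t"
proof -
  let ?J = "{-int N..int N} - {0}" and ?f = "\<lambda>k. (cmod (c t k))\<^sup>2"
  have sub: "{1, -1} \<subseteq> ?J" using assms by auto
  have "4 * fluct_mass t - 3 * (?f 1 + ?f (-1)) = 4 * (\<Sum>k\<in>?J - {1, -1}. ?f k) + (?f 1 + ?f (-1))"
    unfolding fluct_mass_def using sum.subset_diff[OF sub, of ?f] by simp
  also have "4 * (\<Sum>k\<in>?J - {1, -1}. ?f k) \<le> (\<Sum>k\<in>?J - {1, -1}. of_int (k\<^sup>2) * ?f k)"
    unfolding sum_distrib_left
  proof (intro sum_mono mult_right_mono)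
    fix k assume "k \<in> ?J - {1, -1}"
    then have "2 \<le> \<bar>k\<bar>" by auto
    then have "2\<^sup>2 \<le> \<bar>k\<bar>\<^sup>2" by (intro power_mono) auto
    then have "4 \<le> k\<^sup>2" by simp
    then show "4 \<le> real_of_int (k\<^sup>2)" by (metis of_int_le_iff of_int_numeral)
  qed auto
  also have "(\<Sum>k\<in>?J - {1, -1}. of_int (k\<^sup>2) * ?f k) + (?f 1 + ?f (-1)) = (\<Sum>k\<in>?J. of_int (k\<^sup>2) * ?f k)"
    using sum.subset_diff[OF sub, of "\<lambda>k. of_int (k\<^sup>2) * ?f k"] by simp
  also have "\<dots> = Dir t"
    unfolding Dir_def by (rule sum.mono_neutral_left) auto
  finally show ?thesis by simp
qed

text \<open>Expansion of |a + z|^2 (a + z) about the mean a. The terms linear in z have no zero mode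
  because z has mean zero, and everything of higher order is collected in R, whose coefficients are
  bounded by its mean modulus.\<close>

lemma nonlin_expansion:
  assumes k: "\<bar>k\<bar> \<le> int N" and S: "\<And>x. cmod (fluct t x) \<le> S"
  obtains r where "cmod r \<le> (3 * cmod (c t 0) + S) * fluct_mass t"
    "nonlin t k = (if k = 0 then (cmod (c t 0))\<^sup>2 * c t 0
      else 2 * (cmod (c t 0))\<^sup>2 * c t k + (c t 0)\<^sup>2 * cnj (c t (- k))) + r"
proof -
  let ?a = "c t 0" and ?z = "fluct t"
  define R where "R x = 2 * ?a * (cmod (?z x))\<^sup>2 + cnj ?a * (?z x)\<^sup>2 + (cmod (?z x))\<^sup>2 * ?z x" for x
  have cz: "continuous_on UNIV ?z" by (rule continuous_fluct)
  have cR: "continuous_on UNIV R" unfolding R_def by (intro continuous_intros cz)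
  have fz: "fc ?z j = (if j = 0 then 0 else c t j)" if "\<bar>j\<bar> \<le> int N" for j
    using that by (simp add: fluct_eq_trig[abs_def] fc_trig)
  have "(cmod (V t x))\<^sup>2 * V t x = (((cmod ?a)\<^sup>2 * ?a + (2 * (cmod ?a)\<^sup>2) * ?z x) + ?a\<^sup>2 * cnj (?z x)) + R x" for x
  proof -
    have V: "V t x = ?a + ?z x" by (simp add: fluct_def)
    show ?thesis
      by (simp only: R_def V of_real_mult of_real_numeral of_real_power[symmetric] complex_norm_square complex_cnj_add)
        (simp add: algebra_simps power2_eq_square)
  qed
  then have "nonlin t k = fc (\<lambda>x. (((cmod ?a)\<^sup>2 * ?a + (2 * (cmod ?a)\<^sup>2) * ?z x) + ?a\<^sup>2 * cnj (?z x)) + R x) k"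
    unfolding nonlin_def by presburger
  also have "\<dots> = fc (\<lambda>x. (cmod ?a)\<^sup>2 * ?a) k + fc (\<lambda>x. (2 * (cmod ?a)\<^sup>2) * ?z x) k + fc (\<lambda>x. ?a\<^sup>2 * cnj (?z x)) k + fc R k"
    by (subst fc_add, (intro continuous_intros cz cR)+)+ (rule refl)
  also have "fc (\<lambda>x. (2 * (cmod ?a)\<^sup>2) * ?z x) k = (2 * (cmod ?a)\<^sup>2) * fc ?z k"
    by (rule fc_mult_left) (rule cz)
  also have "fc (\<lambda>x. ?a\<^sup>2 * cnj (?z x)) k = ?a\<^sup>2 * cnj (fc ?z (- k))"
    by (subst fc_mult_left) (auto intro!: continuous_intros cz simp only: fc_cnj[OF cz])
  finally have "nonlin t k = (if k = 0 then (cmod ?a)\<^sup>2 * ?a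
      else 2 * (cmod ?a)\<^sup>2 * c t k + ?a\<^sup>2 * cnj (c t (- k))) + fc R k"
    using k by (simp add: fc_const fz)
  moreover have "cmod (fc R k) \<le> mean (\<lambda>x. (3 * cmod ?a + S) * (cmod (?z x))\<^sup>2)"
  proof (rule norm_fc_le[OF cR])
    fix x
    have "cmod (R x) \<le> cmod (2 * ?a * (cmod (?z x))\<^sup>2) + cmod (cnj ?a * (?z x)\<^sup>2) + cmod ((cmod (?z x))\<^sup>2 * ?z x)"
      unfolding R_def by (intro norm_triangle_le add_right_mono norm_triangle_ineq)
    also have "\<dots> = (3 * cmod ?a + cmod (?z x)) * (cmod (?z x))\<^sup>2"
      by (simp add: norm_mult norm_power algebra_simps)
    also have "\<dots> \<le> (3 * cmod ?a + S) * (cmod (?z x))\<^sup>2"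
      using S[of x] by (intro mult_right_mono) auto
    finally show "cmod (R x) \<le> (3 * cmod ?a + S) * (cmod (?z x))\<^sup>2" .
  qed (intro continuous_intros cz)
  then have "cmod (fc R k) \<le> (3 * cmod ?a + S) * fluct_mass t"
    by (subst (asm) mean_mult_left) (auto intro!: continuous_intros cz simp: mean_fluct)
  ultimately show ?thesis using that by blast
qed

text \<open>The four-wave product in which two quanta of the mean turn into the frequencies 1 and
  -1. It is unchanged by constant phases and by translations in x, so the rotation of c_0 needs no
  moving frame.\<close>

definition unstable :: "real \<Rightarrow> real" where
  "unstable t = Im ((cnj (c t 0) * c t 1) * (cnj (c t 0) * c t (-1)))"

definition unstable' :: "real \<Rightarrow> real" where
  "unstable' t = Im ((cnj (c' t 0) * c t 1 + cnj (c t 0) * c' t 1) * (cnj (c t 0) * c t (-1))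
    + (cnj (c t 0) * c t 1) * (cnj (c' t 0) * c t (-1) + cnj (c t 0) * c' t (-1)))"

lemma unstable_deriv:
  assumes "1 \<le> N"
  shows "(unstable has_real_derivative unstable' t) (at t)"
proof -
  have c0: "((\<lambda>t. cnj (c t 0)) has_vector_derivative cnj (c' t 0)) (at t)"
    by (rule bounded_linear.has_vector_derivative[OF bounded_linear_cnj c_deriv]) simp
  have c1: "((\<lambda>t. c t 1) has_vector_derivative c' t 1) (at t)"
    and c2: "((\<lambda>t. c t (-1)) has_vector_derivative c' t (-1)) (at t)"
    using assms by (auto intro!: c_deriv)
  have "((\<lambda>t. Im ((cnj (c t 0) * c t 1) * (cnj (c t 0) * c t (-1)))) has_vector_derivative unstable' t) (at t)"
    unfolding unstable'_def
    by (rule bounded_linear.has_vector_derivative[OF bounded_linear_Im])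
      (rule has_vector_derivative_eq_rhs[OF has_vector_derivative_mult[OF
        has_vector_derivative_mult[OF c0 c1] has_vector_derivative_mult[OF c0 c2]]], simp add: algebra_simps)
  then show ?thesis
    by (simp add: has_real_derivative_iff_has_vector_derivative unstable_def[abs_def])
qed

text \<open>Smallness of the fluctuation mass at the time t itself suffices, because mass and energy
  conservation tie that time directly to time 0.\<close>

lemma unstable'_ge:
  assumes N: "1 \<le> N" and m: "1 \<le> mass 0" "mass 0 \<le> 1.01" and D: "Dir 0 \<le> 0.0001"
    and f: "fluct_mass t \<le> 0.0001"
  shows "unstable t - 26 * (Dir 0)\<^sup>2 \<le> unstable' t"
proof -
  let ?a = "c t 0" and ?z = "fluct_mass t"
  define S where "S = (\<Sum>k\<in>{-int N..int N} - {0}. cmod (c t k))"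
  have S: "cmod (fluct t x) \<le> S" for x unfolding S_def by (rule fluct_le)
  have S0: "0 \<le> S" by (simp add: S_def sum_nonneg)
  have S2: "S\<^sup>2 \<le> 4 * Dir t" unfolding S_def Dir_dirichlet by (rule nonzero_l1_bound)
  have z0: "0 \<le> ?z" by (rule fluct_mass_nonneg)
  have a2: "(cmod ?a)\<^sup>2 = mass 0 - ?z" using mass_split[of t] mass_eq[of t] by simp
  have a: "cmod ?a \<le> 1.005" by (rule power2_le_imp_le) (use a2 m z0 in \<open>auto simp: power2_eq_square\<close>)
  \<comment> \<open>The energy inequality is used twice. Here S is unknown and is estimated through
    \<open>Dir t\<close> itself, which is absorbed since the fluctuation mass is tiny; the resulting
    S \<le> 0.05 then improves the factor of the fluctuation mass to 2.2.\<close>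
  have "Dir t \<le> 0.0006"
  proof -
    have "(2 * cmod ?a + S)\<^sup>2 / 2 \<le> 4 * (cmod ?a)\<^sup>2 + S\<^sup>2"
      using sum_squares_bound[of "2 * cmod ?a" S] by (simp add: power2_sum power_mult_distrib)
    also have "\<dots> \<le> 4.04 + 4 * Dir t" using a2 m z0 S2 by simp
    finally have "(2 * cmod ?a + S)\<^sup>2 / 2 * ?z \<le> (4.04 + 4 * Dir t) * 0.0001"
      using f z0 Dir_nonneg[of t] by (intro mult_mono) auto
    then have "Dir t \<le> Dir 0 + (4.04 + 4 * Dir t) * 0.0001" using Dir_le_fluct[OF S] by linarith
    then show ?thesis using D by (simp add: field_simps)
  qed
  with S2 have "S\<^sup>2 \<le> 0.05\<^sup>2" by (simp add: power2_eq_square)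
  then have S1: "S \<le> 0.05" by (rule power2_le_imp_le) simp
  have "(2 * cmod ?a + S)\<^sup>2 \<le> 2.06\<^sup>2" using a S1 S0 by (intro power_mono) auto
  then have "(2 * cmod ?a + S)\<^sup>2 / 2 * ?z \<le> 2.2 * ?z"
    using z0 by (intro mult_right_mono) (auto simp: power2_eq_square)
  then have "Dir t \<le> Dir 0 + 22 / 10 * ?z" using Dir_le_fluct[OF S] by simp
  \<comment> \<open>The absorption 4 - 2.2 = 1.8 > 0: from 1.8 z \<le> d + 3 p one gets z \<le> d +
    2 p.\<close>
  moreover have "z \<le> d + 2 * p" if "4 * z - 3 * p \<le> e" "e \<le> d + 22 / 10 * z" "0 \<le> d" "0 \<le> p"
    for z p d e :: real
    using that by (simp add: field_simps)
  ultimately have z2: "?z \<le> Dir 0 + 2 * ((cmod (c t 1))\<^sup>2 + (cmod (c t (-1)))\<^sup>2)"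
    using Dir_ge_fluct[OF N, of t] Dir_nonneg[of 0] add_nonneg_nonneg zero_le_power2 by blast
  have bd: "(cmod (c t 1))\<^sup>2 + (cmod (c t (-1)))\<^sup>2 \<le> ?z"
  proof -
    have "(\<Sum>k\<in>{1, -1}. (cmod (c t k))\<^sup>2) \<le> ?z"
      unfolding fluct_mass_def by (rule sum_mono2) (use N in auto)
    then show ?thesis by simp
  qed
  have "(3 * cmod ?a + S) * ?z \<le> 3.1 * ?z" using a S1 z0 by (intro mult_right_mono) auto
  then have rb: "cmod r \<le> 3.1 * ?z" if "cmod r \<le> (3 * cmod ?a + S) * ?z" for r :: complex
    using that by simp
  have N': "\<bar>0\<bar> \<le> int N" "\<bar>1\<bar> \<le> int N" "\<bar>- 1\<bar> \<le> int N" using N by auto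
  obtain r0 where r0: "cmod r0 \<le> (3 * cmod ?a + S) * ?z" "nonlin t 0 = (cmod ?a)\<^sup>2 * ?a + r0"
    using nonlin_expansion[OF N'(1) S] by auto
  obtain r1 where r1: "cmod r1 \<le> (3 * cmod ?a + S) * ?z"
    "nonlin t 1 = 2 * (cmod ?a)\<^sup>2 * c t 1 + ?a\<^sup>2 * cnj (c t (-1)) + r1"
    using nonlin_expansion[OF N'(2) S] by auto
  obtain r2 where r2: "cmod r2 \<le> (3 * cmod ?a + S) * ?z"
    "nonlin t (-1) = 2 * (cmod ?a)\<^sup>2 * c t (-1) + ?a\<^sup>2 * cnj (c t 1) + r2"
    using nonlin_expansion[OF N'(3) S] by auto
  have c'0: "c' t 0 = \<i> * ((cmod ?a)\<^sup>2 * ?a + r0)" by (simp add: c'_def r0 algebra_simps)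
  have c'1: "c' t 1 = - \<i> * (c t 1 - (2 * (cmod ?a)\<^sup>2 * c t 1 + ?a\<^sup>2 * cnj (c t (-1)) + r1))"
    by (simp add: c'_def r1)
  have c'2: "c' t (-1) = - \<i> * (c t (-1) - (2 * (cmod ?a)\<^sup>2 * c t (-1) + ?a\<^sup>2 * cnj (c t 1) + r2))"
    by (simp add: c'_def r2)
  show ?thesis
    unfolding unstable_def unstable'_def c'0 c'1 c'2
  proof (rule instability_algebra[OF _ _ bd f rb[OF r0(1)] rb[OF r1(1)] rb[OF r2(1)] z2 Dir_nonneg])
    show "0.999 \<le> (cmod ?a)\<^sup>2" using a2 m f by simp
    show "(cmod ?a)\<^sup>2 \<le> 1.01" using a2 m z0 by simp
  qed
qed

text \<open>As long as the fluctuation is small, the product \<open>unstable\<close> is bounded by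
  about 10^(-4). Exponential growth therefore limits the time T for which the plane wave can be
  followed.\<close>

theorem exponential_instability:
  assumes N: "1 \<le> N" and T: "0 \<le> T" and m: "1 \<le> mass 0" "mass 0 \<le> 1.01" and D: "Dir 0 \<le> 0.0001"
    and f: "\<And>t. 0 \<le> t \<Longrightarrow> t \<le> T \<Longrightarrow> fluct_mass t \<le> 0.0001"
  shows "exp T * (unstable 0 - 26 * (Dir 0)\<^sup>2) \<le> 1"
proof -
  have "exp T * (unstable 0 - 26 * (Dir 0)\<^sup>2) \<le> unstable T - 26 * (Dir 0)\<^sup>2"
    by (rule exp_growth[OF T unstable_deriv[OF N]]) (rule unstable'_ge[OF N m D f])
  also have "\<dots> \<le> unstable T" by simp
  also have "\<dots> \<le> cmod ((cnj (c T 0) * c T 1) * (cnj (c T 0) * c T (-1)))"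
    unfolding unstable_def using abs_Im_le_cmod abs_le_D1 by blast
  also have "\<dots> = (cmod (c T 0))\<^sup>2 * (cmod (c T 1) * cmod (c T (-1)))"
    by (simp add: norm_mult power2_eq_square)
  also have "\<dots> \<le> 1.01 * (0.01 * 0.01)"
  proof -
    have *: "cmod (c T k) \<le> 0.01" if "k \<in> {-int N..int N} - {0}" for k
    proof (rule power2_le_imp_le)
      have "(cmod (c T k))\<^sup>2 \<le> fluct_mass T"
        unfolding fluct_mass_def by (rule member_le_sum[OF that]) auto
      then show "(cmod (c T k))\<^sup>2 \<le> 0.01\<^sup>2" using f[of T] T by (simp add: power2_eq_square)
    qed simp
    show ?thesis
      using *[of 1] *[of "-1"] N mass_split[of T] fluct_mass_nonneg[of T] mass_eq[of T] m
      by (intro mult_mono) auto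
  qed
  finally show ?thesis by simp
qed

end

section \<open>Compactness and passage to the limit\<close>

text \<open>Arzela-Ascoli by a diagonal subsequence on a countable dense set; the domain need not be
  compact. Equicontinuity yields convergence also along moving points, the form needed for times
  that vary with the truncation.\<close>

lemma equicontinuous_subsequence:
  fixes f :: "nat \<Rightarrow> 'a::{metric_space, second_countable_topology} \<Rightarrow> 'b::euclidean_space"
  assumes bound: "\<And>n x. norm (f n x) \<le> M"
    and equi: "\<And>e. 0 < e \<Longrightarrow> \<exists>d>0. \<forall>n x y. dist x y < d \<longrightarrow> norm (f n x - f n y) < e"
  obtains r g where "strict_mono (r :: nat \<Rightarrow> nat)" "continuous_on UNIV g"
    "\<And>X x. X \<longlonglongrightarrow> x \<Longrightarrow> (\<lambda>n. f (r n) (X n)) \<longlonglongrightarrow> g x"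
proof -
  obtain D :: "'a set" where D: "countable D" "\<And>X. open X \<Longrightarrow> X \<noteq> {} \<Longrightarrow> \<exists>d\<in>D. d \<in> X"
    using countable_dense_setE by blast
  obtain r where r: "strict_mono (r :: nat \<Rightarrow> nat)" "\<And>x. x \<in> D \<Longrightarrow> \<exists>l. (\<lambda>n. f (r n) x) \<longlonglongrightarrow> l"
    using function_convergent_subsequence[OF D(1), of f M] bound by blast
  have "convergent (\<lambda>n. f (r n) x)" for x
  proof (rule Cauchy_convergent, rule metric_CauchyI)
    fix e :: real assume "0 < e"
    then obtain d where d: "0 < d" "\<And>n x y. dist x y < d \<Longrightarrow> norm (f n x - f n y) < e / 3"
      using equi[of "e / 3"] by auto
    obtain y where y: "y \<in> D" "dist y x < d"
      using D(2)[of "ball x d"] d(1) by (auto simp: dist_commute)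
    then have "Cauchy (\<lambda>n. f (r n) y)" using r(2) LIMSEQ_imp_Cauchy by blast
    then obtain n0 where n0: "\<And>m n. n0 \<le> m \<Longrightarrow> n0 \<le> n \<Longrightarrow> dist (f (r m) y) (f (r n) y) < e / 3"
      using \<open>0 < e\<close> unfolding Cauchy_def by (metis zero_less_divide_iff zero_less_numeral)
    have "dist (f (r m) x) (f (r n) x) < e" if "n0 \<le> m" "n0 \<le> n" for m n
    proof -
      have "dist (f (r m) x) (f (r n) x) \<le> dist (f (r m) x) (f (r m) y) + dist (f (r m) y) (f (r n) y) + dist (f (r n) y) (f (r n) x)"
        by (meson add_right_mono dist_triangle dist_triangle_le order_refl order_trans)
      also have "dist (f (r m) x) (f (r m) y) < e / 3"
        using d(2)[of x y "r m"] y by (simp add: dist_norm dist_commute)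
      also have "dist (f (r n) y) (f (r n) x) < e / 3"
        using d(2)[of y x "r n"] y by (simp add: dist_norm)
      finally show ?thesis using n0[OF that] by simp
    qed
    then show "\<exists>M. \<forall>m\<ge>M. \<forall>n\<ge>M. dist (f (r m) x) (f (r n) x) < e" by blast
  qed
  then obtain g where g: "\<And>x. (\<lambda>n. f (r n) x) \<longlonglongrightarrow> g x"
    unfolding convergent_def by metis
  show ?thesis
  proof (rule that[OF r(1)])
    show "(\<lambda>n. f (r n) (X n)) \<longlonglongrightarrow> g x" if X: "X \<longlonglongrightarrow> x" for X x
    proof -
      have "(\<lambda>n. f (r n) (X n) - f (r n) x) \<longlonglongrightarrow> 0"
      proof (rule LIMSEQ_I)
        fix e :: real assume "0 < e"
        then obtain d where d: "0 < d" "\<And>n x y. dist x y < d \<Longrightarrow> norm (f n x - f n y) < e"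
          using equi[of e] by auto
        obtain n0 where "\<And>n. n0 \<le> n \<Longrightarrow> dist (X n) x < d"
          using metric_LIMSEQ_D[OF X d(1)] by blast
        then have "\<forall>n\<ge>n0. norm (f (r n) (X n) - f (r n) x - 0) < e" using d(2) by simp
        then show "\<exists>no. \<forall>n\<ge>no. norm (f (r n) (X n) - f (r n) x - 0) < e" by blast
      qed
      from tendsto_add[OF this g[of x]] show ?thesis by simp
    qed
    show "continuous_on UNIV g"
    proof (rule continuous_on_iff[THEN iffD2], intro ballI allI impI)
      fix x and e :: real assume "0 < e"
      then obtain d where d: "0 < d" "\<And>n x y. dist x y < d \<Longrightarrow> norm (f n x - f n y) < e / 2"
        using equi[of "e / 2"] by auto
      have "dist (g y) (g x) < e" if "dist y x < d" for y
      proof -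
        have "norm (g y - g x) \<le> e / 2"
          by (rule LIMSEQ_le_const2[OF tendsto_norm[OF tendsto_diff[OF g g]]])
            (use d(2)[OF that] less_imp_le in blast)
        then show ?thesis using \<open>0 < e\<close> by (simp add: dist_norm)
      qed
      then show "\<exists>d>0. \<forall>x'\<in>UNIV. dist x' x < d \<longrightarrow> dist (g x') (g x) < e" using d(1) by blast
    qed
  qed
qed

lemma tendsto_prim:
  fixes f :: "nat \<Rightarrow> real \<Rightarrow> 'a::euclidean_space"
  assumes "\<And>n. continuous_on UNIV (f n)" "\<And>n x. norm (f n x) \<le> B" "\<And>x. (\<lambda>n. f n x) \<longlonglongrightarrow> g x"
  shows "(\<lambda>n. prim (f n) t) \<longlonglongrightarrow> prim g t"
proof -
  have "(\<lambda>n. integral {a..b} (f n)) \<longlonglongrightarrow> integral {a..b} g" for a b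
    by (rule dominated_convergence(2)[where h="\<lambda>x. B"])
      (use assms in \<open>auto intro!: integrable_continuous_real intro: continuous_on_subset\<close>)
  then show ?thesis unfolding prim_def by (auto intro: tendsto_minus)
qed

lemma continuous_imp_lebesgue_measurable:
  fixes f :: "'a::euclidean_space \<Rightarrow> 'b::{second_countable_topology, topological_space}"
  assumes "continuous_on UNIV f"
  shows "f \<in> borel_measurable lebesgue"
  using measurable_completion[of f lborel borel] borel_measurable_continuous_onI[OF assms] by simp

lemma L2_norm_eq:
  assumes "continuous_on UNIV f"
  shows "L2_norm f = sqrt (2 * pi * mean (\<lambda>x. (cmod (f x))\<^sup>2))"
proof -
  have "continuous_on {-pi..pi} (\<lambda>x. (cmod (f x))\<^sup>2)"
    by (intro continuous_intros continuous_on_subset[OF assms] subset_UNIV)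
  from LINT_lebesgue_eq_integral[OF set_integrable_lebesgue_continuous[OF this]]
  have "(LINT x=-pi..pi|lebesgue. ((cmod (f x))\<^sup>2)) = integral {-pi..pi} (\<lambda>x. (cmod (f x))\<^sup>2)"
    by simp
  then show ?thesis by (simp add: L2_norm_def mean_def)
qed

lemma in_L2_continuous:
  assumes f: "continuous_on UNIV f" and per: "\<And>x. f (x + 2 * pi) = f x"
  shows "in_L2 f"
  unfolding in_L2_def
proof (intro conjI)
  show "periodic_fun_simple f (2 * pi)"
    by unfold_locales (rule per)
  show "f \<in> borel_measurable lebesgue" by (rule continuous_imp_lebesgue_measurable[OF f])
  have "set_integrable lebesgue {-pi..pi} (\<lambda>x. (cmod (f x))\<^sup>2)"
    by (rule set_integrable_lebesgue_continuous)
      (intro continuous_intros continuous_on_subset[OF f] subset_UNIV)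
  then have "set_integrable lebesgue {-pi<..<pi} (\<lambda>x. (cmod (f x))\<^sup>2)"
    by (rule set_integrable_subset) auto
  moreover have "einterval (ereal (-pi)) (ereal pi) = {-pi<..<pi}" by auto
  ultimately show "interval_lebesgue_integrable lebesgue (-pi) pi (\<lambda>x. (cmod (f x))\<^sup>2)"
    by (simp add: interval_lebesgue_integrable_def)
qed

section \<open>From Galerkin solutions to a solution of the cubic equation\<close>

lemma continuous_on_fc_param:
  fixes f :: "real \<Rightarrow> real \<Rightarrow> complex"
  assumes "continuous_on UNIV (\<lambda>p. f (fst p) (snd p))"
  shows "continuous_on UNIV (\<lambda>t. fc (f t) k)"
  unfolding fc_def
  by (rule continuous_on_mean[of "\<lambda>t x. f t x * cis (- (of_int k * x))"])
    (auto simp: case_prod_unfold intro!: continuous_intros assms)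

text \<open>Multiplication by cis (k^2 t) removes the free evolution. In this form the time
  derivative is a bounded continuous function and the identity passes to the limit by dominated
  convergence.\<close>

lemma (in galerkin) duhamel:
  assumes "\<bar>k\<bar> \<le> int N"
  shows "prim (\<lambda>\<tau>. \<i> * cis (of_int (k\<^sup>2) * \<tau>) * nonlin \<tau> k) t = cis (of_int (k\<^sup>2) * t) * c t k - c 0 k"
proof -
  have "((\<lambda>t. cis (of_int (k\<^sup>2) * t) * c t k) has_vector_derivative
      \<i> * cis (of_int (k\<^sup>2) * t) * nonlin t k) (at t)" for t
  proof -
    have "((\<lambda>t. cis (of_int (k\<^sup>2) * t)) has_vector_derivative \<i> * of_int (k\<^sup>2) * cis (of_int (k\<^sup>2) * t)) (at t)"
      unfolding cis_conv_exp
      by (auto intro!: derivative_eq_intros has_vector_derivative_real_field)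
    from has_vector_derivative_mult[OF this c_deriv[OF assms, of t]] show ?thesis
      by (rule has_vector_derivative_eq_rhs) (simp add: c'_def algebra_simps)
  qed
  from prim_eq_diff[OF this] show ?thesis by simp
qed

text \<open>For jointly continuous periodic v all measurability, integrability and L^2 continuity
  clauses are automatic; only Duhamel's formula is a genuine condition, assumed here with the free
  evolution removed.\<close>

lemma cubic_nls_solution_continuous:
  fixes v :: "real \<Rightarrow> real \<Rightarrow> complex" and v0 :: "real \<Rightarrow> complex"
  assumes v: "continuous_on UNIV (\<lambda>p. v (fst p) (snd p))"
    and per: "\<And>t x. v t (x + 2 * pi) = v t x"
    and v0: "continuous_on UNIV v0"
    and duh: "\<And>t k. cis (of_int (k\<^sup>2) * t) * fc (v t) k - fc v0 k =
      prim (\<lambda>\<tau>. \<i> * cis (of_int (k\<^sup>2) * \<tau>) * fc (\<lambda>x. (cmod (v \<tau> x))\<^sup>2 * v \<tau> x) k) t"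
  shows "cubic_nls_solution (-1) v0 v"
  unfolding cubic_nls_solution_def
proof (intro conjI allI impI)
  have vt: "continuous_on UNIV (v t)" for t
    by (rule continuous_on_slice) (simp add: case_prod_unfold v)
  show "(\<lambda>(t, x). v t x) \<in> borel_measurable lebesgue"
    unfolding case_prod_unfold by (rule continuous_imp_lebesgue_measurable[OF v])
  show "in_L2 (v t)" for t
    by (rule in_L2_continuous[OF vt per])
  show "((\<lambda>\<tau>. L2_norm (\<lambda>x. v \<tau> x - v t x)) \<longlongrightarrow> 0) (at t)" for t
  proof -
    have "continuous_on UNIV (\<lambda>\<tau>. mean (\<lambda>x. (cmod (v \<tau> x - v t x))\<^sup>2))"
      by (rule continuous_on_mean)
        (auto simp: case_prod_unfold intro!: continuous_intros v continuous_on_compose2[OF vt])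
    then have "continuous_on UNIV (\<lambda>\<tau>. sqrt (2 * pi * mean (\<lambda>x. (cmod (v \<tau> x - v t x))\<^sup>2)))"
      by (intro continuous_intros)
    then have "((\<lambda>\<tau>. sqrt (2 * pi * mean (\<lambda>x. (cmod (v \<tau> x - v t x))\<^sup>2))) \<longlongrightarrow>
        sqrt (2 * pi * mean (\<lambda>x. (cmod (v t x - v t x))\<^sup>2))) (at t)"
      by (intro isContD) (simp only: continuous_on_eq_continuous_at[OF open_UNIV] UNIV_I ball_UNIV)
    moreover have "L2_norm (\<lambda>x. v \<tau> x - v t x) = sqrt (2 * pi * mean (\<lambda>x. (cmod (v \<tau> x - v t x))\<^sup>2))" for \<tau>
      by (rule L2_norm_eq) (intro continuous_intros vt)
    ultimately show ?thesis by simp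
  qed
  show "set_integrable lebesgue ({-T..T} \<times> {-pi..pi}) (\<lambda>(t, x). cmod (v t x) ^ 4)" for T :: real
  proof -
    have "{-T..T} \<times> {-pi..pi} = cbox (-T, -pi) (T, pi)"
      by (simp add: cbox_Pair_eq)
    moreover have "continuous_on (cbox (-T, -pi) (T, pi)) (\<lambda>(t, x). cmod (v t x) ^ 4)"
      unfolding case_prod_unfold
      by (intro continuous_intros continuous_on_subset[OF v] subset_UNIV)
    ultimately show ?thesis using absolutely_integrable_continuous by metis
  qed
  fix t k
  let ?n = "\<lambda>\<tau>. fc (\<lambda>x. (cmod (v \<tau> x))\<^sup>2 * v \<tau> x) k"
  have n: "continuous_on UNIV ?n"
    by (rule continuous_on_fc_param) (intro continuous_intros v)
  have fn: "fourier_coeff (\<lambda>x. complex_of_real ((cmod (v \<tau> x))\<^sup>2) * v \<tau> x) k = ?n \<tau>" for \<tau>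
    by (rule fourier_coeff_eq_fc) (intro continuous_intros vt)
  let ?g = "\<lambda>\<tau>. cis (- ((of_int k)\<^sup>2 * (t - \<tau>))) * ?n \<tau>"
  have g: "continuous_on A ?g" for A
    by (intro continuous_intros continuous_on_subset[OF n] subset_UNIV)
  have L: "(LINT \<tau>=0..t|lebesgue. (?g \<tau>)) = prim ?g t"
    by (rule LINT_lebesgue_eq_prim) (rule set_integrable_lebesgue_continuous[OF g])
  let ?h = "\<lambda>\<tau>. \<i> * cis (of_int (k\<^sup>2) * \<tau>) * ?n \<tau>"
  have h: "continuous_on UNIV ?h" by (intro continuous_intros n)
  have gh: "?g \<tau> = - \<i> * cis (- ((of_int k)\<^sup>2 * t)) * ?h \<tau>" for \<tau>
    by (simp add: algebra_simps cis_mult flip: mult.assoc)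
  have pg: "prim ?g t = - \<i> * cis (- ((of_int k)\<^sup>2 * t)) * prim ?h t"
  proof -
    have "((\<lambda>s. - \<i> * cis (- ((of_int k)\<^sup>2 * t)) * prim ?h s) has_vector_derivative ?g s) (at s)" for s
      unfolding gh by (rule has_vector_derivative_mult_right) (rule prim_has_vector_derivative[OF h])
    from prim_eq_diff[OF this, of t] show ?thesis by simp
  qed
  have ph: "prim ?h t = cis (of_int (k\<^sup>2) * t) * fc (v t) k - fc v0 k"
    using duh[of k t] by simp
  have alg: "F = A - \<i> * complex_of_real (-1) * P" if "\<i> * P = F - A" for F A P
    using that by (simp add: algebra_simps)
  have "\<i> * prim ?g t = fc (v t) k - cis (- ((of_int k)\<^sup>2 * t)) * fc v0 k"
    unfolding pg ph by (simp add: algebra_simps cis_mult flip: mult.assoc)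
  then show "fourier_coeff (v t) k =
        cis (- ((of_int k)\<^sup>2 * t)) * fourier_coeff v0 k
        - \<i> * complex_of_real (-1) *
          (LINT \<tau>=0..t|lebesgue. (cis (- ((of_int k)\<^sup>2 * (t - \<tau>))) *
             fourier_coeff (\<lambda>x. complex_of_real ((cmod (v \<tau> x))\<^sup>2) * v \<tau> x) k))"
    unfolding fn L fourier_coeff_eq_fc[OF vt] fourier_coeff_eq_fc[OF v0] by (rule alg)
qed

lemma sum_support_extend:
  fixes N0 n :: nat
  assumes "\<And>k. int N0 < \<bar>k\<bar> \<Longrightarrow> g k = 0"
  shows "(\<Sum>k\<in>{-int (N0 + n)..int (N0 + n)}. g k) = (\<Sum>k\<in>{-int N0..int N0}. g k)"
  by (rule sum.mono_neutral_right) (auto intro!: assms)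

lemma small_modulus:
  fixes B Q :: real
  assumes "0 \<le> B" "0 < e"
  obtains K :: nat and d :: real where "1 \<le> K" "0 < d"
    "\<And>a b. a \<le> d \<Longrightarrow> b \<le> d \<Longrightarrow> 0 \<le> a \<Longrightarrow> 0 \<le> b \<Longrightarrow>
      (2 * real K + 1) * ((2 * (real K)\<^sup>2 + \<bar>Q\<bar>) * a + 2 * real K * b) + 2 * sqrt (2 * B / real K) < e"
proof -
  \<comment> \<open>K settles the tail first: K > 32 B / e^2 is the same as sqrt (2 B / K) < e / 4.
    Only then is d chosen for the low modes, whose constants depend on K.\<close>
  obtain K :: nat where K: "32 * B / e\<^sup>2 + 1 < real K" using reals_Archimedean2 by blast
  have K1: "1 \<le> real K" using K assms by (smt (verit) divide_nonneg_nonneg zero_le_power2)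
  have "32 * B / e\<^sup>2 < real K" using K by simp
  then have "2 * B / real K < (e / 4)\<^sup>2"
    using K1 assms by (simp add: field_simps power2_eq_square)
  then have "sqrt (2 * B / real K) < sqrt ((e / 4)\<^sup>2)" by (rule real_sqrt_less_mono)
  then have "sqrt (2 * B / real K) < e / 4" using assms by simp
  then have h: "2 * sqrt (2 * B / real K) < e / 2" by simp
  define G where "G = (2 * real K + 1) * ((2 * (real K)\<^sup>2 + \<bar>Q\<bar>) + 2 * real K)"
  have G: "0 < G" unfolding G_def using K1 by (intro mult_pos_pos add_nonneg_pos) auto
  define d where "d = e / (2 * G)"
  show ?thesis
  proof (rule that[of K d])
    show "1 \<le> K" using K1 by simp
    show "0 < d" using G assms by (simp add: d_def)
    fix a b assume ab: "a \<le> d" "b \<le> d" "0 \<le> a" "0 \<le> b"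
    have "(2 * real K + 1) * ((2 * (real K)\<^sup>2 + \<bar>Q\<bar>) * a + 2 * real K * b) \<le>
        (2 * real K + 1) * ((2 * (real K)\<^sup>2 + \<bar>Q\<bar>) * d + 2 * real K * d)"
      using ab by (intro mult_left_mono add_mono) auto
    also have "\<dots> = G * d" by (simp add: G_def algebra_simps)
    also have "\<dots> = e / 2" using G by (simp add: d_def)
    finally show "(2 * real K + 1) * ((2 * (real K)\<^sup>2 + \<bar>Q\<bar>) * a + 2 * real K * b) + 2 * sqrt (2 * B / real K) < e"
      using h by simp
  qed
qed

text \<open>The datum is itself a trigonometric polynomial of degree N0, so the truncations N0 + n
  start from it exactly and their initial mass and Dirichlet energy do not depend on n. This makes
  all a priori bounds uniform.\<close>

theorem galerkin_limit:
  fixes c0 :: "int \<Rightarrow> complex" and N0 :: nat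
  assumes supp: "\<And>k. int N0 < \<bar>k\<bar> \<Longrightarrow> c0 k = 0"
    and mass: "(\<Sum>k\<in>{-int N0..int N0}. (cmod (c0 k))\<^sup>2) \<le> 2"
  obtains C :: "nat \<Rightarrow> real \<Rightarrow> int \<Rightarrow> complex" and r :: "nat \<Rightarrow> nat" and v :: "real \<Rightarrow> real \<Rightarrow> complex"
  where "\<And>n. galerkin (N0 + n) (C n)"
    "\<And>n k. \<bar>k\<bar> \<le> int (N0 + n) \<Longrightarrow> C n 0 k = c0 k"
    "cubic_nls_solution (-1) (trig N0 c0) v"
    "\<And>t. continuous_on UNIV (v t)" "\<And>t x. v t (x + 2 * pi) = v t x"
    "\<And>X t k. X \<longlonglongrightarrow> t \<Longrightarrow> (\<lambda>n. C (r n) (X n) k) \<longlonglongrightarrow> fc (v t) k"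
proof -
  define D0 where "D0 = dirichlet N0 c0"
  define B where "B = 2 * D0 + 136"
  have D0: "0 \<le> D0" unfolding D0_def dirichlet_def by (intro sum_nonneg mult_nonneg_nonneg) auto
  have B: "0 \<le> B" using D0 by (simp add: B_def)
  have "\<exists>c. galerkin (N0 + n) c \<and> (\<forall>k. \<bar>k\<bar> \<le> int (N0 + n) \<longrightarrow> c 0 k = c0 k)" for n
    using galerkin_exists[of "N0 + n" c0] by metis
  then obtain C where G: "\<And>n. galerkin (N0 + n) (C n)"
    and C0: "\<And>n k. \<bar>k\<bar> \<le> int (N0 + n) \<Longrightarrow> C n 0 k = c0 k" by metis
  let ?V = "\<lambda>n. galerkin.V (N0 + n) (C n)"
  have V: "?V n t = trig (N0 + n) (C n t)" for n t
    by (simp add: galerkin.V_def[OF G] fun_eq_iff)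
  have m0: "galerkin.mass (N0 + n) (C n) 0 \<le> 2" for n
  proof -
    have "galerkin.mass (N0 + n) (C n) 0 = (\<Sum>k\<in>{-int (N0 + n)..int (N0 + n)}. (cmod (c0 k))\<^sup>2)"
      unfolding galerkin.mass_def[OF G] by (rule sum.cong) (auto simp: C0)
    also have "\<dots> = (\<Sum>k\<in>{-int N0..int N0}. (cmod (c0 k))\<^sup>2)"
      by (rule sum_support_extend) (simp add: supp)
    finally show ?thesis using mass by simp
  qed
  have DB: "galerkin.Dir (N0 + n) (C n) t \<le> B" for n t
  proof -
    have "galerkin.Dir (N0 + n) (C n) 0 = (\<Sum>k\<in>{-int (N0 + n)..int (N0 + n)}. of_int (k\<^sup>2) * (cmod (c0 k))\<^sup>2)"
      unfolding galerkin.Dir_def[OF G] by (rule sum.cong) (auto simp: C0)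
    also have "\<dots> = D0"
      unfolding D0_def dirichlet_def by (rule sum_support_extend) (simp add: supp)
    finally show ?thesis using galerkin.Dir_bound[OF G m0, of n t] by (simp add: B_def)
  qed
  have Vb: "cmod (?V n t x) \<le> 68 + B" for n t x
    by (rule galerkin.V_bound[OF G m0 DB])
  define f where "f n p = ?V n (fst p) (snd p)" for n and p :: "real \<times> real"
  have equi: "\<exists>d>0. \<forall>n x y. dist x y < d \<longrightarrow> norm (f n x - f n y) < e" if e0: "0 < e" for e
  proof -
    obtain K d where K: "1 \<le> K" "0 < d"
      and Kd: "\<And>a b. a \<le> d \<Longrightarrow> b \<le> d \<Longrightarrow> 0 \<le> a \<Longrightarrow> 0 \<le> b \<Longrightarrow>
        (2 * real K + 1) * ((2 * (real K)\<^sup>2 + \<bar>(68 + B) ^ 3\<bar>) * a + 2 * real K * b) + 2 * sqrt (2 * B / real K) < e"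
      using small_modulus[OF B e0, of "(68 + B) ^ 3"] by metis
    have "norm (f n x - f n y) < e" if "dist x y < d" for n x y
    proof -
      have "norm (f n x - f n y) \<le>
        (2 * real K + 1) * ((2 * (real K)\<^sup>2 + (68 + B) ^ 3) * \<bar>fst x - fst y\<bar> + 2 * real K * \<bar>snd x - snd y\<bar>)
        + 2 * sqrt (2 * B / real K)"
        unfolding f_def by (rule galerkin.V_modulus[OF G m0 DB K(1)])
      also have "\<dots> < e"
        using Kd[of "\<bar>fst x - fst y\<bar>" "\<bar>snd x - snd y\<bar>"] dist_fst_le[of x y] dist_snd_le[of x y] that B
        by (simp add: dist_real_def)
      finally show ?thesis .
    qed
    then show ?thesis using K(2) by blast
  qed
  have fb: "norm (f n x) \<le> 68 + B" for n x
    unfolding f_def by (rule Vb)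
  obtain r g where r: "strict_mono (r :: nat \<Rightarrow> nat)" and gc: "continuous_on UNIV g"
    and lim: "\<And>X x. X \<longlonglongrightarrow> x \<Longrightarrow> (\<lambda>n. f (r n) (X n)) \<longlonglongrightarrow> g x"
    using equicontinuous_subsequence[of f, OF fb equi] by metis
  define v where "v t x = g (t, x)" for t x
  have vlim: "(\<lambda>n. ?V (r n) (X n) x) \<longlonglongrightarrow> v t x" if "X \<longlonglongrightarrow> t" for X t x
    using lim[of "\<lambda>n. (X n, x)" "(t, x)"] that by (simp add: f_def v_def tendsto_Pair)
  have vc: "continuous_on UNIV (\<lambda>p. v (fst p) (snd p))"
    unfolding v_def using gc by simp
  have vt: "continuous_on UNIV (v t)" for t
    by (rule continuous_on_slice) (simp add: case_prod_unfold vc)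
  have Vc: "continuous_on UNIV (?V n t)" for n t
    unfolding V by (rule continuous_trig)
  have per: "v t (x + 2 * pi) = v t x" for t x
  proof -
    have "?V n t (x + 2 * pi) = ?V n t x" for n
    proof -
      have "cis (of_int k * (x + 2 * pi)) = cis (of_int k * x)" for k
      proof -
        have "of_int k * (x + 2 * pi) = of_int k * x + 2 * pi * of_int k" by (simp add: algebra_simps)
        then show ?thesis by (simp add: cis_mult[symmetric] cis_multiple_2pi)
      qed
      then show ?thesis by (simp add: V trig_def)
    qed
    then have "(\<lambda>n. ?V (r n) t x) \<longlonglongrightarrow> v t (x + 2 * pi)"
      using vlim[of "\<lambda>n. t" t "x + 2 * pi"] by simp
    moreover have "(\<lambda>n. ?V (r n) t x) \<longlonglongrightarrow> v t x" by (rule vlim) simp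
    ultimately show ?thesis by (rule LIMSEQ_unique)
  qed
  \<comment> \<open>As r n \<ge> n, every fixed mode eventually lies inside the truncation, where it
    coincides with the Fourier coefficient of the Galerkin solution.\<close>
  have rn: "n \<le> r n" for n using r by (rule seq_suble)
  have ev: "\<forall>\<^sub>F n in sequentially. \<bar>k\<bar> \<le> int (N0 + r n)" for k :: int
    using eventually_ge_at_top[of "nat \<bar>k\<bar>"]
  proof eventually_elim
    case (elim n)
    then have "\<bar>k\<bar> \<le> int n" by (simp add: nat_le_iff)
    then show ?case using rn[of n] by linarith
  qed
  have clim: "(\<lambda>n. C (r n) (X n) k) \<longlonglongrightarrow> fc (v t) k" if "X \<longlonglongrightarrow> t" for X t k
  proof -
    have "(\<lambda>n. fc (?V (r n) (X n)) k) \<longlonglongrightarrow> fc (v t) k"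
      by (rule tendsto_fc[OF Vc Vb vlim[OF that]])
    moreover have "\<forall>\<^sub>F n in sequentially. fc (?V (r n) (X n)) k = C (r n) (X n) k"
      using ev[of k] by eventually_elim (simp add: V fc_trig)
    ultimately show ?thesis by (rule Lim_transform_eventually)
  qed
  have duh: "cis (of_int (k\<^sup>2) * t) * fc (v t) k - fc (trig N0 c0) k =
      prim (\<lambda>\<tau>. \<i> * cis (of_int (k\<^sup>2) * \<tau>) * fc (\<lambda>x. (cmod (v \<tau> x))\<^sup>2 * v \<tau> x) k) t" for t k
  proof -
    let ?n = "\<lambda>n. galerkin.nonlin (N0 + n) (C n)"
    have nl: "(\<lambda>n. ?n (r n) \<tau> k) \<longlonglongrightarrow> fc (\<lambda>x. (cmod (v \<tau> x))\<^sup>2 * v \<tau> x) k" for \<tau>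
      unfolding galerkin.nonlin_def[OF G]
    proof (rule tendsto_fc)
      show "norm ((cmod (?V (r n) \<tau> x))\<^sup>2 * ?V (r n) \<tau> x) \<le> (68 + B)\<^sup>2 * (68 + B)" for n x
        unfolding norm_mult norm_of_real using Vb[of "r n" \<tau> x] B
        by (intro mult_mono) (auto simp: norm_power intro!: power_mono)
      show "continuous_on UNIV (\<lambda>x. (cmod (?V (r n) \<tau> x))\<^sup>2 * ?V (r n) \<tau> x)" for n
        by (intro continuous_intros Vc)
      show "(\<lambda>n. (cmod (?V (r n) \<tau> x))\<^sup>2 * ?V (r n) \<tau> x) \<longlonglongrightarrow> (cmod (v \<tau> x))\<^sup>2 * v \<tau> x" for x
        by (intro tendsto_intros vlim)
    qed
    have "(\<lambda>n. prim (\<lambda>\<tau>. \<i> * cis (of_int (k\<^sup>2) * \<tau>) * ?n (r n) \<tau> k) t) \<longlonglongrightarrow>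
        prim (\<lambda>\<tau>. \<i> * cis (of_int (k\<^sup>2) * \<tau>) * fc (\<lambda>x. (cmod (v \<tau> x))\<^sup>2 * v \<tau> x) k) t"
    proof (rule tendsto_prim)
      show "continuous_on UNIV (\<lambda>\<tau>. \<i> * cis (of_int (k\<^sup>2) * \<tau>) * ?n (r n) \<tau> k)" for n
        by (intro continuous_intros galerkin.continuous_nonlin[OF G])
      show "norm (\<i> * cis (of_int (k\<^sup>2) * \<tau>) * ?n (r n) \<tau> k) \<le> (68 + B) ^ 3" for n \<tau>
        using galerkin.nonlin_bound[OF G m0 DB, of "r n" \<tau> k] by (simp add: norm_mult)
      show "(\<lambda>n. \<i> * cis (of_int (k\<^sup>2) * \<tau>) * ?n (r n) \<tau> k) \<longlonglongrightarrow>
          \<i> * cis (of_int (k\<^sup>2) * \<tau>) * fc (\<lambda>x. (cmod (v \<tau> x))\<^sup>2 * v \<tau> x) k" for \<tau>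
        by (intro tendsto_intros nl)
    qed
    moreover have "(\<lambda>n. prim (\<lambda>\<tau>. \<i> * cis (of_int (k\<^sup>2) * \<tau>) * ?n (r n) \<tau> k) t) \<longlonglongrightarrow>
        cis (of_int (k\<^sup>2) * t) * fc (v t) k - c0 k"
    proof (rule Lim_transform_eventually)
      show "(\<lambda>n. cis (of_int (k\<^sup>2) * t) * C (r n) t k - c0 k) \<longlonglongrightarrow> cis (of_int (k\<^sup>2) * t) * fc (v t) k - c0 k"
        by (intro tendsto_intros clim)
      show "\<forall>\<^sub>F n in sequentially. cis (of_int (k\<^sup>2) * t) * C (r n) t k - c0 k =
          prim (\<lambda>\<tau>. \<i> * cis (of_int (k\<^sup>2) * \<tau>) * ?n (r n) \<tau> k) t"
        using ev[of k]
      proof eventually_elim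
        case (elim n)
        show ?case unfolding galerkin.duhamel[OF G elim] C0[OF elim] ..
      qed
    qed
    ultimately have "prim (\<lambda>\<tau>. \<i> * cis (of_int (k\<^sup>2) * \<tau>) * fc (\<lambda>x. (cmod (v \<tau> x))\<^sup>2 * v \<tau> x) k) t =
        cis (of_int (k\<^sup>2) * t) * fc (v t) k - c0 k"
      by (rule LIMSEQ_unique)
    moreover have "fc (trig N0 c0) k = c0 k" using supp[of k] by (simp add: fc_trig)
    ultimately show ?thesis by simp
  qed
  have sol: "cubic_nls_solution (-1) (trig N0 c0) v"
    by (rule cubic_nls_solution_continuous[OF vc per _ duh]) (rule continuous_trig)
  show ?thesis
    by (rule that[where C = C and r = r and v = v])
      (rule G, erule C0, rule sol, rule vt, rule per, erule clim)
qed

section \<open>The unstable datum\<close>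

text \<open>A fluctuation of mass above \<open>10\<^sup>-\<^sup>4\<close> is visible in a low mode: by the bound 137 on the Dirichlet
  energy, the frequencies above 1700 carry at most \<open>137 / 1700\<^sup>2\<close>.\<close>

lemma (in galerkin) escape:
  assumes N: "1 \<le> N" and T: "0 \<le> T" and m: "1 \<le> mass 0" "mass 0 \<le> 1.01" and D: "Dir 0 \<le> 0.0001"
    and grow: "1 < exp T * (unstable 0 - 26 * (Dir 0)\<^sup>2)"
  shows "\<exists>t k. 0 \<le> t \<and> t \<le> T \<and> k \<noteq> 0 \<and> \<bar>k\<bar> \<le> 1700 \<and> 1 / 10000 \<le> cmod (c t k)"
proof (rule ccontr)
  assume no: "\<not> ?thesis"
  have small: "cmod (c t k) \<le> 1 / 10000" if "0 \<le> t" "t \<le> T" "k \<noteq> 0" "\<bar>k\<bar> \<le> 1700" for t k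
    using no that by (meson linear)
  have "fluct_mass t \<le> 0.0001" if t: "0 \<le> t" "t \<le> T" for t
  proof -
    let ?J = "{-int N..int N} - {0}" and ?f = "\<lambda>k. (cmod (c t k))\<^sup>2"
    let ?L = "{k \<in> ?J. \<bar>k\<bar> \<le> 1700}" and ?H = "{k \<in> ?J. 1700 < \<bar>k\<bar>}"
    have fin: "finite ?L" "finite ?H" by (rule finite_subset[of _ "{-int N..int N}"]; auto)+
    have "?J = ?L \<union> ?H" by auto
    then have "fluct_mass t = sum ?f ?L + sum ?f ?H"
      unfolding fluct_mass_def using fin by (metis (no_types, lifting) sum.union_disjoint disjoint_iff mem_Collect_eq not_less)
    also have "sum ?f ?L \<le> (\<Sum>k\<in>?L. (1 / 10000)\<^sup>2)"
      using small[OF t] by (intro sum_mono power_mono) auto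
    also have "\<dots> \<le> (\<Sum>k\<in>{-1700..1700} - {0::int}. (1 / 10000)\<^sup>2)"
      by (intro sum_mono2) auto
    \<comment> \<open>There are 3400 nonzero frequencies up to 1700 in modulus, each contributing at
      most 10^(-8).\<close>
    also have "\<dots> = 0.000034" by (simp add: power2_eq_square)
    also have "sum ?f ?H \<le> (\<Sum>k\<in>?H. (1 / 1700\<^sup>2) * (of_int (k\<^sup>2) * ?f k))"
    proof (intro sum_mono)
      fix k assume "k \<in> ?H"
      then have "1700\<^sup>2 \<le> \<bar>k\<bar>\<^sup>2" by (intro power_mono) auto
      then have "1700\<^sup>2 \<le> k\<^sup>2" by simp
      then have "(1700::real)\<^sup>2 \<le> of_int (k\<^sup>2)" by (metis of_int_le_iff of_int_numeral of_int_power)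
      then have "1700\<^sup>2 * ?f k \<le> of_int (k\<^sup>2) * ?f k" by (intro mult_right_mono) auto
      then show "?f k \<le> (1 / 1700\<^sup>2) * (of_int (k\<^sup>2) * ?f k)" by simp
    qed
    also have "\<dots> = (1 / 1700\<^sup>2) * (\<Sum>k\<in>?H. of_int (k\<^sup>2) * ?f k)" by (rule sum_distrib_left[symmetric])
    also have "\<dots> \<le> (1 / 1700\<^sup>2) * Dir t"
      unfolding Dir_def by (intro mult_left_mono sum_mono2) auto
    also have "\<dots> \<le> (1 / 1700\<^sup>2) * 137"
      using Dir_bound[of t] m D by (intro mult_left_mono) auto
    \<comment> \<open>The tail contributes less than 0.000048, so both parts together stay below the
      threshold 0.0001.\<close>
    also have "0.000034 + (1 / 1700\<^sup>2) * 137 \<le> (0.0001 :: real)" by (simp add: power2_eq_square)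
    finally show ?thesis by simp
  qed
  then have "exp T * (unstable 0 - 26 * (Dir 0)\<^sup>2) \<le> 1"
    by (rule exponential_instability[OF N T m D])
  then show False using grow by simp
qed

text \<open>The factor 1 + i has square 2 i, which makes the initial product purely imaginary with
  value i \<delta>^2 / 2: the perturbation points in the growing direction. The weight 2 M + 1 of
  the high mode compensates the factor 1 / (2 M + 1) that integration over a cell produces.\<close>

definition datum :: "nat \<Rightarrow> real \<Rightarrow> int \<Rightarrow> complex" where
  "datum M \<delta> k =
    (if k = 0 then 1
     else if \<bar>k\<bar> = 1 then complex_of_real \<delta> * (1 + \<i>) / 2
     else if \<bar>k\<bar> = 2 * int M + 1 then complex_of_real ((2 * real M + 1) * \<delta>) * (1 + \<i>) / 2
     else 0)"

text \<open>One evaluation for mass, Dirichlet energy, Sobolev norm and point values. The condition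
  on g removes all frequencies outside the support, and 1 \<le> M keeps the five listed frequencies
  distinct.\<close>

lemma sum_datum:
  fixes g :: "int \<Rightarrow> complex \<Rightarrow> 'a::comm_monoid_add"
  assumes "1 \<le> M" and g: "\<And>k. g k 0 = 0" and N: "2 * M + 1 \<le> N"
  shows "(\<Sum>k\<in>{-int N..int N}. g k (datum M \<delta> k)) =
    g 0 1 + (g 1 (\<delta> * (1 + \<i>) / 2) + (g (-1) (\<delta> * (1 + \<i>) / 2)
    + (g (2 * int M + 1) (complex_of_real ((2 * real M + 1) * \<delta>) * (1 + \<i>) / 2)
    + g (- (2 * int M + 1)) (complex_of_real ((2 * real M + 1) * \<delta>) * (1 + \<i>) / 2))))"
proof -
  let ?S = "{0, 1, -1, 2 * int M + 1, - (2 * int M + 1)}"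
  have "(\<Sum>k\<in>{-int N..int N}. g k (datum M \<delta> k)) = (\<Sum>k\<in>?S. g k (datum M \<delta> k))"
  proof (rule sum.mono_neutral_right)
    show "?S \<subseteq> {-int N..int N}" using assms by auto
    show "\<forall>k\<in>{-int N..int N} - ?S. g k (datum M \<delta> k) = 0"
      using g by (auto simp: datum_def abs_if split: if_splits)
  qed simp
  also have "\<dots> = g 0 (datum M \<delta> 0) + (g 1 (datum M \<delta> 1) + (g (-1) (datum M \<delta> (-1))
      + (g (2 * int M + 1) (datum M \<delta> (2 * int M + 1)) + g (- (2 * int M + 1)) (datum M \<delta> (- (2 * int M + 1))))))"
    using assms(1) by (subst sum.insert, simp, force)+ simp
  also have "datum M \<delta> (2 * int M + 1) = complex_of_real ((2 * real M + 1) * \<delta>) * (1 + \<i>) / 2"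
    using assms(1) by (simp add: datum_def)
  also have "datum M \<delta> (- (2 * int M + 1)) = complex_of_real ((2 * real M + 1) * \<delta>) * (1 + \<i>) / 2"
    using assms(1) by (simp add: datum_def)
  finally show ?thesis by (simp add: datum_def)
qed

lemma cmod_one_plus_i: "(cmod (1 + \<i>))\<^sup>2 = 2"
  by (simp add: cmod_power2)

lemma datum_mass:
  assumes "1 \<le> M" "2 * M + 1 \<le> N"
  shows "(\<Sum>k\<in>{-int N..int N}. (cmod (datum M \<delta> k))\<^sup>2) = 1 + \<delta>\<^sup>2 + ((2 * real M + 1) * \<delta>)\<^sup>2"
proof -
  have c: "(cmod (complex_of_real x * (1 + \<i>) / 2))\<^sup>2 = x\<^sup>2 / 2" for x
    by (simp add: norm_mult norm_divide power_mult_distrib power_divide cmod_one_plus_i)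
  show ?thesis
    using sum_datum[OF assms(1) _ assms(2), of "\<lambda>k z. (cmod z)\<^sup>2" \<delta>] c[of \<delta>] c[of "(2 * real M + 1) * \<delta>"]
    by simp
qed

lemma datum_dirichlet:
  assumes "1 \<le> M" "2 * M + 1 \<le> N"
  shows "(\<Sum>k\<in>{-int N..int N}. of_int (k\<^sup>2) * (cmod (datum M \<delta> k))\<^sup>2) = \<delta>\<^sup>2 + (2 * real M + 1) ^ 4 * \<delta>\<^sup>2"
proof -
  have c: "(cmod (complex_of_real x * (1 + \<i>) / 2))\<^sup>2 = x\<^sup>2 / 2" for x
    by (simp add: norm_mult norm_divide power_mult_distrib power_divide cmod_one_plus_i)
  show ?thesis
    using sum_datum[OF assms(1) _ assms(2), of "\<lambda>k z. of_int (k\<^sup>2) * (cmod z)\<^sup>2" \<delta>]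
    unfolding c by (simp add: power_mult_distrib power2_eq_square power4_eq_xxxx algebra_simps)
qed

text \<open>The fourth power in the smallness condition comes from the Dirichlet energy of the high
  mode. The condition on T says that exp T outweighs \<delta>^2 / 4, half of the initial value
  \<delta>^2 / 2 of the unstable product; the other half covers the loss.\<close>

theorem unstable_solution:
  assumes M: "1 \<le> M" and \<delta>: "0 < \<delta>" "(2 * real M + 1) ^ 4 * \<delta> \<le> 1 / 1000"
    and T: "0 \<le> T" "4 < exp T * \<delta>\<^sup>2"
  obtains v t k where "cubic_nls_solution (-1) (trig (2 * M + 1) (datum M \<delta>)) v"
    "\<And>t. continuous_on UNIV (v t)" "\<And>t x. v t (x + 2 * pi) = v t x"
    "0 \<le> t" "t \<le> T" "k \<noteq> 0" "1 / 10000 \<le> cmod (fc (v t) k)"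
proof -
  let ?L = "2 * real M + 1"
  have L: "1 \<le> ?L" by simp
  have L4: "1 \<le> ?L ^ 4" "?L\<^sup>2 \<le> ?L ^ 4" using L by (auto intro: power_increasing one_le_power)
  have \<delta>1: "\<delta> \<le> 1 / 1000" 
  proof -
    have "1 * \<delta> \<le> ?L ^ 4 * \<delta>" using \<delta> by (intro mult_right_mono L4) auto
    then show ?thesis using \<delta>(2) by linarith
  qed
  \<comment> \<open>One factor of (2 M + 1)^4 \<delta> is spent, so the Dirichlet energy is linear
    in \<delta> with a small constant. Its square is then comparable with \<delta>^2 and beaten by
    \<open>unstable 0\<close>.\<close>
  have D0: "\<delta>\<^sup>2 + ?L ^ 4 * \<delta>\<^sup>2 \<le> \<delta> / 500"
  proof -
    have "1 * \<delta>\<^sup>2 \<le> ?L ^ 4 * \<delta>\<^sup>2" by (intro mult_right_mono L4) auto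
    then have "\<delta>\<^sup>2 + ?L ^ 4 * \<delta>\<^sup>2 \<le> 2 * (?L ^ 4 * \<delta>\<^sup>2)" by linarith
    also have "\<dots> = 2 * ((?L ^ 4 * \<delta>) * \<delta>)" by (simp add: power2_eq_square)
    also have "\<dots> \<le> 2 * ((1 / 1000) * \<delta>)" using \<delta> by (intro mult_left_mono mult_right_mono) auto
    finally show ?thesis by simp
  qed
  have mle: "\<delta>\<^sup>2 + (?L * \<delta>)\<^sup>2 \<le> 0.01"
  proof -
    have "(?L * \<delta>)\<^sup>2 \<le> ?L ^ 4 * \<delta>\<^sup>2" using L4(2) by (simp add: power_mult_distrib mult_right_mono)
    then show ?thesis using D0 \<delta>1 by simp
  qed
  let ?c0 = "datum M \<delta>"
  have supp: "?c0 k = 0" if "int (2 * M + 1) < \<bar>k\<bar>" for k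
    using that M by (auto simp: datum_def)
  have mass: "(\<Sum>k\<in>{-int (2 * M + 1)..int (2 * M + 1)}. (cmod (?c0 k))\<^sup>2) \<le> 2"
    unfolding datum_mass[OF M order_refl] using mle by simp
  obtain C r v where G: "\<And>n. galerkin (2 * M + 1 + n) (C n)"
    and C0: "\<And>n k. \<bar>k\<bar> \<le> int (2 * M + 1 + n) \<Longrightarrow> C n 0 k = ?c0 k"
    and sol: "cubic_nls_solution (-1) (trig (2 * M + 1) ?c0) v"
    and vt: "\<And>t. continuous_on UNIV (v t)" and per: "\<And>t x. v t (x + 2 * pi) = v t x"
    and lim: "\<And>X t k. X \<longlonglongrightarrow> t \<Longrightarrow> (\<lambda>n. C (r n) (X n) k) \<longlonglongrightarrow> fc (v t) k"
    by (rule galerkin_limit[OF supp mass], assumption) (rule that)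
  have "\<exists>t k. 0 \<le> t \<and> t \<le> T \<and> k \<noteq> 0 \<and> \<bar>k\<bar> \<le> 1700 \<and> 1 / 10000 \<le> cmod (C n t k)" for n
  proof -
    let ?N = "2 * M + 1 + n"
    interpret g: galerkin ?N "C n" by (rule G)
    have m: "g.mass 0 = 1 + \<delta>\<^sup>2 + (?L * \<delta>)\<^sup>2"
    proof -
      have "g.mass 0 = (\<Sum>k\<in>{-int ?N..int ?N}. (cmod (?c0 k))\<^sup>2)"
        unfolding g.mass_def by (rule sum.cong) (auto simp: C0)
      then show ?thesis using datum_mass[OF M, of ?N \<delta>] by simp
    qed
    have D: "g.Dir 0 = \<delta>\<^sup>2 + ?L ^ 4 * \<delta>\<^sup>2"
    proof -
      have "g.Dir 0 = (\<Sum>k\<in>{-int ?N..int ?N}. of_int (k\<^sup>2) * (cmod (?c0 k))\<^sup>2)"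
        unfolding g.Dir_def by (rule sum.cong) (auto simp: C0)
      then show ?thesis using datum_dirichlet[OF M, of ?N \<delta>] by simp
    qed
    have c0: "C n 0 0 = 1" "C n 0 1 = \<delta> * (1 + \<i>) / 2" "C n 0 (-1) = \<delta> * (1 + \<i>) / 2"
      using M by (auto simp: C0 datum_def)
    have u: "g.unstable 0 = \<delta>\<^sup>2 / 2"
      unfolding g.unstable_def c0 by (simp add: power2_eq_square)
    have "(g.Dir 0)\<^sup>2 \<le> (\<delta> / 500)\<^sup>2" unfolding D using D0 by (intro power_mono) auto
    moreover have "26 * (\<delta> / 500)\<^sup>2 \<le> \<delta>\<^sup>2 / 4" by (simp add: power_divide)
    ultimately have "\<delta>\<^sup>2 / 4 \<le> g.unstable 0 - 26 * (g.Dir 0)\<^sup>2"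
      unfolding u by linarith
    then have "exp T * (\<delta>\<^sup>2 / 4) \<le> exp T * (g.unstable 0 - 26 * (g.Dir 0)\<^sup>2)"
      by (intro mult_left_mono) auto
    moreover have "1 < exp T * (\<delta>\<^sup>2 / 4)" using T(2) by simp
    ultimately have grow: "1 < exp T * (g.unstable 0 - 26 * (g.Dir 0)\<^sup>2)" by linarith
    show ?thesis
    proof (rule g.escape[OF _ T(1) _ _ _ grow])
      show "1 \<le> ?N" by simp
      show "1 \<le> g.mass 0" unfolding m by simp
      show "g.mass 0 \<le> 1.01" using mle unfolding m by simp
      show "g.Dir 0 \<le> 0.0001" using D0 \<delta>1 unfolding D by simp
    qed
  qed
  then obtain \<tau> \<kappa> where \<tau>: "\<And>n. 0 \<le> \<tau> n" "\<And>n. \<tau> n \<le> T"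
    and \<kappa>: "\<And>n. \<kappa> n \<noteq> 0" "\<And>n. \<bar>\<kappa> n\<bar> \<le> 1700" "\<And>n. 1 / 10000 \<le> cmod (C n (\<tau> n) (\<kappa> n))"
    by metis
  define \<tau>' where "\<tau>' n = \<tau> (r n)" for n
  obtain t\<^sub>0 q where t0: "t\<^sub>0 \<in> {0..T}" and q: "strict_mono (q :: nat \<Rightarrow> nat)" "(\<tau>' \<circ> q) \<longlonglongrightarrow> t\<^sub>0"
  proof -
    have "seq_compact {0..T}" by (simp add: compact_imp_seq_compact)
    moreover have "\<forall>n. \<tau>' n \<in> {0..T}" using \<tau> by (simp add: \<tau>'_def)
    ultimately show ?thesis using that unfolding seq_compact_def by blast
  qed
  \<comment> \<open>Off the range of q the escape times are replaced by their limit, so that X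
    converges along the full sequence and the convergence of modes along moving times
    applies.\<close>
  define X where "X m = (if m \<in> range q then \<tau>' m else t\<^sub>0)" for m
  have X: "X \<longlonglongrightarrow> t\<^sub>0"
  proof (rule metric_LIMSEQ_I)
    fix e :: real assume e: "0 < e"
    then obtain j0 where j0: "\<And>j. j0 \<le> j \<Longrightarrow> dist (\<tau>' (q j)) t\<^sub>0 < e"
      using metric_LIMSEQ_D[OF q(2)] by (auto simp: o_def)
    have "dist (X m) t\<^sub>0 < e" if "q j0 \<le> m" for m
      using that j0 e strict_mono_less_eq[OF q(1)] by (auto simp: X_def)
    then show "\<exists>no. \<forall>n\<ge>no. dist (X n) t\<^sub>0 < e" by blast
  qed
  have "\<exists>k. k \<noteq> 0 \<and> \<bar>k\<bar> \<le> 1700 \<and> 1 / 10000 \<le> cmod (fc (v t\<^sub>0) k)"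
  proof (rule ccontr)
    assume no: "\<not> ?thesis"
    let ?S = "{-1700..1700} - {0::int}"
    have "\<forall>k\<in>?S. \<forall>\<^sub>F n in sequentially. cmod (C (r n) (X n) k) < 1 / 10000"
    proof
      fix k assume "k \<in> ?S"
      then have "\<bar>k\<bar> \<le> 1700" "k \<noteq> 0" by auto
      then have "cmod (fc (v t\<^sub>0) k) < 1 / 10000" using no not_le by blast
      then show "\<forall>\<^sub>F n in sequentially. cmod (C (r n) (X n) k) < 1 / 10000"
        using order_tendstoD(2)[OF tendsto_norm[OF lim[OF X]]] by blast
    qed
    \<comment> \<open>The escape frequency varies with n but lies in the finite set
      \<open>?S\<close>; uniformity over \<open>?S\<close> contradicts the escape at some index in
      the range of q.\<close>
    then have "\<forall>\<^sub>F n in sequentially. \<forall>k\<in>?S. cmod (C (r n) (X n) k) < 1 / 10000"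
      by (intro eventually_ball_finite) auto
    then obtain n0 where n0: "\<And>n k. n0 \<le> n \<Longrightarrow> k \<in> ?S \<Longrightarrow> cmod (C (r n) (X n) k) < 1 / 10000"
      unfolding eventually_sequentially by blast
    have "n0 \<le> q n0" using q(1) by (rule seq_suble)
    moreover have "\<kappa> (r (q n0)) \<in> ?S" using \<kappa>(1,2)[of "r (q n0)"] by auto
    ultimately have "cmod (C (r (q n0)) (X (q n0)) (\<kappa> (r (q n0)))) < 1 / 10000" by (rule n0)
    moreover have "X (q n0) = \<tau> (r (q n0))" by (simp add: X_def \<tau>'_def)
    ultimately show False using \<kappa>(3)[of "r (q n0)"] by simp
  qed
  then show ?thesis using that[OF sol vt per] t0 by auto
qed

section \<open>The lattice solution\<close>

lemma AE_lebesgue_I_negligible: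
  assumes "negligible N" "\<And>x. x \<notin> N \<Longrightarrow> P x"
  shows "AE x in lebesgue. P x"
  by (rule AE_mp[OF AE_not_in[of N]]) (use assms in \<open>auto simp: negligible_iff_null_sets\<close>)

lemma right_derivative_prim:
  fixes g :: "real \<Rightarrow> real"
  assumes int: "\<And>a b. g integrable_on {a..b}"
  obtains N where "negligible N"
    "\<And>x e. x \<notin> N \<Longrightarrow> 0 < e \<Longrightarrow> \<exists>d>0. \<forall>h. 0 < h \<and> h < d \<longrightarrow> \<bar>integral {x..x + h} g / h - g x\<bar> < e"
proof -
  have "g integrable_on cbox a b" for a b using int by simp
  then obtain N where "negligible N"
    and "\<And>x e. x \<notin> N \<Longrightarrow> 0 < e \<Longrightarrow> \<exists>d>0. \<forall>h. 0 < h \<and> h < d \<longrightarrow>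
      norm (integral (cbox x (x + h *\<^sub>R One)) g /\<^sub>R h ^ DIM(real) - g x) < e"
    by (rule integrable_ccontinuous_explicit) blast
  then show ?thesis using that[of N] by (simp add: divide_inverse mult.commute)
qed

text \<open>Since \<open>a\<close> is only measurable, the phase of the lattice solution is a
  primitive of a measurable function and the equation can hold only almost everywhere. Right
  difference quotients come from \<open>right_derivative_prim\<close>; left ones are the right ones
  of the reflected function.\<close>

theorem prim_has_derivative_AE:
  fixes g :: "real \<Rightarrow> real"
  assumes int: "\<And>a b. g integrable_on {a..b}"
  shows "AE t in lebesgue. (prim g has_real_derivative g t) (at t)"
proof -
  define g' where "g' x = g (- x)" for x
  have int': "g' integrable_on {a..b}" for a b
    using int[of "-b" "-a"] Henstock_Kurzweil_Integration.integrable_reflect_real[where f = g and a = "-b" and b = "-a"]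
    by (simp add: g'_def[abs_def])
  obtain N1 where N1: "negligible N1"
    "\<And>x e. x \<notin> N1 \<Longrightarrow> 0 < e \<Longrightarrow> \<exists>d>0. \<forall>h. 0 < h \<and> h < d \<longrightarrow> \<bar>integral {x..x + h} g / h - g x\<bar> < e"
    using right_derivative_prim[OF int] by blast
  obtain N2 where N2: "negligible N2"
    "\<And>x e. x \<notin> N2 \<Longrightarrow> 0 < e \<Longrightarrow> \<exists>d>0. \<forall>h. 0 < h \<and> h < d \<longrightarrow> \<bar>integral {x..x + h} g' / h - g' x\<bar> < e"
    using right_derivative_prim[OF int'] by blast
  have neg: "negligible (uminus ` N2)"
    by (rule negligible_differentiable_image_negligible[OF _ N2(1)]) (auto intro!: derivative_intros)
  have diff: "prim g b - prim g a = integral {a..b} g" if "a \<le> b" for a b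
  proof -
    define T where "T = max \<bar>a\<bar> \<bar>b\<bar>"
    have ab: "\<bar>a\<bar> \<le> T" "\<bar>b\<bar> \<le> T" by (auto simp: T_def)
    have "integral {-T..a} g + integral {a..b} g = integral {-T..b} g"
      by (rule Henstock_Kurzweil_Integration.integral_combine) (use ab that int in auto)
    then show ?thesis using prim_shift[OF int ab(1)] prim_shift[OF int ab(2)] by simp
  qed
  show ?thesis
  proof (rule AE_lebesgue_I_negligible[OF negligible_Un[OF N1(1) neg]])
    fix t assume "t \<notin> N1 \<union> uminus ` N2"
    then have t: "t \<notin> N1" "- t \<notin> N2" by (auto intro: image_eqI[of _ _ "- t"])
    show "(prim g has_real_derivative g t) (at t)"
      unfolding DERIV_def
    proof (rule LIM_I)
      fix e :: real assume e: "0 < e"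
      obtain d1 where d1: "d1 > 0" "\<And>h. 0 < h \<Longrightarrow> h < d1 \<Longrightarrow> \<bar>integral {t..t + h} g / h - g t\<bar> < e"
        using N1(2)[OF t(1) e] by blast
      obtain d2 where d2: "d2 > 0" "\<And>h. 0 < h \<Longrightarrow> h < d2 \<Longrightarrow> \<bar>integral {- t..- t + h} g' / h - g' (- t)\<bar> < e"
        using N2(2)[OF t(2) e] by blast
      have "norm ((prim g (t + h) - prim g t) / h - g t) < e" if h: "h \<noteq> 0" "norm (h - 0) < min d1 d2" for h
      proof (cases "0 < h")
        case True
        then show ?thesis using d1(2)[of h] h diff[of t "t + h"] by simp
      next
        case False
        then have h': "0 < - h" "- h < d2" using h by auto
        have "integral {- t..- t + - h} g' = integral {t + h..t} g"
          using Henstock_Kurzweil_Integration.integral_reflect_real[of t "t + h" g] by (simp add: g'_def[abs_def])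
        also have "\<dots> = prim g t - prim g (t + h)" using diff[of "t + h" t] False by simp
        finally have "integral {- t..- t + - h} g' / (- h) - g' (- t) = (prim g (t + h) - prim g t) / h - g t"
          by (simp add: g'_def) (simp add: diff_divide_distrib)
        then show ?thesis using d2(2)[OF h'] by simp
      qed
      then show "\<exists>s>0. \<forall>x. x \<noteq> 0 \<and> norm (x - 0) < s \<longrightarrow> norm ((prim g (t + x) - prim g t) / x - g t) < e"
        using d1(1) d2(1) by (intro exI[of _ "min d1 d2"]) auto
    qed
  qed
qed

lemma bounded_measurable_integrable:
  fixes g :: "real \<Rightarrow> real"
  assumes "g \<in> borel_measurable lebesgue" "\<And>x. \<bar>g x\<bar> \<le> B"
  shows "g integrable_on {a..b}"
proof (rule measurable_bounded_by_integrable_imp_integrable)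
  show "g \<in> borel_measurable (lebesgue_on {a..b})"
    using assms(1) by (rule measurable_restrict_space1)
  show "(\<lambda>x. B) integrable_on {a..b}" by (rule integrable_const_ivl)
qed (use assms in auto)

lemma prim_lipschitz:
  fixes g :: "real \<Rightarrow> real"
  assumes int: "\<And>a b. g integrable_on {a..b}" and B: "\<And>x. \<bar>g x\<bar> \<le> B" and "a \<le> b"
  shows "\<bar>prim g b - prim g a\<bar> \<le> B * (b - a)"
proof -
  define T where "T = max \<bar>a\<bar> \<bar>b\<bar>"
  have ab: "\<bar>a\<bar> \<le> T" "\<bar>b\<bar> \<le> T" by (auto simp: T_def)
  have "integral {-T..a} g + integral {a..b} g = integral {-T..b} g"
    by (rule Henstock_Kurzweil_Integration.integral_combine) (use ab assms in auto)
  then have "prim g b - prim g a = integral {a..b} g"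
    using prim_shift[OF int ab(1)] prim_shift[OF int ab(2)] by simp
  moreover have "norm (integral {a..b} g) \<le> integral {a..b} (\<lambda>x. B)"
    by (rule integral_norm_bound_integral) (use int B in auto)
  ultimately show ?thesis using assms(3) by (simp add: mult.commute)
qed

section \<open>Lattice functions that are constant in space\<close>

lemma lattice_fourier_coeff_const:
  assumes M: "0 < M" and g: "\<And>x. x \<in> lattice M \<Longrightarrow> g x = z" and k: "k \<in> dual_lattice M"
  shows "lattice_fourier_coeff M g k = (if k = 0 then z else 0)"
proof -
  let ?I = "{- int M..int M - 1}"
  have inj: "inj_on (\<lambda>j. mesh M * of_int j) ?I"
    using M by (auto simp: inj_on_def mesh_def)
  have "(\<Sum>x\<in>lattice M. g x * cis (- (of_int k * x))) = (\<Sum>x\<in>lattice M. z * cis (- (of_int k * x)))"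
    by (rule sum.cong) (auto simp: g)
  also have "\<dots> = z * (\<Sum>j\<in>?I. cis (- (of_int k * (mesh M * of_int j))))"
    unfolding lattice_def by (simp add: sum.reindex[OF inj] sum_distrib_left)
  finally have S: "(\<Sum>x\<in>lattice M. g x * cis (- (of_int k * x))) =
      z * (\<Sum>j\<in>?I. cis (- (of_int k * (mesh M * of_int j))))" .
  show ?thesis
  proof (cases "k = 0")
    case True
    have "complex_of_real (mesh M / (2 * pi)) * (z * of_nat (2 * M)) = z"
      using M by (simp add: mesh_def)
    then show ?thesis using S True by (simp add: lattice_fourier_coeff_def)
  next
    case False
    define \<zeta> where "\<zeta> = cis (- (of_int k * mesh M))"
    \<comment> \<open>The root of unity \<zeta> equals 1 only if 2 M divides k, which is impossible
      for nonzero k with |k| \<le> M. Its powers over a full period of length 2 M then sum to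
      0.\<close>
    have "\<zeta> \<noteq> 1"
    proof
      assume "\<zeta> = 1"
      then have "cos (- (of_int k * mesh M)) = 1" by (simp add: \<zeta>_def complex_eq_iff)
      then obtain n :: int where "- (of_int k * mesh M) = real_of_int n * 2 * pi"
        using cos_one_2pi_int[of "- (of_int k * mesh M)"] by auto
      then have "pi * (- real_of_int k) = pi * of_int (2 * n * int M)"
        using M by (simp add: mesh_def field_simps)
      then have "- real_of_int k = of_int (2 * n * int M)"
        by (subst (asm) mult_left_cancel) auto
      then have kn: "- k = 2 * n * int M" by (metis of_int_eq_iff of_int_minus)
      have "\<bar>k\<bar> \<le> int M" using k by (auto simp: dual_lattice_def)
      moreover have "n \<noteq> 0" using kn False by auto
      then have "int M < \<bar>k\<bar>"
      proof -
        have "\<bar>k\<bar> = 2 * \<bar>n\<bar> * int M" using kn by (metis abs_minus_cancel abs_mult abs_numeral abs_of_nat)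
        moreover have "1 * int M \<le> \<bar>n\<bar> * int M" using \<open>n \<noteq> 0\<close> by (intro mult_right_mono) auto
        ultimately show ?thesis using M by linarith
      qed
      ultimately show False by simp
    qed
    have "\<zeta> ^ (2 * M) = 1"
    proof -
      have "real (2 * M) * (- (of_int k * mesh M)) = 2 * pi * of_int (- k)"
        using M by (simp add: mesh_def)
      then have "\<zeta> ^ (2 * M) = cis (2 * pi * of_int (- k))"
        by (simp only: \<zeta>_def Complex.DeMoivre)
      then show ?thesis by (simp only: cis_multiple_2pi Ints_of_int)
    qed
    have "(\<Sum>j\<in>?I. cis (- (of_int k * (mesh M * of_int j)))) = (\<Sum>i<2 * M. cis (- (of_int k * (mesh M * of_int (int i - int M)))))"
      by (rule sum.reindex_bij_witness[of _ "\<lambda>i. int i - int M" "\<lambda>j. nat (j + int M)"]) auto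
    also have "\<dots> = (\<Sum>i<2 * M. cis (of_int k * (mesh M * real M)) * \<zeta> ^ i)"
      unfolding \<zeta>_def Complex.DeMoivre cis_mult by (rule sum.cong) (auto simp: algebra_simps)
    also have "\<dots> = cis (of_int k * (mesh M * real M)) * (\<Sum>i<2 * M. \<zeta> ^ i)"
      by (rule sum_distrib_left[symmetric])
    also have "(\<Sum>i<2 * M. \<zeta> ^ i) = 0"
      using geometric_sum[OF \<open>\<zeta> \<noteq> 1\<close>, of "2 * M"] \<open>\<zeta> ^ (2 * M) = 1\<close> by simp
    finally show ?thesis using S False by (simp add: lattice_fourier_coeff_def)
  qed
qed

lemma shannon_const:
  assumes M: "0 < M" and g: "\<And>x. x \<in> lattice M \<Longrightarrow> g x = z"
  shows "shannon M g x = z"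
proof -
  have "shannon M g x = (\<Sum>k\<in>dual_lattice M. if 0 = k then z else 0)"
    unfolding shannon_def by (rule sum.cong) (auto simp: lattice_fourier_coeff_const[OF M g])
  also have "\<dots> = z" using M by (subst sum.delta') (auto simp: dual_lattice_def)
  finally show ?thesis .
qed

lemma projector_const:
  assumes M: "0 < M" and \<Lambda>: "s < 1 \<Longrightarrow> 0 \<le> \<Lambda>" and g: "\<And>x. x \<in> lattice M \<Longrightarrow> g x = z"
  shows "projector s \<Lambda> M g x = z"
proof -
  have 0: "0 \<in> dual_lattice M" using M by (auto simp: dual_lattice_def)
  then have "cutoff s \<Lambda> M 0 = 1" using \<Lambda> by (auto simp: cutoff_def)
  then have "projector s \<Lambda> M g x = (\<Sum>k\<in>dual_lattice M. if 0 = k then z else 0)"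
    unfolding projector_def by (intro sum.cong) (auto simp: lattice_fourier_coeff_const[OF M g])
  also have "\<dots> = z" using M by (subst sum.delta') (auto simp: dual_lattice_def)
  finally show ?thesis .
qed

text \<open>Constants are eigenfunctions of the magnetic Laplacian and are fixed by the projector,
  so on them the lattice equation reduces to a scalar equation for the phase, solved by
  integration.\<close>

lemma lattice_solution_const:
  assumes M: "0 < M" and \<Lambda>: "s < 1 \<Longrightarrow> 0 \<le> \<Lambda>" and a: "a \<in> borel_measurable lebesgue"
    and u0: "\<And>x. x \<in> lattice M \<Longrightarrow> cell_average M u0 x = 1"
  obtains \<psi> :: "real \<Rightarrow> real" where "lattice_solution s \<Lambda> a (-1) M u0 (\<lambda>t x. cis (\<psi> t))"
proof -
  let ?h = "mesh M"
  have h: "?h > 0" using M by (simp add: mesh_def)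
  \<comment> \<open>The eigenvalue of the magnetic Laplacian on constants, plus 1 from the focusing
    nonlinearity at modulus 1.\<close>
  define g where "g t = (2 * cos (?h * a t) - 2) / ?h\<^sup>2 + 1" for t
  define B where "B = 4 / ?h\<^sup>2 + 1"
  have B0: "0 < B" using h by (simp add: B_def add_nonneg_pos)
  have gm: "g \<in> borel_measurable lebesgue" unfolding g_def using a by measurable
  have gB: "\<bar>g t\<bar> \<le> B" for t
  proof -
    \<comment> \<open>As the potential enters only through a cosine, g is bounded at every time for
      fixed h. The phase is therefore Lipschitz, which gives absolute continuity.\<close>
    have "\<bar>2 * cos (?h * a t) - 2\<bar> \<le> 4"
      using cos_ge_minus_one[of "?h * a t"] cos_le_one[of "?h * a t"]
      unfolding abs_le_iff by linarith
    then have "\<bar>2 * cos (?h * a t) - 2\<bar> / ?h\<^sup>2 \<le> 4 / ?h\<^sup>2" by (intro divide_right_mono) auto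
    then have "\<bar>(2 * cos (?h * a t) - 2) / ?h\<^sup>2\<bar> \<le> 4 / ?h\<^sup>2" by (simp add: abs_divide)
    then show ?thesis unfolding g_def B_def by linarith
  qed
  have int: "g integrable_on {a..b}" for a b by (rule bounded_measurable_integrable[OF gm gB])
  define \<psi> where "\<psi> = prim g"
  have lip: "\<bar>\<psi> b - \<psi> a\<bar> \<le> B * (b - a)" if "a \<le> b" for a b
    unfolding \<psi>_def by (rule prim_lipschitz[OF int gB that])
  show ?thesis
  proof (rule that[of \<psi>], unfold lattice_solution_def, intro conjI allI ballI impI)
    show "periodic_fun_simple (\<lambda>x. cis (\<psi> t)) (2 * pi)" for t by unfold_locales simp
    show "absolutely_continuous_on {- T..T} (\<lambda>t. cis (\<psi> t))" for T
      unfolding absolutely_continuous_on_def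
    proof (intro allI impI)
      fix e :: real assume e: "0 < e"
      show "\<exists>\<delta>>0. \<forall>(n::nat) l r.
        (\<forall>i<n. l i \<in> {- T..T} \<and> r i \<in> {- T..T} \<and> l i \<le> r i) \<and>
        disjoint_family_on (\<lambda>i. {l i<..<r i}) {..<n} \<and>
        (\<Sum>i<n. r i - l i) < \<delta> \<longrightarrow>
        (\<Sum>i<n. cmod (cis (\<psi> (r i)) - cis (\<psi> (l i)))) < e"
      proof (rule exI[of _ "e / B"], intro conjI allI impI)
        show "0 < e / B" using e B0 by simp
        fix n :: nat and l r :: "nat \<Rightarrow> real"
        assume A: "(\<forall>i<n. l i \<in> {- T..T} \<and> r i \<in> {- T..T} \<and> l i \<le> r i) \<and>
          disjoint_family_on (\<lambda>i. {l i<..<r i}) {..<n} \<and> (\<Sum>i<n. r i - l i) < e / B"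
        have "(\<Sum>i<n. cmod (cis (\<psi> (r i)) - cis (\<psi> (l i)))) \<le> (\<Sum>i<n. B * (r i - l i))"
        proof (rule sum_mono)
          fix i assume "i \<in> {..<n}"
          then have "l i \<le> r i" using A by auto
          then show "cmod (cis (\<psi> (r i)) - cis (\<psi> (l i))) \<le> B * (r i - l i)"
            by (rule order_trans[OF cmod_cis_diff_le lip])
        qed
        also have "\<dots> = B * (\<Sum>i<n. r i - l i)" by (rule sum_distrib_left[symmetric])
        also have "\<dots> < B * (e / B)" using A B0 by (intro mult_strict_left_mono) auto
        finally show "(\<Sum>i<n. cmod (cis (\<psi> (r i)) - cis (\<psi> (l i)))) < e" using B0 by simp
      qed
    qed
    show "cis (\<psi> 0) = projector s \<Lambda> M (cell_average M u0) x" for x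
      using projector_const[OF M \<Lambda>, where g = "cell_average M u0" and z = 1 and x = x] u0 by (simp add: \<psi>_def)
    have "AE t in lebesgue. (prim g has_real_derivative g t) (at t)"
      by (rule prim_has_derivative_AE[OF int])
    then show "AE t in lebesgue. \<forall>x\<in>lattice M. \<exists>D.
        ((\<lambda>\<tau>. cis (\<psi> \<tau>)) has_vector_derivative D) (at t) \<and>
        \<i> * D = - magnetic_laplacian M (a t) (\<lambda>x. cis (\<psi> t)) x
          + complex_of_real (-1) * projector s \<Lambda> M
              (\<lambda>y. complex_of_real ((cmod (projector s \<Lambda> M (\<lambda>x. cis (\<psi> t)) y))\<^sup>2) *
                   projector s \<Lambda> M (\<lambda>x. cis (\<psi> t)) y) x"
    proof (eventually_elim, intro ballI)
      fix t x assume der: "(prim g has_real_derivative g t) (at t)"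
      let ?w = "cis (\<psi> t)"
      have P: "projector s \<Lambda> M (\<lambda>x. z) y = z" for z y by (rule projector_const[OF M \<Lambda>]) auto
      have "((\<lambda>\<tau>. cis (\<psi> \<tau>)) has_vector_derivative (g t *\<^sub>R (\<i> * ?w))) (at t)"
      proof -
        have "(cis has_vector_derivative \<i> * ?w) (at (\<psi> t))"
          unfolding cis_conv_exp[abs_def]
          by (auto intro!: derivative_eq_intros has_vector_derivative_real_field)
        moreover have "(\<psi> has_vector_derivative g t) (at t)"
          using der by (simp add: \<psi>_def has_real_derivative_iff_has_vector_derivative)
        ultimately show ?thesis
          using vector_diff_chain_at[of \<psi> "g t" t cis "\<i> * ?w"] by (simp add: o_def)
      qed
      moreover have "\<i> * (g t *\<^sub>R (\<i> * ?w)) = - magnetic_laplacian M (a t) (\<lambda>x. ?w) x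
          + complex_of_real (-1) * projector s \<Lambda> M
              (\<lambda>y. complex_of_real ((cmod (projector s \<Lambda> M (\<lambda>x. ?w) y))\<^sup>2) * projector s \<Lambda> M (\<lambda>x. ?w) y) x"
      proof -
        have c: "cis (- (?h * a t)) + cis (?h * a t) = 2 * complex_of_real (cos (?h * a t))"
          by (simp add: complex_eq_iff)
        have "magnetic_laplacian M (a t) (\<lambda>x. ?w) x =
            ((cis (- (?h * a t)) + cis (?h * a t)) - 2) * ?w / complex_of_real (?h\<^sup>2)"
          unfolding magnetic_laplacian_def by (simp add: algebra_simps)
        also have "\<dots> = complex_of_real (g t - 1) * ?w"
          unfolding c by (simp add: g_def)
        finally show ?thesis
          unfolding P by (simp add: scaleR_conv_of_real algebra_simps)
      qed
      ultimately show "\<exists>D. ((\<lambda>\<tau>. cis (\<psi> \<tau>)) has_vector_derivative D) (at t) \<and>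
        \<i> * D = - magnetic_laplacian M (a t) (\<lambda>x. ?w) x
          + complex_of_real (-1) * projector s \<Lambda> M
              (\<lambda>y. complex_of_real ((cmod (projector s \<Lambda> M (\<lambda>x. ?w) y))\<^sup>2) * projector s \<Lambda> M (\<lambda>x. ?w) y) x"
        by blast
    qed
  qed
qed

lemma trig_datum:
  assumes "1 \<le> M"
  shows "trig (2 * M + 1) (datum M \<delta>) y =
    1 + \<delta> * (1 + \<i>) * (cos y + (2 * real M + 1) * cos ((2 * real M + 1) * y))"
proof -
  have "trig (2 * M + 1) (datum M \<delta>) y = 1 + (complex_of_real \<delta> * (1 + \<i>) / 2 * cis y
      + (complex_of_real \<delta> * (1 + \<i>) / 2 * cis (- y)
      + (complex_of_real ((2 * real M + 1) * \<delta>) * (1 + \<i>) / 2 * cis ((2 * real M + 1) * y)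
      + complex_of_real ((2 * real M + 1) * \<delta>) * (1 + \<i>) / 2 * cis (- ((2 * real M + 1) * y)))))"
    unfolding trig_def
    using sum_datum[OF assms _ order_refl, of "\<lambda>k z. z * cis (of_int k * y)" \<delta>]
    by (simp add: algebra_simps)
  also have "\<dots> = 1 + \<delta> * (1 + \<i>) * (cos y + (2 * real M + 1) * cos ((2 * real M + 1) * y))"
  proof -
    have c: "w * cis t + (w * cis (- t) + z) = 2 * w * complex_of_real (cos t) + z" for w z t
      by (simp add: complex_eq_iff algebra_simps)
    have c': "w * cis t + w * cis (- t) = 2 * w * complex_of_real (cos t)" for w t
      by (simp add: complex_eq_iff algebra_simps)
    show ?thesis unfolding c c' by (simp add: field_simps)
  qed
  finally show ?thesis .
qed

text \<open>The primitive of the oscillating part of the datum is a multiple of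
  \<open>sin ((M + 1) y) cos (M y)\<close>, which vanishes at the midpoints between lattice points:
  the high frequency of the datum is aliased onto the low one and cancels it.\<close>

lemma cell_average_datum:
  assumes M: "1 \<le> M" and x: "x \<in> lattice M"
  shows "cell_average M (trig (2 * M + 1) (datum M \<delta>)) x = 1"
proof -
  let ?h = "mesh M" and ?L = "2 * real M + 1" and ?u = "trig (2 * M + 1) (datum M \<delta>)"
  have h: "0 < ?h" using M by (simp add: mesh_def)
  define S where "S y = sin y + sin (?L * y)" for y
  have S: "S y = 2 * sin ((real M + 1) * y) * cos (real M * y)" for y
  proof -
    have "y = (real M + 1) * y - real M * y" "?L * y = (real M + 1) * y + real M * y"
      by (simp_all add: algebra_simps)
    then have "S y = sin ((real M + 1) * y - real M * y) + sin ((real M + 1) * y + real M * y)"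
      by (simp only: S_def)
    then show ?thesis unfolding sin_add sin_diff by simp
  qed
  obtain j where j: "x = ?h * of_int j" using x by (auto simp: lattice_def)
  \<comment> \<open>M h = pi turns the end points of the cell around a lattice point into zeros of
    cos (M y).\<close>
  have "real M * (x + ?h / 2) = of_int j * pi + pi / 2" "real M * (x - ?h / 2) = of_int j * pi - pi / 2"
    using M by (simp_all add: j mesh_def field_simps)
  moreover have "cos (of_int j * pi + pi / 2) = 0" "cos (of_int j * pi - pi / 2) = 0"
    by (simp_all add: cos_add cos_diff sin_npi_int mult.commute)
  ultimately have S0: "S (x + ?h / 2) = 0" "S (x - ?h / 2) = 0" by (simp_all add: S)
  have cu: "continuous_on A ?u" for A by (rule continuous_trig)
  have dS: "(S has_real_derivative cos y + ?L * cos (?L * y)) (at y)" for y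
    unfolding S_def[abs_def] by (auto intro!: derivative_eq_intros)
  have dU: "((\<lambda>y. complex_of_real y + \<delta> * (1 + \<i>) * complex_of_real (S y)) has_vector_derivative ?u y) (at y)" for y
  proof -
    have "((\<lambda>y. complex_of_real y) has_vector_derivative 1) (at y)"
      using has_vector_derivative_of_real[OF DERIV_ident] by simp
    from has_vector_derivative_add[OF this has_vector_derivative_mult_right[OF has_vector_derivative_of_real[OF dS]]]
    show ?thesis unfolding trig_datum[OF M] by (rule has_vector_derivative_eq_rhs) simp
  qed
  have "(?u has_integral (complex_of_real (x + ?h / 2) + \<delta> * (1 + \<i>) * complex_of_real (S (x + ?h / 2)))
      - (complex_of_real (x - ?h / 2) + \<delta> * (1 + \<i>) * complex_of_real (S (x - ?h / 2)))) {x - ?h / 2..x + ?h / 2}"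
  proof (rule fundamental_theorem_of_calculus)
    show "x - ?h / 2 \<le> x + ?h / 2" using h by simp
  qed (rule has_vector_derivative_at_within[OF dU])
  then have "integral {x - ?h / 2..x + ?h / 2} ?u = complex_of_real ?h"
    unfolding S0 by (simp only: integral_unique of_real_0 mult_zero_right add_0_right of_real_diff[symmetric]) simp
  moreover have "(LINT y=x - ?h / 2..x + ?h / 2|lebesgue. (?u y)) = integral {x - ?h / 2..x + ?h / 2} ?u"
    by (rule LINT_lebesgue_eq_integral[OF set_integrable_lebesgue_continuous[OF cu]]) (use h in simp)
  ultimately show ?thesis using h by (simp add: cell_average_def)
qed

section \<open>Sobolev norms, gauge and conclusion\<close>

lemma mean_translate:
  fixes F :: "real \<Rightarrow> 'a::banach"
  assumes F: "continuous_on UNIV F" and per: "\<And>x. F (x + 2 * pi) = F x"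
  shows "mean (\<lambda>x. F (x + y)) = mean F"
proof -
  have I: "integral {-pi..pi} (\<lambda>x. F (x + y)) = prim F (pi + y) - prim F (-pi + y)" for y
  proof (rule integral_unique, rule fundamental_theorem_of_calculus)
    show "((\<lambda>x. prim F (x + y)) has_vector_derivative F (x + y)) (at x within {-pi..pi})" for x
    proof -
      have "((\<lambda>x. x + y) has_vector_derivative 1) (at x)"
        by (auto intro!: derivative_eq_intros)
      from vector_diff_chain_at[OF this prim_has_vector_derivative[OF F]]
      show ?thesis by (simp add: o_def has_vector_derivative_at_within)
    qed
  qed auto
  \<comment> \<open>The integral over the shifted period does not change with the shift, because its
    derivative is the difference of F at two points one period apart.\<close>
  have "((\<lambda>y. prim F (pi + y) - prim F (-pi + y)) has_vector_derivative 0) (at y)" for y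
  proof -
    have d: "((\<lambda>y. prim F (c + y)) has_vector_derivative F (c + y)) (at y)" for c
    proof -
      have "((\<lambda>y. c + y) has_vector_derivative 1) (at y)"
        by (auto intro!: derivative_eq_intros)
      from vector_diff_chain_at[OF this prim_has_vector_derivative[OF F]]
      show ?thesis by (simp add: o_def)
    qed
    have "F (pi + y) = F (-pi + y)" using per[of "-pi + y"] by (simp add: algebra_simps)
    then show ?thesis using has_vector_derivative_diff[OF d[of pi] d[of "-pi"]] by simp
  qed
  from prim_eq_diff[OF this, of y]
  have "prim F (pi + y) - prim F (-pi + y) = prim F (pi + 0) - prim F (-pi + 0)"
    by (simp add: prim_def split: if_splits)
  then show ?thesis using I[of y] I[of 0] by (simp add: mean_def)
qed

lemma cis_of_int_period: "cis (- (of_int k * (x + 2 * pi))) = cis (- (of_int k * x))"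
proof -
  have "- (of_int k * (x + 2 * pi)) = - (of_int k * x) + 2 * pi * of_int (- k)"
    by (simp add: algebra_simps)
  moreover have "cis (2 * pi * of_int (- k)) = 1" by (rule cis_multiple_2pi) simp
  ultimately show ?thesis by (simp only: cis_mult[symmetric] mult_1_right)
qed

text \<open>A translation multiplies each Fourier coefficient by a number of modulus 1. The gauge
  can thus be undone without knowing the integrals of \<open>a\<close>.\<close>

lemma cmod_fc_translate:
  assumes f: "continuous_on UNIV f" and per: "\<And>x. f (x + 2 * pi) = f x"
  shows "cmod (fc (\<lambda>x. f (x + y)) k) = cmod (fc f k)"
proof -
  let ?F = "\<lambda>x. f x * cis (- (of_int k * x))"
  have F: "continuous_on UNIV ?F" by (intro continuous_intros f)
  have shift: "continuous_on UNIV (\<lambda>x. ?F (x + y))"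
    by (rule continuous_on_compose2[OF F]) (auto intro!: continuous_intros)
  have eq: "f (x + y) * cis (- (of_int k * x)) = cis (of_int k * y) * ?F (x + y)" for x
    by (simp add: cis_mult algebra_simps)
  have "fc (\<lambda>x. f (x + y)) k = cis (of_int k * y) * mean (\<lambda>x. ?F (x + y))"
    unfolding fc_def eq by (rule mean_mult_left[OF shift])
  also have "mean (\<lambda>x. ?F (x + y)) = mean ?F"
    by (rule mean_translate[OF F]) (simp only: per cis_of_int_period)
  finally show ?thesis by (simp add: norm_mult fc_def)
qed

text \<open>The solution is defined through the function inverse \<open>inv\<close>, so the explicit
  formula follows from injectivity together with a check that the candidate is a preimage.\<close>

lemma inv_gauge_transform:
  "inv (gauge_transform a t) f = (\<lambda>x. cis (- (LINT \<tau>=0..t|lebesgue. ((a \<tau>)\<^sup>2))) *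
     f (x + 2 * (LINT \<tau>=0..t|lebesgue. (a \<tau>))))"
proof (rule inv_f_eq)
  show "inj (gauge_transform a t)"
  proof (rule injI, rule ext)
    fix f g x assume "gauge_transform a t f = gauge_transform a t g"
    from fun_cong[OF this, of "x + 2 * (LINT \<tau>=0..t|lebesgue. (a \<tau>))"]
    show "f x = g x" by (simp add: gauge_transform_def)
  qed
qed (simp add: gauge_transform_def fun_eq_iff cis_mult flip: mult.assoc)

lemma japanese_ge_1: "1 \<le> japanese x"
  by (simp add: japanese_def)

text \<open>All Sobolev weights are at least 1 for \<rho> \<ge> 0, so one nonzero mode already
  bounds the norm from below.\<close>

lemma fourier_coeff_le_Hs_norm:
  assumes "in_Hs \<rho> f" "0 \<le> \<rho>"
  shows "cmod (fourier_coeff f k) \<le> Hs_norm \<rho> f"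
proof -
  let ?g = "\<lambda>k::int. japanese (of_int k) powr (2 * \<rho>) * (cmod (fourier_coeff f k))\<^sup>2"
  have "1 * (cmod (fourier_coeff f k))\<^sup>2 \<le> ?g k"
    using assms(2) japanese_ge_1 by (intro mult_right_mono ge_one_powr_ge_zero) auto
  also have "?g k = sum ?g {k}" by simp
  also have "\<dots> \<le> infsum ?g UNIV"
    by (rule finite_sum_le_infsum) (use assms(1) in \<open>auto simp: in_Hs_def\<close>)
  finally show ?thesis
    unfolding Hs_norm_def by (intro real_le_rsqrt) simp
qed

lemma trig_period: "trig N c (x + 2 * pi) = trig N c x"
proof -
  have "cis (of_int k * (x + 2 * pi)) = cis (of_int k * x)" for k
    using cis_of_int_period[of "- k" x] by simp
  then show ?thesis by (simp add: trig_def)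
qed

lemma datum_Hs:
  assumes M: "1 \<le> M" and s: "0 \<le> s" and \<delta>: "0 < \<delta>"
    and small: "japanese (2 * real M + 1) powr s * ((2 * real M + 1) * \<delta>) \<le> 1"
  shows "in_Hs s (trig (2 * M + 1) (datum M \<delta>))" "Hs_norm s (trig (2 * M + 1) (datum M \<delta>)) \<le> 2"
proof -
  let ?N = "2 * M + 1" and ?L = "2 * real M + 1"
  let ?u = "trig ?N (datum M \<delta>)"
  have cu: "continuous_on UNIV ?u" by (rule continuous_trig)
  have fu: "fourier_coeff ?u k = datum M \<delta> k" for k
    unfolding fourier_coeff_eq_fc[OF cu] fc_trig using M by (auto simp: datum_def)
  let ?g = "\<lambda>k::int. japanese (of_int k) powr (2 * s) * (cmod (datum M \<delta> k))\<^sup>2"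
  have c: "(cmod (complex_of_real x * (1 + \<i>) / 2))\<^sup>2 = x\<^sup>2 / 2" for x
    by (simp add: norm_mult norm_divide power_mult_distrib power_divide cmod_one_plus_i)
  have jp: "japanese (- x) = japanese x" for x by (simp add: japanese_def)
  have L: "real_of_int (2 * int M + 1) = ?L" "real_of_int (- (2 * int M + 1)) = - ?L" by simp_all
  have "(\<Sum>k\<in>{-int ?N..int ?N}. ?g k) = 1 + japanese 1 powr (2 * s) * \<delta>\<^sup>2 + japanese ?L powr (2 * s) * (?L * \<delta>)\<^sup>2"
    using sum_datum[OF M _ order_refl, of "\<lambda>k z. japanese (of_int k) powr (2 * s) * (cmod z)\<^sup>2" \<delta>]
    unfolding c L jp by (simp add: japanese_def)
  moreover have "japanese ?L powr (2 * s) * (?L * \<delta>)\<^sup>2 = (japanese ?L powr s * (?L * \<delta>))\<^sup>2"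
  proof -
    have "japanese ?L powr (2 * s) = (japanese ?L powr s)\<^sup>2"
      by (simp add: power2_eq_square powr_add[symmetric])
    then show ?thesis by (simp only: power_mult_distrib)
  qed
  moreover have "(japanese ?L powr s * (?L * \<delta>))\<^sup>2 \<le> 1"
    using small \<delta> by (simp add: power_le_one)
  \<comment> \<open>The low mode carries a smaller weight and a smaller amplitude than the high one,
    so each of the three contributions to the squared norm is at most 1.\<close>
  moreover have "japanese 1 powr (2 * s) * \<delta>\<^sup>2 \<le> japanese ?L powr (2 * s) * (?L * \<delta>)\<^sup>2"
  proof (intro mult_mono powr_mono2 power_mono)
    show "japanese 1 \<le> japanese ?L" by (simp add: japanese_def power_mono)
    show "\<delta> \<le> ?L * \<delta>" using \<delta> by (simp add: mult_le_cancel_right1)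
    show "0 \<le> japanese 1" by (simp add: japanese_def)
  qed (use s \<delta> in auto)
  ultimately have sum: "(\<Sum>k\<in>{-int ?N..int ?N}. ?g k) \<le> 4" by linarith
  have hs: "(?g has_sum (\<Sum>k\<in>{-int ?N..int ?N}. ?g k)) UNIV"
    by (rule has_sum_finite_neutralI) (auto simp: datum_def)
  show "in_Hs s ?u"
    unfolding in_Hs_def fu
    using in_L2_continuous[OF cu trig_period] has_sum_imp_summable[OF hs] by blast
  show "Hs_norm s ?u \<le> 2"
    unfolding Hs_norm_def fu infsumI[OF hs] using sum by (intro real_le_lsqrt) auto
qed

text \<open>Power laws in M decide everything: \<delta> is the power M^(-q), whereas T is only
  logarithmic in M, so the factor h^\<theta> wins over any power of T.\<close>

lemma parameters_exist:
  fixes \<theta> p C h0 s :: real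
  assumes "0 < \<theta>" "0 \<le> p" "0 < C" "0 < h0" "0 \<le> s"
  obtains M :: nat and \<delta> T :: real where "1 \<le> M" "mesh M \<le> h0" "0 < \<delta>"
    "(2 * real M + 1) ^ 4 * \<delta> \<le> 1 / 1000"
    "japanese (2 * real M + 1) powr s * ((2 * real M + 1) * \<delta>) \<le> 1"
    "0 \<le> T" "4 < exp T * \<delta>\<^sup>2" "C * mesh M powr \<theta> * japanese T powr p < 1 / 10000"
proof -
  \<comment> \<open>With q = s + 5 the fourth-power condition decays like M^(-1-s) and the Sobolev
    condition like M^(-4). With n = 2 q + 2 the quantity exp T * \<delta>^2 equals M^2, which
    exceeds 4 once M \<ge> 3.\<close>
  define q where "q = s + 5"
  define n where "n = 2 * q + 2"
  have e1: "eventually (\<lambda>x::real. pi / x \<le> h0) at_top" using assms by real_asymp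
  have e2: "eventually (\<lambda>x::real. (2 * x + 1) ^ 4 * x powr (- q) \<le> 1 / 1000) at_top"
    using assms unfolding q_def by real_asymp
  have e3: "eventually (\<lambda>x::real. sqrt (1 + (2 * x + 1)\<^sup>2) powr s * ((2 * x + 1) * x powr (- q)) \<le> 1) at_top"
    using assms unfolding q_def by real_asymp
  have e4: "eventually (\<lambda>x::real. C * (pi / x) powr \<theta> * (sqrt (1 + (n * ln x)\<^sup>2)) powr p < 1 / 10000) at_top"
    using assms unfolding n_def q_def by real_asymp
  have e5: "eventually (\<lambda>x::real. 3 \<le> x) at_top" by (rule eventually_ge_at_top)
  have "eventually (\<lambda>x::real. pi / x \<le> h0 \<and> (2 * x + 1) ^ 4 * x powr (- q) \<le> 1 / 1000 \<and>
      sqrt (1 + (2 * x + 1)\<^sup>2) powr s * ((2 * x + 1) * x powr (- q)) \<le> 1 \<and>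
      C * (pi / x) powr \<theta> * (sqrt (1 + (n * ln x)\<^sup>2)) powr p < 1 / 10000 \<and> 3 \<le> x) at_top"
    using e1 e2 e3 e4 e5 by eventually_elim blast
  then have "eventually (\<lambda>M::nat. pi / real M \<le> h0 \<and> (2 * real M + 1) ^ 4 * real M powr (- q) \<le> 1 / 1000 \<and>
      sqrt (1 + (2 * real M + 1)\<^sup>2) powr s * ((2 * real M + 1) * real M powr (- q)) \<le> 1 \<and>
      C * (pi / real M) powr \<theta> * (sqrt (1 + (n * ln (real M))\<^sup>2)) powr p < 1 / 10000 \<and> 3 \<le> real M) sequentially"
    by (rule eventually_compose_filterlim[OF _ filterlim_real_sequentially])
  then obtain M :: nat where M: "pi / real M \<le> h0" "(2 * real M + 1) ^ 4 * real M powr (- q) \<le> 1 / 1000"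
      "sqrt (1 + (2 * real M + 1)\<^sup>2) powr s * ((2 * real M + 1) * real M powr (- q)) \<le> 1"
      "C * (pi / real M) powr \<theta> * (sqrt (1 + (n * ln (real M))\<^sup>2)) powr p < 1 / 10000" "3 \<le> real M"
    unfolding eventually_sequentially by blast
  show ?thesis
  proof (rule that[of M "real M powr (- q)" "n * ln (real M)"])
    show "0 \<le> n * ln (real M)" using M(5) assms by (simp add: n_def q_def)
    have "exp (n * ln (real M)) * (real M powr (- q))\<^sup>2 = real M powr n * real M powr (2 * (- q))"
      using M(5) by (simp add: powr_def power2_eq_square flip: exp_add)
    also have "\<dots> = (real M)\<^sup>2"
      using M(5) by (simp add: n_def flip: powr_add)
    also have "3\<^sup>2 \<le> (real M)\<^sup>2" using M(5) by (intro power_mono) auto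
    then have "4 < (real M)\<^sup>2" by simp
    finally show "4 < exp (n * ln (real M)) * (real M powr (- q))\<^sup>2" .
  qed (use M in \<open>auto simp: mesh_def japanese_def\<close>)
qed

theorem proposition7p1:
  fixes \<rho> s \<Lambda> :: real and a :: "real \<Rightarrow> real"
  assumes "0 \<le> \<rho>" and "\<rho> < s"
    and "in_Linfinity a"
    and "s < 1 \<Longrightarrow> 0 < \<Lambda> \<and> \<Lambda> < 1 / 2"
  shows "\<exists>R>0. \<forall>\<theta>>0. \<forall>p\<ge>0.
    \<not> (\<exists>C>0. \<exists>h\<^sub>0>0. \<forall>M u\<^sub>0 u u\<^sub>h t.
         0 < M \<and> mesh M \<le> h\<^sub>0 \<and>
         in_Hs s u\<^sub>0 \<and> Hs_norm s u\<^sub>0 \<le> R \<and>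
         magnetic_nls_solution a (-1) u\<^sub>0 u \<and>
         lattice_solution s \<Lambda> a (-1) M u\<^sub>0 u\<^sub>h \<longrightarrow>
         in_Hs \<rho> (\<lambda>x. shannon M (u\<^sub>h t) x - u t x) \<and>
         Hs_norm \<rho> (\<lambda>x. shannon M (u\<^sub>h t) x - u t x)
           \<le> C * mesh M powr \<theta> * japanese t powr p)"
proof (intro exI[of _ 2] conjI allI impI notI)
  \<comment> \<open>The radius 2 is the bound for the Sobolev norm of the data given by
    \<open>datum_Hs\<close>; it holds for the data chosen for any \<theta> and p.\<close>
  fix \<theta> p :: real
  assume \<theta>: "0 < \<theta>" and p: "0 \<le> p"
  assume "\<exists>C>0. \<exists>h\<^sub>0>0. \<forall>M u\<^sub>0 u u\<^sub>h t.
         0 < M \<and> mesh M \<le> h\<^sub>0 \<and>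
         in_Hs s u\<^sub>0 \<and> Hs_norm s u\<^sub>0 \<le> 2 \<and>
         magnetic_nls_solution a (-1) u\<^sub>0 u \<and>
         lattice_solution s \<Lambda> a (-1) M u\<^sub>0 u\<^sub>h \<longrightarrow>
         in_Hs \<rho> (\<lambda>x. shannon M (u\<^sub>h t) x - u t x) \<and>
         Hs_norm \<rho> (\<lambda>x. shannon M (u\<^sub>h t) x - u t x)
           \<le> C * mesh M powr \<theta> * japanese t powr p"
  then obtain C h0 where C: "0 < C" "0 < h0" and est: "\<And>M u\<^sub>0 u u\<^sub>h t.
         0 < M \<Longrightarrow> mesh M \<le> h0 \<Longrightarrow> in_Hs s u\<^sub>0 \<Longrightarrow> Hs_norm s u\<^sub>0 \<le> 2 \<Longrightarrow>
         magnetic_nls_solution a (-1) u\<^sub>0 u \<Longrightarrow> lattice_solution s \<Lambda> a (-1) M u\<^sub>0 u\<^sub>h \<Longrightarrow>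
         in_Hs \<rho> (\<lambda>x. shannon M (u\<^sub>h t) x - u t x) \<and>
         Hs_norm \<rho> (\<lambda>x. shannon M (u\<^sub>h t) x - u t x) \<le> C * mesh M powr \<theta> * japanese t powr p"
    by auto
  have s: "0 \<le> s" using assms(1,2) by simp
  obtain M :: nat and \<delta> T :: real where M: "1 \<le> M" "mesh M \<le> h0" and \<delta>: "0 < \<delta>"
    "(2 * real M + 1) ^ 4 * \<delta> \<le> 1 / 1000"
    "japanese (2 * real M + 1) powr s * ((2 * real M + 1) * \<delta>) \<le> 1"
    and T: "0 \<le> T" "4 < exp T * \<delta>\<^sup>2" "C * mesh M powr \<theta> * japanese T powr p < 1 / 10000"
    using parameters_exist[OF \<theta> p C s] by metis
  let ?u0 = "trig (2 * M + 1) (datum M \<delta>)"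
  obtain v t k where v: "cubic_nls_solution (-1) ?u0 v"
    and vt: "\<And>t. continuous_on UNIV (v t)" and per: "\<And>t x. v t (x + 2 * pi) = v t x"
    and t: "0 \<le> t" "t \<le> T" and k: "k \<noteq> 0" "1 / 10000 \<le> cmod (fc (v t) k)"
    using unstable_solution[OF M(1) \<delta>(1,2) T(1,2)] by metis
  define u where "u t = inv (gauge_transform a t) (v t)" for t
  have u: "magnetic_nls_solution a (-1) ?u0 u"
    unfolding magnetic_nls_solution_def u_def using v by blast
  obtain \<psi> where w: "lattice_solution s \<Lambda> a (-1) M ?u0 (\<lambda>t x. cis (\<psi> t))"
  proof (rule lattice_solution_const)
    show "0 < M" using M(1) by simp
    show "a \<in> borel_measurable lebesgue" using assms(3) by (simp add: in_Linfinity_def)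
    show "s < 1 \<Longrightarrow> 0 \<le> \<Lambda>" using assms(4) by auto
  qed (rule cell_average_datum[OF M(1)])
  have sh: "shannon M (\<lambda>x. cis (\<psi> t)) x = cis (\<psi> t)" for x
    by (rule shannon_const) (use M(1) in auto)
  let ?f = "\<lambda>x. shannon M (\<lambda>x. cis (\<psi> t)) x - u t x"
  have "in_Hs \<rho> ?f \<and> Hs_norm \<rho> ?f \<le> C * mesh M powr \<theta> * japanese t powr p"
    by (rule est[OF _ M(2) datum_Hs[OF M(1) s \<delta>(1,3)] u w]) (use M(1) in simp)
  then have f: "in_Hs \<rho> ?f" "Hs_norm \<rho> ?f \<le> C * mesh M powr \<theta> * japanese t powr p" by auto
  \<comment> \<open>At the fixed time t the gauge amounts to two real constants, a phase and a
    shift, whose values disappear in the modulus of the k-th coefficient. The spatially constant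
    lattice solution does not contribute because k is nonzero.\<close>
  define A Y where "A = (LINT \<tau>=0..t|lebesgue. ((a \<tau>)\<^sup>2))" and "Y = 2 * (LINT \<tau>=0..t|lebesgue. (a \<tau>))"
  have ut: "u t = (\<lambda>x. cis (- A) * v t (x + Y))"
    unfolding u_def inv_gauge_transform A_def Y_def ..
  have vs: "continuous_on UNIV (\<lambda>x. v t (x + Y))"
    by (rule continuous_on_compose2[OF vt]) (auto intro!: continuous_intros)
  have "fourier_coeff ?f k = fc (\<lambda>x. cis (\<psi> t) - cis (- A) * v t (x + Y)) k"
    unfolding sh ut by (rule fourier_coeff_eq_fc) (intro continuous_intros vs)
  also have "\<dots> = fc (\<lambda>x. cis (\<psi> t)) k - fc (\<lambda>x. cis (- A) * v t (x + Y)) k"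
    by (rule fc_diff) (intro continuous_intros vs)+
  also have "\<dots> = - (cis (- A) * fc (\<lambda>x. v t (x + Y)) k)"
    using k(1) by (simp add: fc_const fc_mult_left[OF vs])
  finally have "cmod (fourier_coeff ?f k) = cmod (fc (v t) k)"
    by (simp add: norm_mult cmod_fc_translate[OF vt per])
  then have "1 / 10000 \<le> Hs_norm \<rho> ?f"
    using fourier_coeff_le_Hs_norm[OF f(1) assms(1), of k] k(2) by simp
  also have "\<dots> \<le> C * mesh M powr \<theta> * japanese t powr p" by (rule f(2))
  also have "\<dots> \<le> C * mesh M powr \<theta> * japanese T powr p"
  proof (intro mult_left_mono powr_mono2)
    show "japanese t \<le> japanese T" using t by (simp add: japanese_def power_mono)
    show "0 \<le> japanese t" by (simp add: japanese_def)
  qed (use p C in auto)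
  also have "\<dots> < 1 / 10000" by (rule T(3))
  finally show False by simp
qed simp

end
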